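(* Let $\mathbf{C}$ and $\mathbf{S}$ be symmetric monoidal categories and let $\mathsf{R}\colon \mathbf{S}\to\mathbf{C}$ be a symmetric (strong) monoidal functor. Then the category of structured stateful processes $\mathsf{St}(\mathbf{C},\mathsf{R})$, endowed with the operator $\mathsf{store}(\bullet)$, is the free structured feedback category over $\mathbf{C}$ with $\mathsf{R}\colon\mathbf{S}\to\mathbf{C}$. Explicitly, $(\mathsf{St}(\mathbf{C},\mathsf{R}),\mathbf{S},\mathsf{R};\iota,\mathsf{store})$ is a structured feedback category, where $\iota\colon\mathbf{C}\to\mathsf{St}(\mathbf{C},\mathsf{R})$ is the canonical identity-on-objects symmetric monoidal functor; and for every structured feedback category $(\mathbf{C}',\mathbf{S}',\mathsf{R}',\mathsf{fbk}')$ and every pair of symmetric strong monoidal functors $F\colon\mathbf{C}\to\mathbf{C}'$ and $G\colon\mathbf{S}\to\mathbf{S}'$ with $\mathsf{R};F = G;\mathsf{R}'$ (as monoidal functors), there is a unique structured feedback functor of the form $(\widetilde F,G)\colon \mathsf{St}(\mathbf{C},\mathsf{R})\to\mathbf{C}'$ with $\iota;\widetilde F=F$ (as monoidal functors).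
   Context: Composition $f ; g$ is in diagrammatic order; associators and unitors are suppressed. **Structured feedback category.** A symmetric monoidal category $(\mathbf{C},\otimes,I)$, a symmetric monoidal category $(\mathbf{S},\boxtimes,J)$ and a symmetric strong monoidal functor $(\mathsf{R},\varepsilon,\mu)\colon\mathbf{S}\to\mathbf{C}$ (with isomorphisms $\varepsilon\colon I\to \mathsf{R}J$ and $\mu\colon \mathsf{R}S\otimes \mathsf{R}T\to \mathsf{R}(S\boxtimes T)$), endowed with operators $\mathsf{fbk}_S\colon\mathbf{C}(\mathsf{R}S\otimes A,\mathsf{R}S\otimes B)\to\mathbf{C}(A,B)$ for $S \in \mathbf{S}$, $A,B\in\mathbf{C}$, satisfying: - (Tightening) $u;\mathsf{fbk}_S(f);v=\mathsf{fbk}_S((\mathrm{id}\otimes u);f;(\mathrm{id}\otimes v))$ for $f\colon\mathsf{R}S\otimes A\to\mathsf{R}S\otimes B$, $u\colon A'\to A$, $v\colon B\to B'$. - (Vanishing) $\mathsf{fbk}_J((\varepsilon^{-1}\otimes \mathrm{id});f;(\varepsilon\otimes \mathrm{id}))=f$ for $f\colon A\to B$. - (Joining) $\mathsf{fbk}_T(\mathsf{fbk}_S(f))=\mathsf{fbk}_{S\boxtimes T}((\mu^{-1}\otimes \mathrm{id});f;(\mu\otimes \mathrm{id}))$ for $f\colon \mathsf{R}S\otimes\mathsf{R}T\otimes A\to\mathsf{R}S\otimes\mathsf{R}T\otimes B$. - (Strength) $\mathsf{fbk}_S(f)\otimes g=\mathsf{fbk}_S(f\otimes g)$ for $f\colon\mathsf{R}S\otimes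 A\to\mathsf{R}S\otimes B$, $g\colon A'\to B'$. - (Sliding) $\mathsf{fbk}_T(f;(\mathsf{R}h\otimes \mathrm{id}))=\mathsf{fbk}_S((\mathsf{R}h\otimes \mathrm{id});f)$ for every $f\colon\mathsf{R}T\otimes A\to\mathsf{R}S\otimes B$ and every $h\colon S\to T$ in $\mathbf{S}$. **Structured feedback functor** from $(\mathbf{C},\mathbf{S},\mathsf{R},\mathsf{fbk})$ to $(\mathbf{C}',\mathbf{S}',\mathsf{R}',\mathsf{fbk}')$: a pair of symmetric strong monoidal functors $(F,\varepsilon^F,\mu^F)\colon\mathbf{C}\to\mathbf{C}'$, $G\colon\mathbf{S}\to\mathbf{S}'$ with $\mathsf{R};F=G;\mathsf{R}'$ and $F(\mathsf{fbk}_S(f))=\mathsf{fbk}'_{GS}(\mu^F;Ff;(\mu^F)^{-1})$. **Category $\mathsf{St}(\mathbf{C},\mathsf{R})$ of structured stateful processes.** Objects are those of $\mathbf{C}$. Morphisms $A\to B$ are pairs $(S\mid f)$ with $S\in\mathbf{S}$, $f\colon\mathsf{R}S\otimes A\to\mathsf{R}S\otimes B$, modulo the equivalence relation generated by $(S\mid(\mathsf{R}h\otimes \mathrm{id});f)\sim(T\mid f;(\mathsf{R}h\otimes \mathrm{id}))$ for $h\colon S\to T$ in $\mathbf{S}$ and $f\colon \mathsf{R}T\otimes A\to\mathsf{R}S\otimes B$. Up to the coherence isomorphisms $\varepsilon,\mu$ of $\mathsf{R}$ (and with $\sigma$ the symmetry of $\mathbf{C}$): the identity on $A$ is $(J\mid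 \mathrm{id})$; the composite of $(S\mid f)\colon A\to B$ and $(T\mid g)\colon B\to C$ is $(S\boxtimes T\mid(\sigma\otimes \mathrm{id});(\mathrm{id}\otimes f);(\sigma\otimes \mathrm{id});(\mathrm{id}\otimes g))$; the tensor of $(S\mid f)$ and $(S'\mid f')$ is $(S\boxtimes S'\mid(\mathrm{id}\otimes\sigma\otimes \mathrm{id});(f\otimes f');(\mathrm{id}\otimes\sigma\otimes \mathrm{id}))$; and $\mathsf{store}_T(S\mid f)=(S\boxtimes T\mid f)$ for $f\colon\mathsf{R}S\otimes\mathsf{R}T\otimes A\to\mathsf{R}S\otimes\mathsf{R}T\otimes B$. The functor $\iota$ sends $f\colon A\to B$ to $(J\mid(\varepsilon^{-1}\otimes \mathrm{id});f;(\varepsilon\otimes \mathrm{id}))$, and is strict monoidal. *)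

theory Defs
  imports Main
begin

text \<open>
  Composition is in diagrammatic order throughout.  Monoidal categories are not assumed to be
  strict: all associators and unitors are explicit.  All operations are total functions that are
  constrained only on the carriers \<open>Obj\<close> and \<open>Arr\<close>.
\<close>

section \<open>Symmetric monoidal categories\<close>

record ('o, 'a) cat =
  Obj :: "'o set"
  Arr :: "'a set"
  Dom :: "'a \<Rightarrow> 'o"
  Cod :: "'a \<Rightarrow> 'o"
  Ide :: "'o \<Rightarrow> 'a"  ("\<one>\<index>")
  Comp :: "'a \<Rightarrow> 'a \<Rightarrow> 'a"  (infixl "\<Zcomp>\<index>" 65)

record ('o, 'a) smc = "('o, 'a) cat" +
  TUnit :: "'o"  ("\<I>\<index>")
  OTensor :: "'o \<Rightarrow> 'o \<Rightarrow> 'o"  (infixl "\<odot>\<index>" 70)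
  ATensor :: "'a \<Rightarrow> 'a \<Rightarrow> 'a"  (infixl "\<otimes>\<index>" 70)
  Assoc :: "'o \<Rightarrow> 'o \<Rightarrow> 'o \<Rightarrow> 'a"  ("\<alpha>\<index>")
  LUnitor :: "'o \<Rightarrow> 'a"  ("\<lambda>\<index>'_")
  RUnitor :: "'o \<Rightarrow> 'a"  ("\<rho>\<index>")
  Symm :: "'o \<Rightarrow> 'o \<Rightarrow> 'a"  ("\<sigma>\<index>")

definition hom :: "('o, 'a, 'm) cat_scheme \<Rightarrow> 'o \<Rightarrow> 'o \<Rightarrow> 'a set" where
  "hom C A B = {f \<in> Arr C. Dom C f = A \<and> Cod C f = B}"

definition inverse_arrows :: "('o, 'a, 'm) cat_scheme \<Rightarrow> 'a \<Rightarrow> 'a \<Rightarrow> bool" where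
  "inverse_arrows C f g \<longleftrightarrow>
     f \<in> Arr C \<and> g \<in> hom C (Cod C f) (Dom C f) \<and>
     f \<Zcomp>\<^bsub>C\<^esub> g = \<one>\<^bsub>C\<^esub> (Dom C f) \<and> g \<Zcomp>\<^bsub>C\<^esub> f = \<one>\<^bsub>C\<^esub> (Cod C f)"

definition is_iso :: "('o, 'a, 'm) cat_scheme \<Rightarrow> 'a \<Rightarrow> bool" where
  "is_iso C f \<longleftrightarrow> (\<exists>g. inverse_arrows C f g)"

definition inv_arr :: "('o, 'a, 'm) cat_scheme \<Rightarrow> 'a \<Rightarrow> 'a"  ("inv\<index> _" [81] 80) where
  "inv\<^bsub>C\<^esub> f = (THE g. inverse_arrows C f g)"

locale category =
  fixes C :: "('o, 'a, 'm) cat_scheme" (structure)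
  assumes Dom_Obj: "f \<in> Arr C \<Longrightarrow> Dom C f \<in> Obj C"
    and Cod_Obj: "f \<in> Arr C \<Longrightarrow> Cod C f \<in> Obj C"
    and Ide_hom: "A \<in> Obj C \<Longrightarrow> \<one> A \<in> hom C A A"
    and Comp_hom: "\<lbrakk>f \<in> hom C A B; g \<in> hom C B D\<rbrakk> \<Longrightarrow> f \<Zcomp> g \<in> hom C A D"
    and Comp_Ide_left: "f \<in> hom C A B \<Longrightarrow> \<one> A \<Zcomp> f = f"
    and Comp_Ide_right: "f \<in> hom C A B \<Longrightarrow> f \<Zcomp> \<one> B = f"
    and Comp_assoc: "\<lbrakk>f \<in> hom C A B; g \<in> hom C B D; h \<in> hom C D E\<rbrakk>
      \<Longrightarrow> (f \<Zcomp> g) \<Zcomp> h = f \<Zcomp> (g \<Zcomp> h)"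

locale symmetric_monoidal_category = category C
  for C :: "('o, 'a) smc" (structure) +
  assumes TUnit_Obj: "\<I> \<in> Obj C"
    and OTensor_Obj: "\<lbrakk>A \<in> Obj C; B \<in> Obj C\<rbrakk> \<Longrightarrow> A \<odot> B \<in> Obj C"
    and ATensor_hom: "\<lbrakk>f \<in> hom C A B; g \<in> hom C A' B'\<rbrakk>
      \<Longrightarrow> f \<otimes> g \<in> hom C (A \<odot> A') (B \<odot> B')"
    and ATensor_Ide: "\<lbrakk>A \<in> Obj C; B \<in> Obj C\<rbrakk> \<Longrightarrow> \<one> A \<otimes> \<one> B = \<one> (A \<odot> B)"
    and ATensor_Comp: "\<lbrakk>f \<in> hom C A B; g \<in> hom C B D; f' \<in> hom C A' B'; g' \<in> hom C B' D'\<rbrakk>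
      \<Longrightarrow> (f \<Zcomp> g) \<otimes> (f' \<Zcomp> g') = (f \<otimes> f') \<Zcomp> (g \<otimes> g')"
    and Assoc_hom: "\<lbrakk>A \<in> Obj C; B \<in> Obj C; D \<in> Obj C\<rbrakk>
      \<Longrightarrow> \<alpha> A B D \<in> hom C (A \<odot> B \<odot> D) (A \<odot> (B \<odot> D))"
    and Assoc_iso: "\<lbrakk>A \<in> Obj C; B \<in> Obj C; D \<in> Obj C\<rbrakk> \<Longrightarrow> is_iso C (\<alpha> A B D)"
    and Assoc_natural: "\<lbrakk>f \<in> hom C A A'; g \<in> hom C B B'; h \<in> hom C D D'\<rbrakk>
      \<Longrightarrow> (f \<otimes> g \<otimes> h) \<Zcomp> \<alpha> A' B' D' = \<alpha> A B D \<Zcomp> (f \<otimes> (g \<otimes> h))"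
    and LUnitor_hom: "A \<in> Obj C \<Longrightarrow> \<lambda>_ A \<in> hom C (\<I> \<odot> A) A"
    and LUnitor_iso: "A \<in> Obj C \<Longrightarrow> is_iso C (\<lambda>_ A)"
    and LUnitor_natural: "f \<in> hom C A B \<Longrightarrow> (\<one> \<I> \<otimes> f) \<Zcomp> \<lambda>_ B = \<lambda>_ A \<Zcomp> f"
    and RUnitor_hom: "A \<in> Obj C \<Longrightarrow> \<rho> A \<in> hom C (A \<odot> \<I>) A"
    and RUnitor_iso: "A \<in> Obj C \<Longrightarrow> is_iso C (\<rho> A)"
    and RUnitor_natural: "f \<in> hom C A B \<Longrightarrow> (f \<otimes> \<one> \<I>) \<Zcomp> \<rho> B = \<rho> A \<Zcomp> f"
    and Symm_hom: "\<lbrakk>A \<in> Obj C; B \<in> Obj C\<rbrakk> \<Longrightarrow> \<sigma> A B \<in> hom C (A \<odot> B) (B \<odot> A)"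
    and Symm_natural: "\<lbrakk>f \<in> hom C A A'; g \<in> hom C B B'\<rbrakk>
      \<Longrightarrow> (f \<otimes> g) \<Zcomp> \<sigma> A' B' = \<sigma> A B \<Zcomp> (g \<otimes> f)"
    and Symm_inverse: "\<lbrakk>A \<in> Obj C; B \<in> Obj C\<rbrakk> \<Longrightarrow> \<sigma> A B \<Zcomp> \<sigma> B A = \<one> (A \<odot> B)"
    and pentagon: "\<lbrakk>A \<in> Obj C; B \<in> Obj C; D \<in> Obj C; E \<in> Obj C\<rbrakk>
      \<Longrightarrow> (\<alpha> A B D \<otimes> \<one> E) \<Zcomp> \<alpha> A (B \<odot> D) E \<Zcomp> (\<one> A \<otimes> \<alpha> B D E)
          = \<alpha> (A \<odot> B) D E \<Zcomp> \<alpha> A B (D \<odot> E)"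
    and triangle: "\<lbrakk>A \<in> Obj C; B \<in> Obj C\<rbrakk>
      \<Longrightarrow> \<alpha> A \<I> B \<Zcomp> (\<one> A \<otimes> \<lambda>_ B) = \<rho> A \<otimes> \<one> B"
    and hexagon: "\<lbrakk>A \<in> Obj C; B \<in> Obj C; D \<in> Obj C\<rbrakk>
      \<Longrightarrow> \<alpha> A B D \<Zcomp> \<sigma> A (B \<odot> D) \<Zcomp> \<alpha> B D A
          = (\<sigma> A B \<otimes> \<one> D) \<Zcomp> \<alpha> B A D \<Zcomp> (\<one> B \<otimes> \<sigma> A D)"

section \<open>Symmetric strong monoidal functors\<close>

record ('o, 'a, 'p, 'b) mfunctor =
  OMap :: "'o \<Rightarrow> 'p"
  AMap :: "'a \<Rightarrow> 'b"
  Eps :: "'b"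
  Mu :: "'o \<Rightarrow> 'o \<Rightarrow> 'b"

locale symmetric_monoidal_functor =
  C: symmetric_monoidal_category C + D: symmetric_monoidal_category D
  for C :: "('o, 'a) smc" and D :: "('p, 'b) smc" (structure)
    and F :: "('o, 'a, 'p, 'b) mfunctor" +
  assumes OMap_Obj: "A \<in> Obj C \<Longrightarrow> OMap F A \<in> Obj D"
    and AMap_hom: "f \<in> hom C A B \<Longrightarrow> AMap F f \<in> hom D (OMap F A) (OMap F B)"
    and AMap_Ide: "A \<in> Obj C \<Longrightarrow> AMap F (\<one>\<^bsub>C\<^esub> A) = \<one> (OMap F A)"
    and AMap_Comp: "\<lbrakk>f \<in> hom C A B; g \<in> hom C B E\<rbrakk>
      \<Longrightarrow> AMap F (f \<Zcomp>\<^bsub>C\<^esub> g) = AMap F f \<Zcomp> AMap F g"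
    and Eps_hom: "Eps F \<in> hom D \<I> (OMap F \<I>\<^bsub>C\<^esub>)"
    and Eps_iso: "is_iso D (Eps F)"
    and Mu_hom: "\<lbrakk>A \<in> Obj C; B \<in> Obj C\<rbrakk>
      \<Longrightarrow> Mu F A B \<in> hom D (OMap F A \<odot> OMap F B) (OMap F (A \<odot>\<^bsub>C\<^esub> B))"
    and Mu_iso: "\<lbrakk>A \<in> Obj C; B \<in> Obj C\<rbrakk> \<Longrightarrow> is_iso D (Mu F A B)"
    and Mu_natural: "\<lbrakk>f \<in> hom C A A'; g \<in> hom C B B'\<rbrakk>
      \<Longrightarrow> (AMap F f \<otimes> AMap F g) \<Zcomp> Mu F A' B' = Mu F A B \<Zcomp> AMap F (f \<otimes>\<^bsub>C\<^esub> g)"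
    and Mu_Assoc: "\<lbrakk>A \<in> Obj C; B \<in> Obj C; E \<in> Obj C\<rbrakk>
      \<Longrightarrow> (Mu F A B \<otimes> \<one> (OMap F E)) \<Zcomp> Mu F (A \<odot>\<^bsub>C\<^esub> B) E \<Zcomp> AMap F (\<alpha>\<^bsub>C\<^esub> A B E)
          = \<alpha> (OMap F A) (OMap F B) (OMap F E) \<Zcomp> (\<one> (OMap F A) \<otimes> Mu F B E)
            \<Zcomp> Mu F A (B \<odot>\<^bsub>C\<^esub> E)"
    and Mu_LUnitor: "A \<in> Obj C
      \<Longrightarrow> (Eps F \<otimes> \<one> (OMap F A)) \<Zcomp> Mu F \<I>\<^bsub>C\<^esub> A \<Zcomp> AMap F (\<lambda>\<^bsub>C\<^esub>_ A) = \<lambda>_ (OMap F A)"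
    and Mu_RUnitor: "A \<in> Obj C
      \<Longrightarrow> (\<one> (OMap F A) \<otimes> Eps F) \<Zcomp> Mu F A \<I>\<^bsub>C\<^esub> \<Zcomp> AMap F (\<rho>\<^bsub>C\<^esub> A) = \<rho> (OMap F A)"
    and Mu_Symm: "\<lbrakk>A \<in> Obj C; B \<in> Obj C\<rbrakk>
      \<Longrightarrow> Mu F A B \<Zcomp> AMap F (\<sigma>\<^bsub>C\<^esub> A B) = \<sigma> (OMap F A) (OMap F B) \<Zcomp> Mu F B A"

text \<open>The composite \<open>F ; G\<close> of monoidal functors, where \<open>E\<close> is the codomain of \<open>G\<close>.\<close>

definition mf_comp ::
  "('r, 'c) smc \<Rightarrow> ('o, 'a, 'p, 'b) mfunctor \<Rightarrow> ('p, 'b, 'r, 'c) mfunctor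
    \<Rightarrow> ('o, 'a, 'r, 'c) mfunctor" where
  "mf_comp E F G =
    \<lparr>OMap = (\<lambda>A. OMap G (OMap F A)),
     AMap = (\<lambda>f. AMap G (AMap F f)),
     Eps = Eps G \<Zcomp>\<^bsub>E\<^esub> AMap G (Eps F),
     Mu = (\<lambda>A B. Mu G (OMap F A) (OMap F B) \<Zcomp>\<^bsub>E\<^esub> AMap G (Mu F A B))\<rparr>"

text \<open>
  Equality of monoidal functors out of \<open>C\<close>, including the structure maps.  It compares values on
  the carriers of \<open>C\<close> only, because the values elsewhere are meaningless.
\<close>

definition mf_eq ::
  "('o, 'a) smc \<Rightarrow> ('o, 'a, 'p, 'b) mfunctor \<Rightarrow> ('o, 'a, 'p, 'b) mfunctor \<Rightarrow> bool" where
  "mf_eq C F G \<longleftrightarrow>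
     (\<forall>A \<in> Obj C. OMap F A = OMap G A) \<and>
     (\<forall>f \<in> Arr C. AMap F f = AMap G f) \<and>
     Eps F = Eps G \<and>
     (\<forall>A \<in> Obj C. \<forall>B \<in> Obj C. Mu F A B = Mu G A B)"

section \<open>Structured feedback categories\<close>

context
  fixes C :: "('o, 'a) smc" (structure)
    and S :: "('s, 'h) smc"
    and R :: "('s, 'h, 'o, 'a) mfunctor"
begin

text \<open>\<open>(\<epsilon>\<inverse> \<otimes> id) ; f ; (\<epsilon> \<otimes> id)\<close>, of type \<open>RJ \<odot> A \<rightarrow> RJ \<odot> B\<close>, for \<open>f : A \<rightarrow> B\<close>.\<close>

definition unit_state :: "'o \<Rightarrow> 'o \<Rightarrow> 'a \<Rightarrow> 'a" where
  "unit_state A B f =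
     (inv (Eps R) \<otimes> \<one> A) \<Zcomp> \<lambda>_ A \<Zcomp> f \<Zcomp> inv (\<lambda>_ B) \<Zcomp> (Eps R \<otimes> \<one> B)"

text \<open>
  \<open>(\<mu>\<inverse> \<otimes> id) ; f ; (\<mu> \<otimes> id)\<close>, of type \<open>R(s \<odot> t) \<odot> A \<rightarrow> R(s \<odot> t) \<odot> B\<close>, for
  \<open>f : Rs \<odot> (Rt \<odot> A) \<rightarrow> Rs \<odot> (Rt \<odot> B)\<close>.
\<close>

definition join_state :: "'s \<Rightarrow> 's \<Rightarrow> 'o \<Rightarrow> 'o \<Rightarrow> 'a \<Rightarrow> 'a" where
  "join_state s t A B f =
     (inv (Mu R s t) \<otimes> \<one> A) \<Zcomp> \<alpha> (OMap R s) (OMap R t) A \<Zcomp> f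
     \<Zcomp> inv (\<alpha> (OMap R s) (OMap R t) B) \<Zcomp> (Mu R s t \<otimes> \<one> B)"

end

text \<open>
  \<open>fbk s A B\<close> is the operator from \<open>hom C (Rs \<odot> A) (Rs \<odot> B)\<close> to \<open>hom C A B\<close>; the objects \<open>A\<close>
  and \<open>B\<close> are arguments because they cannot be recovered from \<open>Rs \<odot> A\<close> and \<open>Rs \<odot> B\<close>.
\<close>

locale structured_feedback_category =
  R: symmetric_monoidal_functor S C R
  for C :: "('o, 'a) smc" (structure)
    and S :: "('s, 'h) smc"
    and R :: "('s, 'h, 'o, 'a) mfunctor" +
  fixes fbk :: "'s \<Rightarrow> 'o \<Rightarrow> 'o \<Rightarrow> 'a \<Rightarrow> 'a"
  assumes fbk_hom:
    "\<lbrakk>s \<in> Obj S; A \<in> Obj C; B \<in> Obj C; f \<in> hom C (OMap R s \<odot> A) (OMap R s \<odot> B)\<rbrakk>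
      \<Longrightarrow> fbk s A B f \<in> hom C A B"
    and tightening:
    "\<lbrakk>s \<in> Obj S; A \<in> Obj C; B \<in> Obj C; f \<in> hom C (OMap R s \<odot> A) (OMap R s \<odot> B);
      u \<in> hom C A' A; v \<in> hom C B B'\<rbrakk>
      \<Longrightarrow> u \<Zcomp> fbk s A B f \<Zcomp> v
          = fbk s A' B' ((\<one> (OMap R s) \<otimes> u) \<Zcomp> f \<Zcomp> (\<one> (OMap R s) \<otimes> v))"
    and vanishing:
    "f \<in> hom C A B \<Longrightarrow> fbk \<I>\<^bsub>S\<^esub> A B (unit_state C R A B f) = f"
    and joining:
    "\<lbrakk>s \<in> Obj S; t \<in> Obj S; A \<in> Obj C; B \<in> Obj C;
      f \<in> hom C (OMap R s \<odot> (OMap R t \<odot> A)) (OMap R s \<odot> (OMap R t \<odot> B))\<rbrakk>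
      \<Longrightarrow> fbk t A B (fbk s (OMap R t \<odot> A) (OMap R t \<odot> B) f)
          = fbk (s \<odot>\<^bsub>S\<^esub> t) A B (join_state C R s t A B f)"
    and strength:
    "\<lbrakk>s \<in> Obj S; A \<in> Obj C; B \<in> Obj C; f \<in> hom C (OMap R s \<odot> A) (OMap R s \<odot> B);
      g \<in> hom C A' B'\<rbrakk>
      \<Longrightarrow> fbk s A B f \<otimes> g
          = fbk s (A \<odot> A') (B \<odot> B')
              (inv (\<alpha> (OMap R s) A A') \<Zcomp> (f \<otimes> g) \<Zcomp> \<alpha> (OMap R s) B B')"
    and sliding:
    "\<lbrakk>h \<in> hom S s t; A \<in> Obj C; B \<in> Obj C; f \<in> hom C (OMap R t \<odot> A) (OMap R s \<odot> B)\<rbrakk>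
      \<Longrightarrow> fbk t A B (f \<Zcomp> (AMap R h \<otimes> \<one> B)) = fbk s A B ((AMap R h \<otimes> \<one> A) \<Zcomp> f)"

locale structured_feedback_functor =
  C: structured_feedback_category C S R fbk +
  C': structured_feedback_category C' S' R' fbk' +
  F: symmetric_monoidal_functor C C' F +
  G: symmetric_monoidal_functor S S' G
  for C :: "('o, 'a) smc"
    and S :: "('s, 'h) smc"
    and R :: "('s, 'h, 'o, 'a) mfunctor"
    and fbk :: "'s \<Rightarrow> 'o \<Rightarrow> 'o \<Rightarrow> 'a \<Rightarrow> 'a"
    and C' :: "('p, 'b) smc" (structure)
    and S' :: "('t, 'k) smc"
    and R' :: "('t, 'k, 'p, 'b) mfunctor"
    and fbk' :: "'t \<Rightarrow> 'p \<Rightarrow> 'p \<Rightarrow> 'b \<Rightarrow> 'b"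
    and F :: "('o, 'a, 'p, 'b) mfunctor"
    and G :: "('s, 'h, 't, 'k) mfunctor" +
  assumes square: "mf_eq S (mf_comp C' R F) (mf_comp C' G R')"
    and preserves_fbk:
    "\<lbrakk>s \<in> Obj S; A \<in> Obj C; B \<in> Obj C;
      f \<in> hom C (OMap R s \<odot>\<^bsub>C\<^esub> A) (OMap R s \<odot>\<^bsub>C\<^esub> B)\<rbrakk>
      \<Longrightarrow> AMap F (fbk s A B f)
          = fbk' (OMap G s) (OMap F A) (OMap F B)
              (Mu F (OMap R s) A \<Zcomp> AMap F f \<Zcomp> inv (Mu F (OMap R s) B))"

section \<open>Structured stateful processes\<close>

context
  fixes C :: "('o, 'a) smc" (structure)
    and S :: "('s, 'h) smc"
    and R :: "('s, 'h, 'o, 'a) mfunctor"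
begin

definition processes :: "'o \<Rightarrow> 'o \<Rightarrow> ('s \<times> 'a) set" where
  "processes A B = {(s, f). s \<in> Obj S \<and> f \<in> hom C (OMap R s \<odot> A) (OMap R s \<odot> B)}"

definition slides :: "'o \<Rightarrow> 'o \<Rightarrow> (('s \<times> 'a) \<times> ('s \<times> 'a)) set" where
  "slides A B =
     {((s, (AMap R h \<otimes> \<one> A) \<Zcomp> f), (t, f \<Zcomp> (AMap R h \<otimes> \<one> B))) | s t h f.
        h \<in> hom S s t \<and> f \<in> hom C (OMap R t \<odot> A) (OMap R s \<odot> B)}"

definition process_rel :: "'o \<Rightarrow> 'o \<Rightarrow> (('s \<times> 'a) \<times> ('s \<times> 'a)) set" where
  "process_rel A B = Restr ((slides A B \<union> (slides A B)\<inverse>)\<^sup>*) (processes A B)"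

text \<open>
  A morphism of \<open>St(C,R)\<close> carries its domain and codomain together with a class of processes.
\<close>

definition St_class :: "'o \<Rightarrow> 'o \<Rightarrow> 's \<times> 'a \<Rightarrow> 'o \<times> 'o \<times> ('s \<times> 'a) set" where
  "St_class A B p = (A, B, process_rel A B `` {p})"

definition St_Arr :: "('o \<times> 'o \<times> ('s \<times> 'a) set) set" where
  "St_Arr = {(A, B, X) | A B X. A \<in> Obj C \<and> B \<in> Obj C \<and> X \<in> processes A B // process_rel A B}"

definition comp_state :: "'o \<Rightarrow> 'o \<Rightarrow> 'o \<Rightarrow> 's \<times> 'a \<Rightarrow> 's \<times> 'a \<Rightarrow> 's \<times> 'a" where
  "comp_state A B D = (\<lambda>(s, f) (t, g).
     (s \<odot>\<^bsub>S\<^esub> t,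
      (inv (Mu R s t) \<otimes> \<one> A)
      \<Zcomp> (\<sigma> (OMap R s) (OMap R t) \<otimes> \<one> A)
      \<Zcomp> \<alpha> (OMap R t) (OMap R s) A \<Zcomp> (\<one> (OMap R t) \<otimes> f) \<Zcomp> inv (\<alpha> (OMap R t) (OMap R s) B)
      \<Zcomp> (\<sigma> (OMap R t) (OMap R s) \<otimes> \<one> B)
      \<Zcomp> \<alpha> (OMap R s) (OMap R t) B \<Zcomp> (\<one> (OMap R s) \<otimes> g) \<Zcomp> inv (\<alpha> (OMap R s) (OMap R t) D)
      \<Zcomp> (Mu R s t \<otimes> \<one> D)))"

text \<open>\<open>id \<otimes> \<sigma> \<otimes> id : (W \<odot> X) \<odot> (Y \<odot> Z) \<rightarrow> (W \<odot> Y) \<odot> (X \<odot> Z)\<close>\<close>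

definition middle_swap :: "'o \<Rightarrow> 'o \<Rightarrow> 'o \<Rightarrow> 'o \<Rightarrow> 'a" where
  "middle_swap W X Y Z =
     \<alpha> W X (Y \<odot> Z)
     \<Zcomp> (\<one> W \<otimes> (inv (\<alpha> X Y Z) \<Zcomp> (\<sigma> X Y \<otimes> \<one> Z) \<Zcomp> \<alpha> Y X Z))
     \<Zcomp> inv (\<alpha> W Y (X \<odot> Z))"

definition tensor_state ::
  "'o \<Rightarrow> 'o \<Rightarrow> 'o \<Rightarrow> 'o \<Rightarrow> 's \<times> 'a \<Rightarrow> 's \<times> 'a \<Rightarrow> 's \<times> 'a" where
  "tensor_state A B A' B' = (\<lambda>(s, f) (s', f').
     (s \<odot>\<^bsub>S\<^esub> s',
      (inv (Mu R s s') \<otimes> \<one> (A \<odot> A'))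
      \<Zcomp> middle_swap (OMap R s) (OMap R s') A A'
      \<Zcomp> (f \<otimes> f')
      \<Zcomp> middle_swap (OMap R s) B (OMap R s') B'
      \<Zcomp> (Mu R s s' \<otimes> \<one> (B \<odot> B'))))"

definition iota_arr :: "'a \<Rightarrow> 'o \<times> 'o \<times> ('s \<times> 'a) set" where
  "iota_arr f =
     St_class (Dom C f) (Cod C f) (\<I>\<^bsub>S\<^esub>, unit_state C R (Dom C f) (Cod C f) f)"

text \<open>
  Operations on classes are unions over all representatives.
\<close>

definition St :: "('o, 'o \<times> 'o \<times> ('s \<times> 'a) set) smc" where
  "St =
    \<lparr>Obj = Obj C,
     Arr = St_Arr,
     Dom = (\<lambda>(A, B, X). A),
     Cod = (\<lambda>(A, B, X). B),
     Ide = (\<lambda>A. St_class A A (\<I>\<^bsub>S\<^esub>, \<one> (OMap R \<I>\<^bsub>S\<^esub> \<odot> A))),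
     Comp = (\<lambda>(A, B, X) (B', D, Y).
       (A, D, \<Union>p \<in> X. \<Union>q \<in> Y. process_rel A D `` {comp_state A B D p q})),
     TUnit = \<I>,
     OTensor = (\<odot>),
     ATensor = (\<lambda>(A, B, X) (A', B', Y).
       (A \<odot> A', B \<odot> B',
        \<Union>p \<in> X. \<Union>q \<in> Y. process_rel (A \<odot> A') (B \<odot> B') `` {tensor_state A B A' B' p q})),
     Assoc = (\<lambda>A B D. iota_arr (\<alpha> A B D)),
     LUnitor = (\<lambda>A. iota_arr (\<lambda>_ A)),
     RUnitor = (\<lambda>A. iota_arr (\<rho> A)),
     Symm = (\<lambda>A B. iota_arr (\<sigma> A B))\<rparr>"

definition store ::
  "'s \<Rightarrow> 'o \<Rightarrow> 'o \<Rightarrow> 'o \<times> 'o \<times> ('s \<times> 'a) set \<Rightarrow> 'o \<times> 'o \<times> ('s \<times> 'a) set" where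
  "store t A B = (\<lambda>(_, _, X).
     (A, B, \<Union>(s, f) \<in> X. process_rel A B `` {(s \<odot>\<^bsub>S\<^esub> t, join_state C R s t A B f)}))"

text \<open>The canonical functor \<open>\<iota>\<close>: the identity on objects, and strict monoidal.\<close>

definition iota :: "('o, 'a, 'o, 'o \<times> 'o \<times> ('s \<times> 'a) set) mfunctor" where
  "iota =
    \<lparr>OMap = (\<lambda>A. A),
     AMap = iota_arr,
     Eps = \<one>\<^bsub>St\<^esub> \<I>,
     Mu = (\<lambda>A B. \<one>\<^bsub>St\<^esub> (A \<odot> B))\<rparr>"

end

end

theory Submission
  imports Defs
begin

text \<open>
  All tensor products are nested to the right, so that a process acts on \<open>X \<odot> A\<close> with \<open>A\<close> as a
  passive tail.  In this form the symmetry becomes a family \<open>X \<odot> (Y \<odot> A) \<rightarrow> Y \<odot> (X \<odot> A)\<close> that is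
  natural, involutive and satisfies the Yang-Baxter equation, and \<open>R\<close> acts on \<open>C\<close> through
  isomorphisms \<open>R (s \<odot> t) \<odot> A \<rightarrow> R s \<odot> (R t \<odot> A)\<close>.  Sliding along an isomorphism of \<open>S\<close> identifies a
  process with its conjugate, hence the coherence isomorphisms of \<open>S\<close> rebracket, permute and delete
  the components of a state, and each axiom of \<open>St\<close> becomes an equation in \<open>C\<close> between processes
  with the same list of state components.  The tensor product of two processes is the composite of
  their whiskerings; its functoriality is the interchange of the whiskerings, up to sliding along
  the symmetry of \<open>S\<close>.

  Since \<open>(s | f)\<close> is the \<open>store\<close> of \<open>\<iota> f\<close>, an extension of \<open>F\<close> must send it to the feedback of
  \<open>\<mu> ; F f ; \<mu>\<inverse>\<close>.  That this is a structured feedback functor uses only the feedback axioms with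
  states in \<open>S\<close>, where \<open>fbk'\<close> is pulled back along \<open>G\<close>.
\<close>

section \<open>Symmetric monoidal categories\<close>

text \<open>The obstacle is that an arrow of \<open>St\<close> is a class of zigzags of slides, and
  the arrow in the middle of a slide has type
  \<open>R t \<odot> A \<rightarrow> R s \<odot> B\<close>, with different states at its two ends.
  Operations such as \<open>under\<close> and \<open>extend\<close> expect one state object at both
  ends and do not apply to it. For composition, the whiskerings and the extension, invariance is
  therefore shown by exhibiting the transformed middle arrow and sliding once more. Since the
  operations are unions over representatives, invariance along single slides, in one argument at a
  time, is enough.

  Two choices keep the calculations uniform. Composites are nested to the right and tensors are
  split into whiskerings, so that an equation becomes a rewrite rule for the head of a composite.
  And the extension is built over \<open>S\<close> alone; since the functors \<open>R ; F\<close>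
  and \<open>G ; R'\<close> agree on carriers only, the re-indexed feedback structure has to be
  transported from one to the other axiom by axiom.\<close>

lemma in_hom [simp]: "f \<in> hom C A B \<longleftrightarrow> f \<in> Arr C \<and> Dom C f = A \<and> Cod C f = B"
  by (simp add: hom_def)

context category
begin

lemma Arr_Dom [simp, intro]: "f \<in> Arr C \<Longrightarrow> Dom C f \<in> Obj C"
  and Arr_Cod [simp, intro]: "f \<in> Arr C \<Longrightarrow> Cod C f \<in> Obj C"
  using Dom_Obj Cod_Obj by auto

lemma Ide_simps [simp]:
  assumes "A \<in> Obj C"
  shows "\<one> A \<in> Arr C" "Dom C (\<one> A) = A" "Cod C (\<one> A) = A"
  using Ide_hom[OF assms] by auto

lemma Comp_simps [simp]:
  assumes "f \<in> Arr C" "g \<in> Arr C" "Cod C f = Dom C g"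
  shows "f \<Zcomp> g \<in> Arr C" "Dom C (f \<Zcomp> g) = Dom C f" "Cod C (f \<Zcomp> g) = Cod C g"
  using Comp_hom[of f "Dom C f" "Dom C g" g "Cod C g"] assms by auto

lemma Ide_left [simp]: "f \<in> Arr C \<Longrightarrow> Dom C f = A \<Longrightarrow> \<one> A \<Zcomp> f = f"
  and Ide_right [simp]: "f \<in> Arr C \<Longrightarrow> Cod C f = A \<Longrightarrow> f \<Zcomp> \<one> A = f"
  using Comp_Ide_left Comp_Ide_right by auto

lemma assoc:
  "\<lbrakk>f \<in> Arr C; g \<in> Arr C; h \<in> Arr C; Cod C f = Dom C g; Cod C g = Dom C h\<rbrakk>
    \<Longrightarrow> f \<Zcomp> g \<Zcomp> h = f \<Zcomp> (g \<Zcomp> h)"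
  using Comp_assoc by auto

section \<open>Inverses and cancellation\<close>

lemma inverse_arrows_unique:
  assumes "inverse_arrows C f g" "inverse_arrows C f h"
  shows "g = h"
proof -
  have "g = g \<Zcomp> (f \<Zcomp> h)"
    using assms by (simp add: inverse_arrows_def)
  also have "\<dots> = (g \<Zcomp> f) \<Zcomp> h"
    using assms by (intro assoc[symmetric]) (simp_all add: inverse_arrows_def)
  also have "\<dots> = h" using assms by (simp add: inverse_arrows_def)
  finally show ?thesis .
qed

lemma inv_eqI: "inverse_arrows C f g \<Longrightarrow> inv f = g"
  unfolding inv_arr_def by (rule the_equality) (auto intro: inverse_arrows_unique)

lemma inverse_arrows_inv: "is_iso C f \<Longrightarrow> inverse_arrows C f (inv f)"
  using inv_eqI by (auto simp: is_iso_def)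

lemma inverse_arrowsI:
  "\<lbrakk>f \<in> Arr C; g \<in> Arr C; Dom C g = Cod C f; Cod C g = Dom C f;
    f \<Zcomp> g = \<one> (Dom C f); g \<Zcomp> f = \<one> (Cod C f)\<rbrakk> \<Longrightarrow> inverse_arrows C f g"
  by (auto simp: inverse_arrows_def)

lemma inverse_arrows_is_iso: "inverse_arrows C f g \<Longrightarrow> is_iso C f"
  by (auto simp: is_iso_def)

lemma iso_Arr: "is_iso C f \<Longrightarrow> f \<in> Arr C"
  by (auto simp: is_iso_def inverse_arrows_def)

lemma inv_simps [simp]:
  assumes "is_iso C f"
  shows "inv f \<in> Arr C" "Dom C (inv f) = Cod C f" "Cod C (inv f) = Dom C f"
    "f \<Zcomp> inv f = \<one> (Dom C f)" "inv f \<Zcomp> f = \<one> (Cod C f)"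
  using inverse_arrows_inv[OF assms] by (auto simp: inverse_arrows_def)

lemma inv_cancel [simp]:
  assumes "is_iso C f" "k \<in> Arr C"
  shows "Dom C k = Dom C f \<Longrightarrow> f \<Zcomp> (inv f \<Zcomp> k) = k"
    and "Dom C k = Cod C f \<Longrightarrow> inv f \<Zcomp> (f \<Zcomp> k) = k"
  using assms iso_Arr[OF assms(1)] by (simp_all flip: assoc)

lemma is_iso_inv [simp]: "is_iso C f \<Longrightarrow> is_iso C (inv f)"
  by (rule inverse_arrows_is_iso[of _ f], rule inverse_arrowsI) (auto simp: iso_Arr)

lemma inv_inv [simp]: "is_iso C f \<Longrightarrow> inv (inv f) = f"
  by (rule inv_eqI, rule inverse_arrowsI) (auto simp: iso_Arr)

lemma inverse_arrows_Comp:
  assumes "is_iso C f" "is_iso C g" "Cod C f = Dom C g"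
  shows "inverse_arrows C (f \<Zcomp> g) (inv g \<Zcomp> inv f)"
  using assms by (intro inverse_arrowsI) (auto simp: iso_Arr assoc)

lemma is_iso_Comp [simp]: "\<lbrakk>is_iso C f; is_iso C g; Cod C f = Dom C g\<rbrakk> \<Longrightarrow> is_iso C (f \<Zcomp> g)"
  and inv_Comp [simp]:
    "\<lbrakk>is_iso C f; is_iso C g; Cod C f = Dom C g\<rbrakk> \<Longrightarrow> inv (f \<Zcomp> g) = inv g \<Zcomp> inv f"
  using inverse_arrows_Comp inverse_arrows_is_iso inv_eqI by auto

lemma inverse_arrows_Ide: "A \<in> Obj C \<Longrightarrow> inverse_arrows C (\<one> A) (\<one> A)"
  by (auto simp: inverse_arrows_def)

lemma is_iso_Ide [simp]: "A \<in> Obj C \<Longrightarrow> is_iso C (\<one> A)"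
  and inv_Ide [simp]: "A \<in> Obj C \<Longrightarrow> inv (\<one> A) = \<one> A"
  using inverse_arrows_Ide inverse_arrows_is_iso inv_eqI by auto

lemma iso_cancel_left:
  assumes "is_iso C k" "k \<Zcomp> f = k \<Zcomp> g" "f \<in> Arr C" "g \<in> Arr C" "Dom C f = Cod C k" "Dom C g = Cod C k"
  shows "f = g"
proof -
  have "f = inv k \<Zcomp> (k \<Zcomp> f)" using assms(1,3,5) by simp
  also have "\<dots> = g" using assms(1,2,4,6) by simp
  finally show ?thesis .
qed

lemma iso_cancel_right:
  assumes "is_iso C k" "f \<Zcomp> k = g \<Zcomp> k" "f \<in> Arr C" "g \<in> Arr C" "Cod C f = Dom C k" "Cod C g = Dom C k"
  shows "f = g"
proof -
  have "f = f \<Zcomp> k \<Zcomp> inv k" using assms(1,3,5) by (simp add: assoc iso_Arr)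
  also have "\<dots> = g" using assms(1,2,4,6) by (simp add: assoc iso_Arr)
  finally show ?thesis .
qed

text \<open>Together with \<open>move_right\<close> this solves an equation for one factor:
  naturality squares and coherence axioms become rules with a single structure map on the left-hand
  side.\<close>

lemma move_left:
  assumes "is_iso C k" "f \<in> Arr C" "Dom C f = Cod C k" "g = k \<Zcomp> f"
  shows "inv k \<Zcomp> g = f"
  using assms by (simp add: assoc iso_Arr)

lemma move_right:
  assumes "is_iso C k" "f \<in> Arr C" "Cod C f = Dom C k" "g = f \<Zcomp> k"
  shows "g \<Zcomp> inv k = f"
  using assms by (simp add: assoc iso_Arr)

text \<open>In a composite nested to the right, \<open>f \<Zcomp> g\<close> does not occur as a
  subterm when something follows it. Applied with THEN, this restates an equation so that it
  rewrites the head of a longer composite.\<close>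

lemma Comp_eq_assoc:
  assumes "f \<Zcomp> g = h" "f \<in> Arr C" "g \<in> Arr C" "Cod C f = Dom C g"
    "k \<in> Arr C" "Cod C g = Dom C k"
  shows "f \<Zcomp> (g \<Zcomp> k) = h \<Zcomp> k"
  using assms by (simp flip: assoc)

lemma Comp_eq_assoc3:
  assumes "f \<Zcomp> (g \<Zcomp> h) = k" "f \<in> Arr C" "g \<in> Arr C" "h \<in> Arr C"
    "Cod C f = Dom C g" "Cod C g = Dom C h" "l \<in> Arr C" "Cod C h = Dom C l"
  shows "f \<Zcomp> (g \<Zcomp> (h \<Zcomp> l)) = k \<Zcomp> l"
  using assms by (simp flip: assoc)

end

text \<open>Whiskerings replace tensors of two arrows because functoriality in each argument is then
  a terminating simplification rule (\<open>whisker_Comp\<close>), while moving two arrows past each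
  other is the separate rule \<open>whisker_exchange\<close>.\<close>

definition lwhisker :: "('o, 'a) smc \<Rightarrow> 'o \<Rightarrow> 'a \<Rightarrow> 'a"  (infixr "\<rhd>\<index>" 75) where
  "X \<rhd>\<^bsub>C\<^esub> f = \<one>\<^bsub>C\<^esub> X \<otimes>\<^bsub>C\<^esub> f"

definition rwhisker :: "('o, 'a) smc \<Rightarrow> 'a \<Rightarrow> 'o \<Rightarrow> 'a"  (infixl "\<lhd>\<index>" 75) where
  "f \<lhd>\<^bsub>C\<^esub> X = f \<otimes>\<^bsub>C\<^esub> \<one>\<^bsub>C\<^esub> X"

definition swap :: "('o, 'a) smc \<Rightarrow> 'o \<Rightarrow> 'o \<Rightarrow> 'o \<Rightarrow> 'a"  ("\<omega>\<index>") where
  "\<omega>\<^bsub>C\<^esub> X Y A = inv\<^bsub>C\<^esub> (\<alpha>\<^bsub>C\<^esub> X Y A) \<Zcomp>\<^bsub>C\<^esub> (\<sigma>\<^bsub>C\<^esub> X Y \<lhd>\<^bsub>C\<^esub> A) \<Zcomp>\<^bsub>C\<^esub> \<alpha>\<^bsub>C\<^esub> Y X A"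

context symmetric_monoidal_category
begin

declare TUnit_Obj [simp] OTensor_Obj [simp] ATensor_Ide [simp]

lemma ATensor_simps [simp]:
  assumes "f \<in> Arr C" "g \<in> Arr C"
  shows "f \<otimes> g \<in> Arr C" "Dom C (f \<otimes> g) = Dom C f \<odot> Dom C g" "Cod C (f \<otimes> g) = Cod C f \<odot> Cod C g"
  using ATensor_hom[of f "Dom C f" "Cod C f" g "Dom C g" "Cod C g"] assms by auto

lemma lwhisker_simps [simp]:
  assumes "f \<in> Arr C" "X \<in> Obj C"
  shows "X \<rhd> f \<in> Arr C" "Dom C (X \<rhd> f) = X \<odot> Dom C f" "Cod C (X \<rhd> f) = X \<odot> Cod C f"
  using assms by (simp_all add: lwhisker_def)

lemma rwhisker_simps [simp]:
  assumes "f \<in> Arr C" "X \<in> Obj C"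
  shows "f \<lhd> X \<in> Arr C" "Dom C (f \<lhd> X) = Dom C f \<odot> X" "Cod C (f \<lhd> X) = Cod C f \<odot> X"
  using assms by (simp_all add: rwhisker_def)

lemma whisker_Ide [simp]:
  assumes "A \<in> Obj C" "X \<in> Obj C"
  shows "X \<rhd> \<one> A = \<one> (X \<odot> A)" "\<one> A \<lhd> X = \<one> (A \<odot> X)"
  using assms by (simp_all add: lwhisker_def rwhisker_def)

lemma interchange:
  "\<lbrakk>f \<in> Arr C; g \<in> Arr C; f' \<in> Arr C; g' \<in> Arr C; Cod C f = Dom C g; Cod C f' = Dom C g'\<rbrakk>
    \<Longrightarrow> (f \<otimes> f') \<Zcomp> (g \<otimes> g') = (f \<Zcomp> g) \<otimes> (f' \<Zcomp> g')"
  by (rule ATensor_Comp[symmetric]) auto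

lemma whisker_Comp [simp]:
  assumes "f \<in> Arr C" "g \<in> Arr C" "Cod C f = Dom C g" "X \<in> Obj C"
  shows "X \<rhd> (f \<Zcomp> g) = X \<rhd> f \<Zcomp> X \<rhd> g" "(f \<Zcomp> g) \<lhd> X = f \<lhd> X \<Zcomp> g \<lhd> X"
  using assms by (simp_all add: lwhisker_def rwhisker_def interchange)

lemma ATensor_whisker: "\<lbrakk>f \<in> Arr C; g \<in> Arr C\<rbrakk> \<Longrightarrow> f \<otimes> g = f \<lhd> Dom C g \<Zcomp> Cod C f \<rhd> g"
  by (simp_all add: lwhisker_def rwhisker_def interchange)

lemma whisker_exchange:
  assumes "f \<in> Arr C" "g \<in> Arr C" "Dom C f = A" "Cod C f = A'" "Dom C g = B" "Cod C g = B'"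
  shows "A \<rhd> g \<Zcomp> f \<lhd> B' = f \<lhd> B \<Zcomp> A' \<rhd> g"
  using assms by (auto simp add: lwhisker_def rwhisker_def interchange)

lemma inverse_arrows_ATensor:
  "\<lbrakk>is_iso C f; is_iso C g\<rbrakk> \<Longrightarrow> inverse_arrows C (f \<otimes> g) (inv f \<otimes> inv g)"
  by (intro inverse_arrowsI) (simp_all add: interchange iso_Arr)

lemma is_iso_ATensor [simp]: "\<lbrakk>is_iso C f; is_iso C g\<rbrakk> \<Longrightarrow> is_iso C (f \<otimes> g)"
  and inv_ATensor [simp]: "\<lbrakk>is_iso C f; is_iso C g\<rbrakk> \<Longrightarrow> inv (f \<otimes> g) = inv f \<otimes> inv g"
  using inverse_arrows_ATensor inverse_arrows_is_iso inv_eqI by auto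

text \<open>The last two equations pull inverses out of whiskerings, so that
  \<open>inv_cancel\<close> can match a whiskered arrow with its inverse.\<close>

lemma is_iso_whisker [simp]:
  assumes "is_iso C f" "X \<in> Obj C"
  shows "is_iso C (X \<rhd> f)" "is_iso C (f \<lhd> X)"
    "X \<rhd> inv f = inv (X \<rhd> f)" "inv f \<lhd> X = inv (f \<lhd> X)"
  using assms by (simp_all add: lwhisker_def rwhisker_def)

lemma structure_simps [simp]:
  assumes "A \<in> Obj C"
  shows "\<lambda>_ A \<in> Arr C" "Dom C (\<lambda>_ A) = \<I> \<odot> A" "Cod C (\<lambda>_ A) = A" "is_iso C (\<lambda>_ A)"
    "\<rho> A \<in> Arr C" "Dom C (\<rho> A) = A \<odot> \<I>" "Cod C (\<rho> A) = A" "is_iso C (\<rho> A)"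
    "B \<in> Obj C \<Longrightarrow> \<sigma> A B \<in> Arr C" "B \<in> Obj C \<Longrightarrow> Dom C (\<sigma> A B) = A \<odot> B"
    "B \<in> Obj C \<Longrightarrow> Cod C (\<sigma> A B) = B \<odot> A"
    "\<lbrakk>B \<in> Obj C; D \<in> Obj C\<rbrakk> \<Longrightarrow> \<alpha> A B D \<in> Arr C"
    "\<lbrakk>B \<in> Obj C; D \<in> Obj C\<rbrakk> \<Longrightarrow> Dom C (\<alpha> A B D) = A \<odot> B \<odot> D"
    "\<lbrakk>B \<in> Obj C; D \<in> Obj C\<rbrakk> \<Longrightarrow> Cod C (\<alpha> A B D) = A \<odot> (B \<odot> D)"
    "\<lbrakk>B \<in> Obj C; D \<in> Obj C\<rbrakk> \<Longrightarrow> is_iso C (\<alpha> A B D)"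
  using assms LUnitor_hom RUnitor_hom LUnitor_iso RUnitor_iso Symm_hom Assoc_hom Assoc_iso by auto

lemma inverse_arrows_Symm: "\<lbrakk>A \<in> Obj C; B \<in> Obj C\<rbrakk> \<Longrightarrow> inverse_arrows C (\<sigma> A B) (\<sigma> B A)"
  by (intro inverse_arrowsI) (simp_all add: Symm_inverse)

lemma is_iso_Symm [simp]: "\<lbrakk>A \<in> Obj C; B \<in> Obj C\<rbrakk> \<Longrightarrow> is_iso C (\<sigma> A B)"
  and inv_Symm [simp]: "\<lbrakk>A \<in> Obj C; B \<in> Obj C\<rbrakk> \<Longrightarrow> inv (\<sigma> A B) = \<sigma> B A"
  using inverse_arrows_Symm inverse_arrows_is_iso inv_eqI by auto

text \<open>Since \<open>inv_Symm\<close> rewrites \<open>inv (\<sigma> A B)\<close> to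
  \<open>\<sigma> B A\<close>, the cancellation rules for \<open>inv\<close> no longer match and are
  restated for the symmetry; the same happens below for \<open>\<omega>\<close>.\<close>

lemma Symm_cancel [simp]:
  "\<lbrakk>A \<in> Obj C; B \<in> Obj C\<rbrakk> \<Longrightarrow> \<sigma> A B \<Zcomp> \<sigma> B A = \<one> (A \<odot> B)"
  "\<lbrakk>A \<in> Obj C; B \<in> Obj C; k \<in> Arr C; Dom C k = A \<odot> B\<rbrakk> \<Longrightarrow> \<sigma> A B \<Zcomp> (\<sigma> B A \<Zcomp> k) = k"
  by (simp_all add: Symm_inverse flip: assoc)

lemma LUnitor_nat: "f \<in> Arr C \<Longrightarrow> Cod C f = B \<Longrightarrow> \<I> \<rhd> f \<Zcomp> \<lambda>_ B = \<lambda>_ (Dom C f) \<Zcomp> f"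
  using LUnitor_natural by (auto simp: lwhisker_def)

lemma RUnitor_nat: "f \<in> Arr C \<Longrightarrow> Cod C f = B \<Longrightarrow> f \<lhd> \<I> \<Zcomp> \<rho> B = \<rho> (Dom C f) \<Zcomp> f"
  using RUnitor_natural by (auto simp: rwhisker_def)

lemma Symm_nat_left:
  "\<lbrakk>f \<in> Arr C; B \<in> Obj C; Cod C f = A\<rbrakk> \<Longrightarrow> f \<lhd> B \<Zcomp> \<sigma> A B = \<sigma> (Dom C f) B \<Zcomp> B \<rhd> f"
  using Symm_natural[of f "Dom C f" "Cod C f" "\<one> B" B B] by (auto simp: lwhisker_def rwhisker_def)

lemma Symm_nat_right:
  "\<lbrakk>f \<in> Arr C; B \<in> Obj C; Cod C f = A\<rbrakk> \<Longrightarrow> B \<rhd> f \<Zcomp> \<sigma> B A = \<sigma> B (Dom C f) \<Zcomp> f \<lhd> B"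
  using Symm_natural[of "\<one> B" B B f "Dom C f" "Cod C f"] by (auto simp: lwhisker_def rwhisker_def)

lemma Assoc_nat:
  assumes "f \<in> Arr C" "A \<in> Obj C" "B \<in> Obj C"
  shows "f \<lhd> A \<lhd> B \<Zcomp> \<alpha> (Cod C f) A B = \<alpha> (Dom C f) A B \<Zcomp> f \<lhd> (A \<odot> B)"
    "(A \<rhd> f) \<lhd> B \<Zcomp> \<alpha> A (Cod C f) B = \<alpha> A (Dom C f) B \<Zcomp> A \<rhd> (f \<lhd> B)"
    "(A \<odot> B) \<rhd> f \<Zcomp> \<alpha> A B (Cod C f) = \<alpha> A B (Dom C f) \<Zcomp> A \<rhd> B \<rhd> f"
  using Assoc_natural[of f "Dom C f" "Cod C f" "\<one> A" A A "\<one> B" B B]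
    Assoc_natural[of "\<one> A" A A f "Dom C f" "Cod C f" "\<one> B" B B]
    Assoc_natural[of "\<one> A" A A "\<one> B" B B f "Dom C f" "Cod C f"] assms
  by (simp_all add: lwhisker_def rwhisker_def)

text \<open>
  Read as rewrite rules, the next lemmas nest every tensor product to the right.  Together with
  \<open>assoc\<close> and cancellation they settle the coherence equations that involve no symmetry.
\<close>

lemma whisker_rebracket:
  assumes "f \<in> Arr C" "A \<in> Obj C" "B \<in> Obj C"
  shows "f \<lhd> A \<lhd> B = \<alpha> (Dom C f) A B \<Zcomp> (f \<lhd> (A \<odot> B) \<Zcomp> inv (\<alpha> (Cod C f) A B))"
    "(A \<rhd> f) \<lhd> B = \<alpha> A (Dom C f) B \<Zcomp> (A \<rhd> (f \<lhd> B) \<Zcomp> inv (\<alpha> A (Cod C f) B))"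
    "(A \<odot> B) \<rhd> f = \<alpha> A B (Dom C f) \<Zcomp> (A \<rhd> B \<rhd> f \<Zcomp> inv (\<alpha> A B (Cod C f)))"
  using Assoc_nat[OF assms, THEN sym, THEN move_right[rotated -1]] assms by (simp_all add: assoc)

lemma rwhisker_Assoc:
  assumes "A \<in> Obj C" "B \<in> Obj C" "D \<in> Obj C" "E \<in> Obj C"
  shows "\<alpha> A B D \<lhd> E =
    \<alpha> (A \<odot> B) D E \<Zcomp> (\<alpha> A B (D \<odot> E) \<Zcomp> (A \<rhd> inv (\<alpha> B D E) \<Zcomp> inv (\<alpha> A (B \<odot> D) E)))"
proof -
  have "\<alpha> A B D \<lhd> E \<Zcomp> (\<alpha> A (B \<odot> D) E \<Zcomp> A \<rhd> \<alpha> B D E) = \<alpha> (A \<odot> B) D E \<Zcomp> \<alpha> A B (D \<odot> E)"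
    using pentagon[OF assms] assms by (simp add: lwhisker_def rwhisker_def assoc)
  from move_right[OF _ _ _ this[symmetric]] assms show ?thesis by (simp add: assoc)
qed

section \<open>Unit coherence derived from pentagon, triangle and hexagon\<close>

lemma LUnitor_cancel:
  assumes "f \<in> Arr C" "g \<in> Arr C" "Dom C f = Dom C g" "Cod C f = Cod C g" "\<I> \<rhd> f = \<I> \<rhd> g"
  shows "f = g"
proof -
  have "\<lambda>_ (Dom C f) \<Zcomp> f = \<I> \<rhd> f \<Zcomp> \<lambda>_ (Cod C f)"
    by (rule LUnitor_nat[OF assms(1) refl, symmetric])
  also have "\<dots> = \<lambda>_ (Dom C f) \<Zcomp> g"
    by (simp only: LUnitor_nat[OF assms(2) refl] assms(3-5))
  finally show ?thesis
    by (rule iso_cancel_left[rotated]) (use assms(1-4) in simp_all)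
qed

lemma RUnitor_cancel:
  assumes "f \<in> Arr C" "g \<in> Arr C" "Dom C f = Dom C g" "Cod C f = Cod C g" "f \<lhd> \<I> = g \<lhd> \<I>"
  shows "f = g"
proof -
  have "\<rho> (Dom C f) \<Zcomp> f = f \<lhd> \<I> \<Zcomp> \<rho> (Cod C f)"
    by (rule RUnitor_nat[OF assms(1) refl, symmetric])
  also have "\<dots> = \<rho> (Dom C f) \<Zcomp> g"
    by (simp only: RUnitor_nat[OF assms(2) refl] assms(3-5))
  finally show ?thesis
    by (rule iso_cancel_left[rotated]) (use assms(1-4) in simp_all)
qed

lemma rwhisker_RUnitor:
  "\<lbrakk>A \<in> Obj C; B \<in> Obj C\<rbrakk> \<Longrightarrow> \<rho> A \<lhd> B = \<alpha> A \<I> B \<Zcomp> A \<rhd> \<lambda>_ B"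
  using triangle by (simp add: lwhisker_def rwhisker_def)

text \<open>Kelly's argument: tensoring with \<open>\<I>\<close> is faithful by
  \<open>LUnitor_cancel\<close>, and after whiskering the claim follows from the pentagon at
  \<open>\<I>\<close>, \<open>\<I>\<close>, \<open>A\<close>, \<open>B\<close>, two triangles and
  naturality of \<open>\<alpha>\<close>.\<close>

lemma rwhisker_LUnitor:
  assumes "A \<in> Obj C" "B \<in> Obj C"
  shows "\<lambda>_ A \<lhd> B = \<alpha> \<I> A B \<Zcomp> \<lambda>_ (A \<odot> B)"
proof (rule LUnitor_cancel)
  \<comment> \<open>One side of the pentagon; it is an isomorphism, and the calculation ends by
    cancelling it.\<close>
  let ?a = "\<alpha> (\<I> \<odot> \<I>) A B \<Zcomp> \<alpha> \<I> \<I> (A \<odot> B)"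
  have "?a \<Zcomp> \<I> \<rhd> \<lambda>_ (A \<odot> B) = \<alpha> (\<I> \<odot> \<I>) A B \<Zcomp> \<rho> \<I> \<lhd> (A \<odot> B)"
    using assms by (simp add: rwhisker_RUnitor assoc)
  also have "\<dots> = (\<rho> \<I> \<lhd> A) \<lhd> B \<Zcomp> \<alpha> \<I> A B"
    using assms Assoc_nat(1)[of "\<rho> \<I>" A B] by simp
  also have "\<dots> = \<alpha> \<I> \<I> A \<lhd> B \<Zcomp> ((\<I> \<rhd> \<lambda>_ A) \<lhd> B \<Zcomp> \<alpha> \<I> A B)"
    using assms by (simp add: rwhisker_RUnitor assoc)
  also have "\<dots> = ?a \<Zcomp> (\<I> \<rhd> inv (\<alpha> \<I> A B) \<Zcomp> \<I> \<rhd> (\<lambda>_ A \<lhd> B))"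
    using assms by (simp add: rwhisker_Assoc whisker_rebracket assoc)
  finally have "\<I> \<rhd> \<lambda>_ (A \<odot> B) = \<I> \<rhd> inv (\<alpha> \<I> A B) \<Zcomp> \<I> \<rhd> (\<lambda>_ A \<lhd> B)"
    by (rule iso_cancel_left[rotated]) (use assms in simp_all)
  then have "\<I> \<rhd> \<alpha> \<I> A B \<Zcomp> \<I> \<rhd> \<lambda>_ (A \<odot> B) = \<I> \<rhd> (\<lambda>_ A \<lhd> B)"
    using assms by (simp flip: whisker_Comp add: assoc)
  then show "\<I> \<rhd> (\<lambda>_ A \<lhd> B) = \<I> \<rhd> (\<alpha> \<I> A B \<Zcomp> \<lambda>_ (A \<odot> B))"
    using assms by simp
qed (use assms in simp_all)

text \<open>After whiskering with \<open>\<I>\<close> on the right, which is faithful, triangle and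
  pentagon reduce both sides to the same composite around
  \<open>A \<rhd> B \<rhd> \<lambda>_ \<I>\<close>.\<close>

lemma RUnitor_OTensor:
  assumes "A \<in> Obj C" "B \<in> Obj C"
  shows "\<rho> (A \<odot> B) = \<alpha> A B \<I> \<Zcomp> A \<rhd> \<rho> B"
proof (rule RUnitor_cancel)
  show "\<rho> (A \<odot> B) \<lhd> \<I> = (\<alpha> A B \<I> \<Zcomp> A \<rhd> \<rho> B) \<lhd> \<I>"
    using assms by (simp add: rwhisker_RUnitor rwhisker_Assoc whisker_rebracket assoc)
qed (use assms in simp_all)

text \<open>The hexagon with \<open>\<I>\<close> in the middle forces the symmetry to respect the
  units: naturality of \<open>\<lambda>_\<close> and of \<open>\<sigma>\<close> leaves a whiskered
  unitor followed by \<open>\<sigma> A ?B\<close> on either side.\<close>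

lemma Symm_LUnitor:
  assumes "A \<in> Obj C"
  shows "\<sigma> A \<I> \<Zcomp> \<lambda>_ A = \<rho> A"
proof (rule RUnitor_cancel)
  \<comment> \<open>The calculation is uniform in \<open>?B\<close>; the unit is taken because
    whiskering with it can be cancelled at the end.\<close>
  let ?B = "\<I>"
  have "((\<sigma> A \<I> \<Zcomp> \<lambda>_ A) \<lhd> ?B) \<Zcomp> \<sigma> A ?B = \<sigma> A \<I> \<lhd> ?B \<Zcomp> (\<alpha> \<I> A ?B \<Zcomp> (\<I> \<rhd> \<sigma> A ?B \<Zcomp> \<lambda>_ (?B \<odot> A)))"
    using assms by (simp add: rwhisker_LUnitor assoc LUnitor_nat)
  also have "\<dots> = \<sigma> A \<I> \<lhd> ?B \<Zcomp> \<alpha> \<I> A ?B \<Zcomp> \<I> \<rhd> \<sigma> A ?B \<Zcomp> \<lambda>_ (?B \<odot> A)"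
    using assms by (simp add: assoc)
  also have "\<dots> = \<alpha> A \<I> ?B \<Zcomp> \<sigma> A (\<I> \<odot> ?B) \<Zcomp> \<alpha> \<I> ?B A \<Zcomp> \<lambda>_ (?B \<odot> A)"
    using assms hexagon[of A "\<I>" ?B] by (simp add: lwhisker_def rwhisker_def)
  also have "\<dots> = \<alpha> A \<I> ?B \<Zcomp> (\<sigma> A (\<I> \<odot> ?B) \<Zcomp> \<lambda>_ ?B \<lhd> A)"
    using assms by (simp add: assoc rwhisker_LUnitor)
  also have "\<dots> = \<alpha> A \<I> ?B \<Zcomp> (A \<rhd> \<lambda>_ ?B \<Zcomp> \<sigma> A ?B)"
    using assms Symm_nat_right[of "\<lambda>_ ?B" A] by simp
  also have "\<dots> = \<rho> A \<lhd> ?B \<Zcomp> \<sigma> A ?B"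
    using assms by (simp add: assoc rwhisker_RUnitor)
  finally show "(\<sigma> A \<I> \<Zcomp> \<lambda>_ A) \<lhd> ?B = \<rho> A \<lhd> ?B"
    by (rule iso_cancel_right[rotated]) (use assms in simp_all)
qed (use assms in simp_all)

lemma Symm_RUnitor: "A \<in> Obj C \<Longrightarrow> \<sigma> \<I> A \<Zcomp> \<rho> A = \<lambda>_ A"
  by (simp flip: Symm_LUnitor)

section \<open>The symmetry with a passive tail\<close>

lemma swap_simps [simp]:
  assumes "X \<in> Obj C" "Y \<in> Obj C" "A \<in> Obj C"
  shows "\<omega> X Y A \<in> Arr C" "Dom C (\<omega> X Y A) = X \<odot> (Y \<odot> A)" "Cod C (\<omega> X Y A) = Y \<odot> (X \<odot> A)"
    "is_iso C (\<omega> X Y A)"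
  using assms by (simp_all add: swap_def)

lemma inv_rwhisker_Symm [simp]:
  assumes "X \<in> Obj C" "Y \<in> Obj C" "A \<in> Obj C"
  shows "inv (\<sigma> X Y \<lhd> A) = \<sigma> Y X \<lhd> A" "inv (A \<rhd> \<sigma> X Y) = A \<rhd> \<sigma> Y X"
  using assms is_iso_whisker(3,4)[of "\<sigma> X Y" A] by simp_all

lemma swap_inv [simp]:
  assumes "X \<in> Obj C" "Y \<in> Obj C" "A \<in> Obj C"
  shows "inv (\<omega> X Y A) = \<omega> Y X A"
  using assms by (simp add: swap_def assoc)

lemma swap_cancel [simp]:
  assumes "X \<in> Obj C" "Y \<in> Obj C" "A \<in> Obj C"
  shows "\<omega> X Y A \<Zcomp> \<omega> Y X A = \<one> (X \<odot> (Y \<odot> A))"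
    "\<lbrakk>k \<in> Arr C; Dom C k = X \<odot> (Y \<odot> A)\<rbrakk> \<Longrightarrow> \<omega> X Y A \<Zcomp> (\<omega> Y X A \<Zcomp> k) = k"
  using inv_simps(4)[of "\<omega> X Y A"] inv_cancel(1)[of "\<omega> X Y A" k] assms by simp_all

lemma lwhisker_swap_inv [simp]:
  assumes "X \<in> Obj C" "Y \<in> Obj C" "A \<in> Obj C" "Z \<in> Obj C"
  shows "inv (Z \<rhd> \<omega> X Y A) = Z \<rhd> \<omega> Y X A"
  using assms is_iso_whisker(3)[of "\<omega> X Y A" Z] by simp

lemma lwhisker_swap_cancel [simp]:
  assumes "X \<in> Obj C" "Y \<in> Obj C" "A \<in> Obj C" "Z \<in> Obj C"
  shows "Z \<rhd> \<omega> X Y A \<Zcomp> Z \<rhd> \<omega> Y X A = \<one> (Z \<odot> (X \<odot> (Y \<odot> A)))"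
    "\<lbrakk>k \<in> Arr C; Dom C k = Z \<odot> (X \<odot> (Y \<odot> A))\<rbrakk>
      \<Longrightarrow> Z \<rhd> \<omega> X Y A \<Zcomp> (Z \<rhd> \<omega> Y X A \<Zcomp> k) = k"
  using inv_simps(4)[of "Z \<rhd> \<omega> X Y A"] inv_cancel(1)[of "Z \<rhd> \<omega> X Y A" k] assms
  by simp_all

lemma swap_nat_tail:
  assumes "X \<in> Obj C" "Y \<in> Obj C" "f \<in> Arr C"
  shows "\<omega> X Y (Dom C f) \<Zcomp> Y \<rhd> X \<rhd> f = X \<rhd> Y \<rhd> f \<Zcomp> \<omega> X Y (Cod C f)"
proof -
  have E1: "\<alpha> Y X (Dom C f) \<Zcomp> Y \<rhd> X \<rhd> f = (Y \<odot> X) \<rhd> f \<Zcomp> \<alpha> Y X (Cod C f)"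
    using assms by (simp add: Assoc_nat)
  have E2: "\<sigma> X Y \<lhd> Dom C f \<Zcomp> (Y \<odot> X) \<rhd> f = (X \<odot> Y) \<rhd> f \<Zcomp> \<sigma> X Y \<lhd> Cod C f"
    using assms by (intro whisker_exchange[symmetric]) simp_all
  have E3: "inv (\<alpha> X Y (Dom C f)) \<Zcomp> (X \<odot> Y) \<rhd> f = X \<rhd> Y \<rhd> f \<Zcomp> inv (\<alpha> X Y (Cod C f))"
    using assms by (simp add: whisker_rebracket)
  show ?thesis
    using assms unfolding swap_def by (simp add: assoc E1 E2[THEN Comp_eq_assoc] E3[THEN Comp_eq_assoc])
qed

lemma swap_nat_left:
  assumes "f \<in> Arr C" "Y \<in> Obj C" "A \<in> Obj C"
  shows "f \<lhd> (Y \<odot> A) \<Zcomp> \<omega> (Cod C f) Y A = \<omega> (Dom C f) Y A \<Zcomp> Y \<rhd> (f \<lhd> A)"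
proof -
  have E1: "inv (\<alpha> (Dom C f) Y A) \<Zcomp> f \<lhd> Y \<lhd> A = f \<lhd> (Y \<odot> A) \<Zcomp> inv (\<alpha> (Cod C f) Y A)"
    using assms by (simp add: whisker_rebracket)
  have E2: "f \<lhd> Y \<lhd> A \<Zcomp> \<sigma> (Cod C f) Y \<lhd> A = \<sigma> (Dom C f) Y \<lhd> A \<Zcomp> (Y \<rhd> f) \<lhd> A"
    using assms by (simp add: Symm_nat_left flip: whisker_Comp)
  have E3: "(Y \<rhd> f) \<lhd> A \<Zcomp> \<alpha> Y (Cod C f) A = \<alpha> Y (Dom C f) A \<Zcomp> Y \<rhd> (f \<lhd> A)"
    using assms by (simp add: Assoc_nat)
  show ?thesis
    using assms unfolding swap_def
    by (simp add: assoc E1[symmetric, THEN Comp_eq_assoc] E2[THEN Comp_eq_assoc] E3)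
qed

text \<open>\<open>swap_nat_left\<close> read backwards, since \<open>\<omega> X Y A\<close> and
  \<open>\<omega> Y X A\<close> are mutually inverse.\<close>

lemma swap_nat_right:
  assumes "f \<in> Arr C" "X \<in> Obj C" "A \<in> Obj C"
  shows "X \<rhd> (f \<lhd> A) \<Zcomp> \<omega> X (Cod C f) A = \<omega> X (Dom C f) A \<Zcomp> f \<lhd> (X \<odot> A)"
proof -
  have "\<omega> X (Dom C f) A \<Zcomp> (f \<lhd> (X \<odot> A) \<Zcomp> \<omega> (Cod C f) X A) =
      \<omega> X (Dom C f) A \<Zcomp> (\<omega> (Dom C f) X A \<Zcomp> X \<rhd> (f \<lhd> A))"
    using assms by (simp only: swap_nat_left)
  then have "(\<omega> X (Dom C f) A \<Zcomp> f \<lhd> (X \<odot> A)) \<Zcomp> \<omega> (Cod C f) X A = X \<rhd> (f \<lhd> A)"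
    using assms by (simp add: assoc)
  from move_right[OF _ _ _ this[symmetric]] assms show ?thesis by simp
qed

lemma rwhisker_Symm:
  assumes "X \<in> Obj C" "Y \<in> Obj C" "A \<in> Obj C"
  shows "\<sigma> X Y \<lhd> A = \<alpha> X Y A \<Zcomp> (\<omega> X Y A \<Zcomp> inv (\<alpha> Y X A))"
  using assms by (simp add: swap_def assoc)

lemma rwhisker_swap:
  assumes "X \<in> Obj C" "Y \<in> Obj C" "A \<in> Obj C" "B \<in> Obj C"
  shows "\<omega> X Y A \<lhd> B = \<alpha> X (Y \<odot> A) B \<Zcomp> (X \<rhd> \<alpha> Y A B \<Zcomp> (\<omega> X Y (A \<odot> B)
    \<Zcomp> (inv (Y \<rhd> \<alpha> X A B) \<Zcomp> inv (\<alpha> Y (X \<odot> A) B))))"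
  using assms unfolding swap_def
  by (simp add: rwhisker_Assoc whisker_rebracket assoc)

text \<open>This is the hexagon, solved for \<open>\<sigma> X (Y \<odot> Z)\<close> and given a
  tail: passing a tensor product means passing its factors in turn.\<close>

lemma swap_OTensor_right:
  assumes "X \<in> Obj C" "Y \<in> Obj C" "Z \<in> Obj C" "A \<in> Obj C"
  shows "\<omega> X (Y \<odot> Z) A =
    X \<rhd> \<alpha> Y Z A \<Zcomp> (\<omega> X Y (Z \<odot> A) \<Zcomp> (Y \<rhd> \<omega> X Z A \<Zcomp> inv (\<alpha> Y Z (X \<odot> A))))"
proof -
  have "\<alpha> X Y Z \<Zcomp> (\<sigma> X (Y \<odot> Z) \<Zcomp> \<alpha> Y Z X) = \<sigma> X Y \<lhd> Z \<Zcomp> (\<alpha> Y X Z \<Zcomp> Y \<rhd> \<sigma> X Z)"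
    using hexagon[of X Y Z] assms by (simp add: lwhisker_def rwhisker_def assoc)
  from move_left[OF _ _ _ this[symmetric]]
  have "\<sigma> X (Y \<odot> Z) \<Zcomp> \<alpha> Y Z X = inv (\<alpha> X Y Z) \<Zcomp> (\<sigma> X Y \<lhd> Z \<Zcomp> (\<alpha> Y X Z \<Zcomp> Y \<rhd> \<sigma> X Z))"
    using assms by simp
  from move_right[OF _ _ _ this[symmetric]]
  have "\<sigma> X (Y \<odot> Z) = inv (\<alpha> X Y Z) \<Zcomp> (\<sigma> X Y \<lhd> Z \<Zcomp> (\<alpha> Y X Z \<Zcomp> (Y \<rhd> \<sigma> X Z \<Zcomp> inv (\<alpha> Y Z X))))"
    using assms by (simp add: assoc)
  then show ?thesis
    using assms unfolding swap_def[of C X "Y \<odot> Z" A]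
    by (simp add: rwhisker_Symm rwhisker_swap rwhisker_Assoc whisker_rebracket assoc)
qed

lemma swap_OTensor_left:
  assumes "X \<in> Obj C" "Y \<in> Obj C" "Z \<in> Obj C" "A \<in> Obj C"
  shows "\<omega> (X \<odot> Y) Z A =
    \<alpha> X Y (Z \<odot> A) \<Zcomp> (X \<rhd> \<omega> Y Z A \<Zcomp> (\<omega> X Z (Y \<odot> A) \<Zcomp> inv (Z \<rhd> \<alpha> X Y A)))"
proof -
  have "\<omega> (X \<odot> Y) Z A = inv (\<omega> Z (X \<odot> Y) A)" using assms by simp
  also have "\<dots> = \<alpha> X Y (Z \<odot> A) \<Zcomp> (X \<rhd> \<omega> Y Z A \<Zcomp> (\<omega> X Z (Y \<odot> A) \<Zcomp> inv (Z \<rhd> \<alpha> X Y A)))"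
    using assms by (subst swap_OTensor_right) (simp_all add: assoc)
  finally show ?thesis .
qed

text \<open>Naturality of the swap with \<open>X\<close> at the arrow \<open>\<sigma> Y Z\<close>,
  where the swaps past \<open>Y \<odot> Z\<close> and \<open>Z \<odot> Y\<close> are expanded by the
  hexagon.\<close>

lemma yang_baxter:
  assumes "X \<in> Obj C" "Y \<in> Obj C" "Z \<in> Obj C" "A \<in> Obj C"
  shows "\<omega> X Y (Z \<odot> A) \<Zcomp> (Y \<rhd> \<omega> X Z A \<Zcomp> \<omega> Y Z (X \<odot> A)) =
    X \<rhd> \<omega> Y Z A \<Zcomp> (\<omega> X Z (Y \<odot> A) \<Zcomp> Z \<rhd> \<omega> X Y A)"
proof -
  have "X \<rhd> \<alpha> Y Z A \<Zcomp> ((X \<rhd> \<omega> Y Z A \<Zcomp> (\<omega> X Z (Y \<odot> A) \<Zcomp> Z \<rhd> \<omega> X Y A)) \<Zcomp> inv (\<alpha> Z Y (X \<odot> A)))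
      = X \<rhd> (\<sigma> Y Z \<lhd> A) \<Zcomp> \<omega> X (Z \<odot> Y) A"
    using assms by (simp add: rwhisker_Symm swap_OTensor_right assoc)
  also have "\<dots> = \<omega> X (Y \<odot> Z) A \<Zcomp> \<sigma> Y Z \<lhd> (X \<odot> A)"
    using assms swap_nat_right[of "\<sigma> Y Z" X A] by simp
  also have "\<dots> = X \<rhd> \<alpha> Y Z A \<Zcomp> ((\<omega> X Y (Z \<odot> A) \<Zcomp> (Y \<rhd> \<omega> X Z A \<Zcomp> \<omega> Y Z (X \<odot> A))) \<Zcomp> inv (\<alpha> Z Y (X \<odot> A)))"
    using assms by (simp add: rwhisker_Symm swap_OTensor_right assoc)
  finally have "(X \<rhd> \<omega> Y Z A \<Zcomp> (\<omega> X Z (Y \<odot> A) \<Zcomp> Z \<rhd> \<omega> X Y A)) \<Zcomp> inv (\<alpha> Z Y (X \<odot> A)) =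
      (\<omega> X Y (Z \<odot> A) \<Zcomp> (Y \<rhd> \<omega> X Z A \<Zcomp> \<omega> Y Z (X \<odot> A))) \<Zcomp> inv (\<alpha> Z Y (X \<odot> A))"
    by (rule iso_cancel_left[rotated]) (use assms in simp_all)
  then show ?thesis
    by (rule iso_cancel_right[rotated, symmetric]) (use assms in simp_all)
qed

lemma swap_LUnitor:
  assumes "X \<in> Obj C" "A \<in> Obj C"
  shows "\<omega> \<I> X A \<Zcomp> X \<rhd> \<lambda>_ A = \<lambda>_ (X \<odot> A)"
proof -
  have "\<omega> \<I> X A \<Zcomp> X \<rhd> \<lambda>_ A = inv (\<alpha> \<I> X A) \<Zcomp> (\<sigma> \<I> X \<lhd> A \<Zcomp> \<rho> X \<lhd> A)"
    using assms by (simp add: swap_def assoc rwhisker_RUnitor)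
  also have "\<dots> = inv (\<alpha> \<I> X A) \<Zcomp> \<lambda>_ X \<lhd> A"
    using assms by (simp add: Symm_RUnitor flip: whisker_Comp)
  finally show ?thesis using assms by (simp add: rwhisker_LUnitor)
qed

text \<open>The inverse of the hexagon at \<open>B\<close>, \<open>X\<close>, \<open>A\<close>. It
  trades an object in front of the tail for one behind it, and thereby links \<open>under\<close> to
  \<open>extend\<close> in \<open>under_Symm\<close>.\<close>

lemma swap_Symm:
  assumes "X \<in> Obj C" "A \<in> Obj C" "B \<in> Obj C"
  shows "X \<rhd> \<sigma> B A \<Zcomp> (inv (\<alpha> X A B) \<Zcomp> \<sigma> (X \<odot> A) B) = \<omega> X B A"
proof -
  have "\<alpha> B X A \<Zcomp> (\<sigma> B (X \<odot> A) \<Zcomp> \<alpha> X A B) = \<sigma> B X \<lhd> A \<Zcomp> (\<alpha> X B A \<Zcomp> X \<rhd> \<sigma> B A)"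
    using hexagon[of B X A] assms by (simp add: lwhisker_def rwhisker_def assoc)
  then have "inv (\<alpha> B X A \<Zcomp> (\<sigma> B (X \<odot> A) \<Zcomp> \<alpha> X A B)) = inv (\<sigma> B X \<lhd> A \<Zcomp> (\<alpha> X B A \<Zcomp> X \<rhd> \<sigma> B A))"
    by (simp only:)
  then have "X \<rhd> \<sigma> A B \<Zcomp> (inv (\<alpha> X B A) \<Zcomp> \<sigma> X B \<lhd> A) = inv (\<alpha> X A B) \<Zcomp> (\<sigma> (X \<odot> A) B \<Zcomp> inv (\<alpha> B X A))"
    using assms by (simp add: assoc)
  then have "inv (\<alpha> X A B) \<Zcomp> (\<sigma> (X \<odot> A) B \<Zcomp> inv (\<alpha> B X A)) = X \<rhd> \<sigma> A B \<Zcomp> (inv (\<alpha> X B A) \<Zcomp> \<sigma> X B \<lhd> A)"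
    by (rule sym)
  then have "X \<rhd> \<sigma> B A \<Zcomp> (inv (\<alpha> X A B) \<Zcomp> (\<sigma> (X \<odot> A) B \<Zcomp> inv (\<alpha> B X A)))
     = X \<rhd> \<sigma> B A \<Zcomp> (X \<rhd> \<sigma> A B \<Zcomp> (inv (\<alpha> X B A) \<Zcomp> \<sigma> X B \<lhd> A))"
    by (simp only:)
  also have "\<dots> = (X \<rhd> (\<sigma> B A \<Zcomp> \<sigma> A B)) \<Zcomp> (inv (\<alpha> X B A) \<Zcomp> \<sigma> X B \<lhd> A)"
    using assms by (simp add: assoc del: Symm_cancel)
  also have "\<dots> = inv (\<alpha> X B A) \<Zcomp> \<sigma> X B \<lhd> A"
    using assms by simp
  finally have "(X \<rhd> \<sigma> B A \<Zcomp> (inv (\<alpha> X A B) \<Zcomp> \<sigma> (X \<odot> A) B)) \<Zcomp> inv (\<alpha> B X A) =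
     (inv (\<alpha> X B A) \<Zcomp> \<sigma> X B \<lhd> A)"
    using assms by (simp add: assoc)
  from move_right[OF _ _ _ this[symmetric]] show ?thesis
    using assms by (simp add: swap_def assoc)
qed

end

section \<open>Symmetric strong monoidal functors\<close>

text \<open>The associativity constraint of the action \<open>s, A \<mapsto> R s \<odot> A\<close>.
  \<open>Mu\<close> is inverted so that this arrow unpacks a joint state; \<open>join_state\<close>
  is conjugation by it, and \<open>unit_state\<close> is conjugation by
  \<open>act_unit\<close>.\<close>

definition act :: "('o, 'a) smc \<Rightarrow> ('s, 'h, 'o, 'a) mfunctor \<Rightarrow> 's \<Rightarrow> 's \<Rightarrow> 'o \<Rightarrow> 'a" where
  "act C R s t A = inv\<^bsub>C\<^esub> (Mu R s t) \<lhd>\<^bsub>C\<^esub> A \<Zcomp>\<^bsub>C\<^esub> \<alpha>\<^bsub>C\<^esub> (OMap R s) (OMap R t) A"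

definition act_unit :: "('o, 'a) smc \<Rightarrow> ('s, 'h, 'o, 'a) mfunctor \<Rightarrow> 'o \<Rightarrow> 'a" where
  "act_unit C R A = inv\<^bsub>C\<^esub> (Eps R) \<lhd>\<^bsub>C\<^esub> A \<Zcomp>\<^bsub>C\<^esub> \<lambda>\<^bsub>C\<^esub>_ A"

context symmetric_monoidal_functor
begin

declare OMap_Obj [simp] AMap_Ide [simp]

lemma AMap_simps [simp]:
  assumes "f \<in> Arr C"
  shows "AMap F f \<in> Arr D" "Dom D (AMap F f) = OMap F (Dom C f)" "Cod D (AMap F f) = OMap F (Cod C f)"
  using AMap_hom[of f "Dom C f" "Cod C f"] assms by auto

lemma AMap_Comp_simp [simp]:
  "\<lbrakk>f \<in> Arr C; g \<in> Arr C; Cod C f = Dom C g\<rbrakk> \<Longrightarrow> AMap F (f \<Zcomp>\<^bsub>C\<^esub> g) = AMap F f \<Zcomp> AMap F g"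
  by (rule AMap_Comp) auto

lemma Eps_simps [simp]:
  "Eps F \<in> Arr D" "Dom D (Eps F) = \<I>" "Cod D (Eps F) = OMap F \<I>\<^bsub>C\<^esub>" "is_iso D (Eps F)"
  using Eps_hom Eps_iso by auto

lemma Mu_simps [simp]:
  assumes "A \<in> Obj C" "B \<in> Obj C"
  shows "Mu F A B \<in> Arr D" "Dom D (Mu F A B) = OMap F A \<odot> OMap F B"
    "Cod D (Mu F A B) = OMap F (A \<odot>\<^bsub>C\<^esub> B)" "is_iso D (Mu F A B)"
  using Mu_hom[OF assms] Mu_iso[OF assms] by auto

lemma inverse_arrows_AMap:
  assumes "is_iso C f"
  shows "inverse_arrows D (AMap F f) (AMap F (inv\<^bsub>C\<^esub> f))"
  using assms by (intro D.inverse_arrowsI) (simp_all add: C.iso_Arr flip: AMap_Comp_simp)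

lemma is_iso_AMap [simp]: "is_iso C f \<Longrightarrow> is_iso D (AMap F f)"
  and AMap_inv [simp]: "is_iso C f \<Longrightarrow> AMap F (inv\<^bsub>C\<^esub> f) = inv (AMap F f)"
  using inverse_arrows_AMap D.inverse_arrows_is_iso D.inv_eqI by metis+

lemma Mu_nat_left:
  "\<lbrakk>f \<in> Arr C; B \<in> Obj C; Cod C f = A\<rbrakk>
    \<Longrightarrow> AMap F f \<lhd> OMap F B \<Zcomp> Mu F A B = Mu F (Dom C f) B \<Zcomp> AMap F (f \<lhd>\<^bsub>C\<^esub> B)"
  using Mu_natural[of f "Dom C f" "Cod C f" "\<one>\<^bsub>C\<^esub> B" B B] by (auto simp: rwhisker_def)

lemma Mu_nat_right:
  "\<lbrakk>f \<in> Arr C; B \<in> Obj C; Cod C f = A\<rbrakk>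
    \<Longrightarrow> OMap F B \<rhd> AMap F f \<Zcomp> Mu F B A = Mu F B (Dom C f) \<Zcomp> AMap F (B \<rhd>\<^bsub>C\<^esub> f)"
  using Mu_natural[of "\<one>\<^bsub>C\<^esub> B" B B f "Dom C f" "Cod C f"] by (auto simp: lwhisker_def)

lemma Mu_Assoc_whisker:
  "\<lbrakk>A \<in> Obj C; B \<in> Obj C; E \<in> Obj C\<rbrakk>
    \<Longrightarrow> Mu F A B \<lhd> OMap F E \<Zcomp> (Mu F (A \<odot>\<^bsub>C\<^esub> B) E \<Zcomp> AMap F (\<alpha>\<^bsub>C\<^esub> A B E))
        = \<alpha> (OMap F A) (OMap F B) (OMap F E) \<Zcomp> (OMap F A \<rhd> Mu F B E \<Zcomp> Mu F A (B \<odot>\<^bsub>C\<^esub> E))"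
  using Mu_Assoc[of A B E] by (simp add: lwhisker_def rwhisker_def D.assoc)

lemma Mu_LUnitor_whisker:
  "A \<in> Obj C
    \<Longrightarrow> Eps F \<lhd> OMap F A \<Zcomp> (Mu F \<I>\<^bsub>C\<^esub> A \<Zcomp> AMap F (\<lambda>\<^bsub>C\<^esub>_ A)) = \<lambda>_ (OMap F A)"
  using Mu_LUnitor[of A] by (simp add: lwhisker_def rwhisker_def D.assoc)

lemma Mu_RUnitor_whisker:
  "A \<in> Obj C
    \<Longrightarrow> OMap F A \<rhd> Eps F \<Zcomp> (Mu F A \<I>\<^bsub>C\<^esub> \<Zcomp> AMap F (\<rho>\<^bsub>C\<^esub> A)) = \<rho> (OMap F A)"
  using Mu_RUnitor[of A] by (simp add: lwhisker_def rwhisker_def D.assoc)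

lemma AMap_Assoc:
  assumes "X \<in> Obj C" "Y \<in> Obj C" "A \<in> Obj C"
  shows "AMap F (\<alpha>\<^bsub>C\<^esub> X Y A) = inv (Mu F (X \<odot>\<^bsub>C\<^esub> Y) A) \<Zcomp> (inv (Mu F X Y \<lhd> OMap F A) \<Zcomp>
    (\<alpha> (OMap F X) (OMap F Y) (OMap F A) \<Zcomp> (OMap F X \<rhd> Mu F Y A \<Zcomp> Mu F X (Y \<odot>\<^bsub>C\<^esub> A))))"
  using assms by (simp flip: Mu_Assoc_whisker)

lemma AMap_rwhisker:
  assumes "f \<in> Arr C" "B \<in> Obj C"
  shows "AMap F (f \<lhd>\<^bsub>C\<^esub> B) = inv (Mu F (Dom C f) B) \<Zcomp> (AMap F f \<lhd> OMap F B \<Zcomp> Mu F (Cod C f) B)"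
  using assms by (simp add: Mu_nat_left)

section \<open>The action induced by a strong monoidal functor\<close>

lemma act_simps [simp]:
  assumes "s \<in> Obj C" "t \<in> Obj C" "A \<in> Obj D"
  shows "act D F s t A \<in> Arr D" "Dom D (act D F s t A) = OMap F (s \<odot>\<^bsub>C\<^esub> t) \<odot> A"
    "Cod D (act D F s t A) = OMap F s \<odot> (OMap F t \<odot> A)" "is_iso D (act D F s t A)"
  using assms by (simp_all add: act_def)

lemma act_unit_simps [simp]:
  assumes "A \<in> Obj D"
  shows "act_unit D F A \<in> Arr D" "Dom D (act_unit D F A) = OMap F \<I>\<^bsub>C\<^esub> \<odot> A"
    "Cod D (act_unit D F A) = A" "is_iso D (act_unit D F A)"
  using assms by (simp_all add: act_unit_def)

lemma unit_state_act:
  assumes "f \<in> Arr D" "Dom D f = A" "Cod D f = B"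
  shows "unit_state D F A B f = act_unit D F A \<Zcomp> (f \<Zcomp> inv (act_unit D F B))"
proof -
  have "Eps F \<lhd> B = inv (inv (Eps F) \<lhd> B)"
    using assms by auto
  then show ?thesis
    using assms unfolding unit_state_def act_unit_def rwhisker_def[symmetric] by (auto simp: D.assoc)
qed

lemma join_state_act:
  assumes "f \<in> Arr D" "Dom D f = OMap F s \<odot> (OMap F t \<odot> A)" "Cod D f = OMap F s \<odot> (OMap F t \<odot> B)"
    "s \<in> Obj C" "t \<in> Obj C" "A \<in> Obj D" "B \<in> Obj D"
  shows "join_state D F s t A B f = act D F s t A \<Zcomp> (f \<Zcomp> inv (act D F s t B))"
  using assms unfolding join_state_def act_def rwhisker_def[symmetric]
  by (auto simp: D.assoc)

lemma act_nat_tail: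
  assumes "s \<in> Obj C" "t \<in> Obj C" "f \<in> Arr D" "Cod D f = B"
  shows "OMap F (s \<odot>\<^bsub>C\<^esub> t) \<rhd> f \<Zcomp> act D F s t B
    = act D F s t (Dom D f) \<Zcomp> OMap F s \<rhd> OMap F t \<rhd> f"
proof -
  have E1: "OMap F (s \<odot>\<^bsub>C\<^esub> t) \<rhd> f \<Zcomp> inv (Mu F s t) \<lhd> B
     = inv (Mu F s t) \<lhd> Dom D f \<Zcomp> (OMap F s \<odot> OMap F t) \<rhd> f"
    using assms by (intro D.whisker_exchange) auto
  have E2: "(OMap F s \<odot> OMap F t) \<rhd> f \<Zcomp> \<alpha> (OMap F s) (OMap F t) B =
    \<alpha> (OMap F s) (OMap F t) (Dom D f) \<Zcomp> OMap F s \<rhd> OMap F t \<rhd> f"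
    using assms D.Assoc_nat(3) by auto
  have "OMap F (s \<odot>\<^bsub>C\<^esub> t) \<rhd> f \<Zcomp> act D F s t B
     = (OMap F (s \<odot>\<^bsub>C\<^esub> t) \<rhd> f \<Zcomp> inv (Mu F s t) \<lhd> B) \<Zcomp> \<alpha> (OMap F s) (OMap F t) B"
    using assms unfolding act_def by (auto simp: D.assoc)
  also have "\<dots> = inv (Mu F s t) \<lhd> Dom D f \<Zcomp> ((OMap F s \<odot> OMap F t) \<rhd> f \<Zcomp> \<alpha> (OMap F s) (OMap F t) B)"
    using assms unfolding E1 by (auto simp: D.assoc)
  also have "\<dots> = act D F s t (Dom D f) \<Zcomp> OMap F s \<rhd> OMap F t \<rhd> f"
    using assms unfolding E2 act_def by (auto simp: D.assoc)
  finally show ?thesis .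
qed

lemma act_unit_nat:
  assumes "f \<in> Arr D" "Cod D f = B"
  shows "OMap F \<I>\<^bsub>C\<^esub> \<rhd> f \<Zcomp> act_unit D F B = act_unit D F (Dom D f) \<Zcomp> f"
proof -
  have "OMap F \<I>\<^bsub>C\<^esub> \<rhd> f \<Zcomp> inv (Eps F) \<lhd> B = inv (Eps F) \<lhd> Dom D f \<Zcomp> \<I> \<rhd> f"
    using assms by (intro D.whisker_exchange) auto
  from this[THEN D.Comp_eq_assoc] show ?thesis
    using assms D.LUnitor_nat[of f B] by (auto simp: act_unit_def D.assoc)
qed

lemma AMap_ATensor:
  assumes "h \<in> Arr C" "k \<in> Arr C"
  shows "AMap F (h \<otimes>\<^bsub>C\<^esub> k) =
    inv (Mu F (Dom C h) (Dom C k)) \<Zcomp> ((AMap F h \<otimes> AMap F k) \<Zcomp> Mu F (Cod C h) (Cod C k))"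
  using assms Mu_natural[of h "Dom C h" "Cod C h" k "Dom C k" "Cod C k"] by simp

lemma act_nat_state:
  assumes "h \<in> Arr C" "k \<in> Arr C" "A \<in> Obj D"
  shows "AMap F (h \<otimes>\<^bsub>C\<^esub> k) \<lhd> A \<Zcomp> act D F (Cod C h) (Cod C k) A
    = act D F (Dom C h) (Dom C k) A \<Zcomp> (AMap F h \<otimes> (AMap F k \<lhd> A))"
proof -
  have E: "(AMap F h \<otimes> AMap F k) \<lhd> A \<Zcomp> \<alpha> (OMap F (Cod C h)) (OMap F (Cod C k)) A
    = \<alpha> (OMap F (Dom C h)) (OMap F (Dom C k)) A \<Zcomp> (AMap F h \<otimes> (AMap F k \<lhd> A))"
    unfolding rwhisker_def using assms
    by (intro D.Assoc_natural) auto
  show ?thesis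
    using assms unfolding act_def by (simp add: AMap_ATensor D.assoc E)
qed

text \<open>\<open>Mu_Assoc\<close> with a tail. This lemma and its analogues for the unitors and
  the symmetry relate the image of a coherence isomorphism to \<open>act\<close> and
  \<open>act_unit\<close>; that image is the factor introduced by a slide along the
  isomorphism.\<close>

lemma act_Assoc:
  assumes "s \<in> Obj C" "t \<in> Obj C" "u \<in> Obj C" "A \<in> Obj D"
  shows "AMap F (\<alpha>\<^bsub>C\<^esub> s t u) \<lhd> A \<Zcomp> (act D F s (t \<odot>\<^bsub>C\<^esub> u) A \<Zcomp> OMap F s \<rhd> act D F t u A)
    = act D F (s \<odot>\<^bsub>C\<^esub> t) u A \<Zcomp> act D F s t (OMap F u \<odot> A)"
proof -
  show ?thesis
    using assms unfolding act_def
    by (simp add: AMap_Assoc D.whisker_rebracket D.rwhisker_Assoc D.assoc)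
qed

lemma act_LUnitor:
  assumes "s \<in> Obj C" "A \<in> Obj D"
  shows "AMap F (\<lambda>\<^bsub>C\<^esub>_ s) \<lhd> A = act D F \<I>\<^bsub>C\<^esub> s A \<Zcomp> act_unit D F (OMap F s \<odot> A)"
proof -
  have E: "AMap F (\<lambda>\<^bsub>C\<^esub>_ s) = inv (Mu F \<I>\<^bsub>C\<^esub> s) \<Zcomp> (inv (Eps F \<lhd> OMap F s) \<Zcomp> \<lambda>_ (OMap F s))"
    using assms by (simp flip: Mu_LUnitor_whisker)
  show ?thesis
    using assms unfolding act_def act_unit_def E
    by (simp add: D.whisker_rebracket D.rwhisker_LUnitor D.assoc)
qed

lemma act_RUnitor:
  assumes "s \<in> Obj C" "A \<in> Obj D"
  shows "AMap F (\<rho>\<^bsub>C\<^esub> s) \<lhd> A = act D F s \<I>\<^bsub>C\<^esub> A \<Zcomp> OMap F s \<rhd> act_unit D F A"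
proof -
  have E: "AMap F (\<rho>\<^bsub>C\<^esub> s) = inv (Mu F s \<I>\<^bsub>C\<^esub>) \<Zcomp> (inv (OMap F s \<rhd> Eps F) \<Zcomp> \<rho> (OMap F s))"
    using assms by (simp flip: Mu_RUnitor_whisker)
  show ?thesis
    using assms unfolding act_def act_unit_def E
    by (simp add: D.whisker_rebracket D.rwhisker_RUnitor D.assoc)
qed

lemma act_Symm:
  assumes "s \<in> Obj C" "t \<in> Obj C" "A \<in> Obj D"
  shows "AMap F (\<sigma>\<^bsub>C\<^esub> s t) \<lhd> A \<Zcomp> act D F t s A = act D F s t A \<Zcomp> \<omega> (OMap F s) (OMap F t) A"
proof -
  have E: "AMap F (\<sigma>\<^bsub>C\<^esub> s t) = inv (Mu F s t) \<Zcomp> (\<sigma> (OMap F s) (OMap F t) \<Zcomp> Mu F t s)"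
    using assms by (simp flip: Mu_Symm)
  show ?thesis
    using assms unfolding act_def E by (simp add: D.rwhisker_Symm D.assoc)
qed

lemma swap_act:
  assumes "s \<in> Obj C" "t \<in> Obj C" "X \<in> Obj D" "A \<in> Obj D"
  shows "\<omega> (OMap F (s \<odot>\<^bsub>C\<^esub> t)) X A \<Zcomp> X \<rhd> act D F s t A
    = act D F s t (X \<odot> A) \<Zcomp> (OMap F s \<rhd> \<omega> (OMap F t) X A \<Zcomp> \<omega> (OMap F s) X (OMap F t \<odot> A))"
proof -
  have "\<omega> (OMap F (s \<odot>\<^bsub>C\<^esub> t)) X A \<Zcomp> X \<rhd> (inv (Mu F s t) \<lhd> A)
    = inv (Mu F s t) \<lhd> (X \<odot> A) \<Zcomp> \<omega> (OMap F s \<odot> OMap F t) X A"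
    using assms D.swap_nat_left[of "inv (Mu F s t)" X A] by simp
  from this[THEN D.Comp_eq_assoc] show ?thesis
    using assms unfolding act_def by (simp add: D.swap_OTensor_left D.assoc)
qed

lemma swap_act_unit:
  assumes "X \<in> Obj D" "A \<in> Obj D"
  shows "\<omega> (OMap F \<I>\<^bsub>C\<^esub>) X A \<Zcomp> X \<rhd> act_unit D F A = act_unit D F (X \<odot> A)"
proof -
  have "\<omega> (OMap F \<I>\<^bsub>C\<^esub>) X A \<Zcomp> X \<rhd> (inv (Eps F) \<lhd> A) = inv (Eps F) \<lhd> (X \<odot> A) \<Zcomp> \<omega> \<I> X A"
    using assms D.swap_nat_left[of "inv (Eps F)" X A] by simp
  from this[THEN D.Comp_eq_assoc] show ?thesis
    using assms unfolding act_unit_def by (simp add: D.swap_LUnitor D.assoc)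
qed

lemma rwhisker_act:
  assumes "s \<in> Obj C" "t \<in> Obj C" "A \<in> Obj D" "B \<in> Obj D"
  shows "act D F s t A \<lhd> B = \<alpha> (OMap F (s \<odot>\<^bsub>C\<^esub> t)) A B \<Zcomp> (act D F s t (A \<odot> B) \<Zcomp>
    (inv (OMap F s \<rhd> \<alpha> (OMap F t) A B) \<Zcomp> inv (\<alpha> (OMap F s) (OMap F t \<odot> A) B)))"
  using assms unfolding act_def by (simp add: D.whisker_rebracket D.rwhisker_Assoc D.assoc)

lemma rwhisker_act_unit:
  assumes "A \<in> Obj D" "B \<in> Obj D"
  shows "act_unit D F A \<lhd> B = \<alpha> (OMap F \<I>\<^bsub>C\<^esub>) A B \<Zcomp> act_unit D F (A \<odot> B)"
  using assms unfolding act_unit_def by (simp add: D.whisker_rebracket D.rwhisker_LUnitor D.assoc)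

end

text \<open>In each coherence axiom, naturality of \<open>Mu G\<close> moves the images of the
  structure maps of \<open>F\<close> together. What remains is the axiom for \<open>G\<close>
  followed by the image under \<open>G\<close> of the axiom for \<open>F\<close>.\<close>

lemma symmetric_monoidal_functor_mf_comp:
  assumes "symmetric_monoidal_functor C D F" "symmetric_monoidal_functor D E G"
  shows "symmetric_monoidal_functor C E (mf_comp E F G)"
proof -
  interpret F: symmetric_monoidal_functor C D F by fact
  interpret G: symmetric_monoidal_functor D E G by fact
  let ?H = "mf_comp E F G"
  note [simp] = mf_comp_def
  show ?thesis
  proof unfold_locales
    fix A B f assume "f \<in> hom C A B" then show "AMap ?H f \<in> hom E (OMap ?H A) (OMap ?H B)" by auto
  next
    fix A B Z f g assume "f \<in> hom C A B" "g \<in> hom C B Z"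
    then show "AMap ?H (f \<Zcomp>\<^bsub>C\<^esub> g) = AMap ?H f \<Zcomp>\<^bsub>E\<^esub> AMap ?H g" by auto
  next
    fix A A' f B B' g assume *: "f \<in> hom C A A'" "g \<in> hom C B B'"
    then have [simp]: "A \<in> Obj C" "A' \<in> Obj C" "B \<in> Obj C" "B' \<in> Obj C" by auto
    have E1: "(AMap G (AMap F f) \<otimes>\<^bsub>E\<^esub> AMap G (AMap F g)) \<Zcomp>\<^bsub>E\<^esub> Mu G (OMap F A') (OMap F B') =
      Mu G (OMap F A) (OMap F B) \<Zcomp>\<^bsub>E\<^esub> AMap G (AMap F f \<otimes>\<^bsub>D\<^esub> AMap F g)"
      using * by (intro G.Mu_natural) auto
    show "(AMap ?H f \<otimes>\<^bsub>E\<^esub> AMap ?H g) \<Zcomp>\<^bsub>E\<^esub> Mu ?H A' B' = Mu ?H A B \<Zcomp>\<^bsub>E\<^esub> AMap ?H (f \<otimes>\<^bsub>C\<^esub> g)"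
      using * by (simp add: F.AMap_ATensor G.D.assoc E1[THEN G.D.Comp_eq_assoc])
  next
    fix A B Z assume *: "A \<in> Obj C" "B \<in> Obj C" "Z \<in> Obj C"
    have E1: "AMap G (Mu F A B) \<lhd>\<^bsub>E\<^esub> OMap G (OMap F Z) \<Zcomp>\<^bsub>E\<^esub> Mu G (OMap F (A \<odot>\<^bsub>C\<^esub> B)) (OMap F Z)
      = Mu G (OMap F A \<odot>\<^bsub>D\<^esub> OMap F B) (OMap F Z) \<Zcomp>\<^bsub>E\<^esub> AMap G (Mu F A B \<lhd>\<^bsub>D\<^esub> OMap F Z)"
      using * G.Mu_nat_left[of "Mu F A B" "OMap F Z"] by simp
    have E2: "OMap G (OMap F A) \<rhd>\<^bsub>E\<^esub> AMap G (Mu F B Z) \<Zcomp>\<^bsub>E\<^esub> Mu G (OMap F A) (OMap F (B \<odot>\<^bsub>C\<^esub> Z))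
      = Mu G (OMap F A) (OMap F B \<odot>\<^bsub>D\<^esub> OMap F Z) \<Zcomp>\<^bsub>E\<^esub> AMap G (OMap F A \<rhd>\<^bsub>D\<^esub> Mu F B Z)"
      using * G.Mu_nat_right[of "Mu F B Z" "OMap F A"] by simp
    have "AMap G (Mu F A B \<lhd>\<^bsub>D\<^esub> OMap F Z \<Zcomp>\<^bsub>D\<^esub> (Mu F (A \<odot>\<^bsub>C\<^esub> B) Z \<Zcomp>\<^bsub>D\<^esub> AMap F (\<alpha>\<^bsub>C\<^esub> A B Z))) =
      AMap G (\<alpha>\<^bsub>D\<^esub> (OMap F A) (OMap F B) (OMap F Z) \<Zcomp>\<^bsub>D\<^esub> (OMap F A \<rhd>\<^bsub>D\<^esub> Mu F B Z \<Zcomp>\<^bsub>D\<^esub> Mu F A (B \<odot>\<^bsub>C\<^esub> Z)))"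
      using * by (simp only: F.Mu_Assoc_whisker)
    then have E3: "AMap G (Mu F A B \<lhd>\<^bsub>D\<^esub> OMap F Z) \<Zcomp>\<^bsub>E\<^esub> (AMap G (Mu F (A \<odot>\<^bsub>C\<^esub> B) Z) \<Zcomp>\<^bsub>E\<^esub> AMap G (AMap F (\<alpha>\<^bsub>C\<^esub> A B Z))) =
      AMap G (\<alpha>\<^bsub>D\<^esub> (OMap F A) (OMap F B) (OMap F Z)) \<Zcomp>\<^bsub>E\<^esub> (AMap G (OMap F A \<rhd>\<^bsub>D\<^esub> Mu F B Z) \<Zcomp>\<^bsub>E\<^esub> AMap G (Mu F A (B \<odot>\<^bsub>C\<^esub> Z)))"
      using * by simp
    \<comment> \<open>The axiom for \<open>G\<close> is needed in front of an arbitrary continuation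
      \<open>k\<close>, since in the goal the images of the structure maps of \<open>F\<close>
      follow it.\<close>
    have E4: "Mu G (OMap F A) (OMap F B) \<lhd>\<^bsub>E\<^esub> OMap G (OMap F Z) \<Zcomp>\<^bsub>E\<^esub> (Mu G (OMap F A \<odot>\<^bsub>D\<^esub> OMap F B) (OMap F Z) \<Zcomp>\<^bsub>E\<^esub>
      (AMap G (\<alpha>\<^bsub>D\<^esub> (OMap F A) (OMap F B) (OMap F Z)) \<Zcomp>\<^bsub>E\<^esub> k)) =
      \<alpha>\<^bsub>E\<^esub> (OMap G (OMap F A)) (OMap G (OMap F B)) (OMap G (OMap F Z)) \<Zcomp>\<^bsub>E\<^esub>
      (OMap G (OMap F A) \<rhd>\<^bsub>E\<^esub> Mu G (OMap F B) (OMap F Z) \<Zcomp>\<^bsub>E\<^esub> (Mu G (OMap F A) (OMap F B \<odot>\<^bsub>D\<^esub> OMap F Z) \<Zcomp>\<^bsub>E\<^esub> k))"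
      if "k \<in> Arr E" "Dom E k = OMap G (OMap F A \<odot>\<^bsub>D\<^esub> (OMap F B \<odot>\<^bsub>D\<^esub> OMap F Z))" for k
      using * that G.Mu_Assoc_whisker[of "OMap F A" "OMap F B" "OMap F Z", THEN arg_cong, of "\<lambda>x. x \<Zcomp>\<^bsub>E\<^esub> k"]
      by (simp add: G.D.assoc)
    show "(Mu ?H A B \<otimes>\<^bsub>E\<^esub> \<one>\<^bsub>E\<^esub> (OMap ?H Z)) \<Zcomp>\<^bsub>E\<^esub> Mu ?H (A \<odot>\<^bsub>C\<^esub> B) Z \<Zcomp>\<^bsub>E\<^esub> AMap ?H (\<alpha>\<^bsub>C\<^esub> A B Z)
          = \<alpha>\<^bsub>E\<^esub> (OMap ?H A) (OMap ?H B) (OMap ?H Z) \<Zcomp>\<^bsub>E\<^esub> (\<one>\<^bsub>E\<^esub> (OMap ?H A) \<otimes>\<^bsub>E\<^esub> Mu ?H B Z)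
            \<Zcomp>\<^bsub>E\<^esub> Mu ?H A (B \<odot>\<^bsub>C\<^esub> Z)"
      unfolding lwhisker_def[symmetric] rwhisker_def[symmetric]
      using * by (simp add: G.D.assoc E1[THEN G.D.Comp_eq_assoc] E2[THEN G.D.Comp_eq_assoc] E3 E4)
  next
    fix A assume *: "A \<in> Obj C"
    have E1: "AMap G (Eps F) \<lhd>\<^bsub>E\<^esub> OMap G (OMap F A) \<Zcomp>\<^bsub>E\<^esub> Mu G (OMap F \<I>\<^bsub>C\<^esub>) (OMap F A)
      = Mu G \<I>\<^bsub>D\<^esub> (OMap F A) \<Zcomp>\<^bsub>E\<^esub> AMap G (Eps F \<lhd>\<^bsub>D\<^esub> OMap F A)"
      using * G.Mu_nat_left[of "Eps F" "OMap F A"] by simp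
    have E2: "OMap G (OMap F A) \<rhd>\<^bsub>E\<^esub> AMap G (Eps F) \<Zcomp>\<^bsub>E\<^esub> Mu G (OMap F A) (OMap F \<I>\<^bsub>C\<^esub>)
      = Mu G (OMap F A) \<I>\<^bsub>D\<^esub> \<Zcomp>\<^bsub>E\<^esub> AMap G (OMap F A \<rhd>\<^bsub>D\<^esub> Eps F)"
      using * G.Mu_nat_right[of "Eps F" "OMap F A"] by simp
    have E3: "AMap G (Eps F \<lhd>\<^bsub>D\<^esub> OMap F A) \<Zcomp>\<^bsub>E\<^esub> (AMap G (Mu F \<I>\<^bsub>C\<^esub> A) \<Zcomp>\<^bsub>E\<^esub> AMap G (AMap F (\<lambda>\<^bsub>C\<^esub>_ A))) =
      AMap G (\<lambda>\<^bsub>D\<^esub>_ (OMap F A))"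
      using * F.Mu_LUnitor_whisker[of A, THEN arg_cong, of "AMap G"] by simp
    have E4: "AMap G (OMap F A \<rhd>\<^bsub>D\<^esub> Eps F) \<Zcomp>\<^bsub>E\<^esub> (AMap G (Mu F A \<I>\<^bsub>C\<^esub>) \<Zcomp>\<^bsub>E\<^esub> AMap G (AMap F (\<rho>\<^bsub>C\<^esub> A))) =
      AMap G (\<rho>\<^bsub>D\<^esub> (OMap F A))"
      using * F.Mu_RUnitor_whisker[of A, THEN arg_cong, of "AMap G"] by simp
    show "(Eps ?H \<otimes>\<^bsub>E\<^esub> \<one>\<^bsub>E\<^esub> (OMap ?H A)) \<Zcomp>\<^bsub>E\<^esub> Mu ?H \<I>\<^bsub>C\<^esub> A \<Zcomp>\<^bsub>E\<^esub> AMap ?H (\<lambda>\<^bsub>C\<^esub>_ A) = \<lambda>\<^bsub>E\<^esub>_ (OMap ?H A)"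
      unfolding lwhisker_def[symmetric] rwhisker_def[symmetric]
      using * by (simp add: G.D.assoc E1[THEN G.D.Comp_eq_assoc] E3 G.Mu_LUnitor_whisker)
    show "(\<one>\<^bsub>E\<^esub> (OMap ?H A) \<otimes>\<^bsub>E\<^esub> Eps ?H) \<Zcomp>\<^bsub>E\<^esub> Mu ?H A \<I>\<^bsub>C\<^esub> \<Zcomp>\<^bsub>E\<^esub> AMap ?H (\<rho>\<^bsub>C\<^esub> A) = \<rho>\<^bsub>E\<^esub> (OMap ?H A)"
      unfolding lwhisker_def[symmetric] rwhisker_def[symmetric]
      using * by (simp add: G.D.assoc E2[THEN G.D.Comp_eq_assoc] E4 G.Mu_RUnitor_whisker)
  next
    fix A B assume *: "A \<in> Obj C" "B \<in> Obj C"
    have E1: "AMap G (Mu F A B) \<Zcomp>\<^bsub>E\<^esub> AMap G (AMap F (\<sigma>\<^bsub>C\<^esub> A B)) =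
      AMap G (\<sigma>\<^bsub>D\<^esub> (OMap F A) (OMap F B)) \<Zcomp>\<^bsub>E\<^esub> AMap G (Mu F B A)"
      using * F.Mu_Symm[of A B, THEN arg_cong, of "AMap G"] by simp
    have E2: "Mu G (OMap F A) (OMap F B) \<Zcomp>\<^bsub>E\<^esub> AMap G (\<sigma>\<^bsub>D\<^esub> (OMap F A) (OMap F B)) =
      \<sigma>\<^bsub>E\<^esub> (OMap G (OMap F A)) (OMap G (OMap F B)) \<Zcomp>\<^bsub>E\<^esub> Mu G (OMap F B) (OMap F A)"
      using * by (intro G.Mu_Symm) auto
    show "Mu ?H A B \<Zcomp>\<^bsub>E\<^esub> AMap ?H (\<sigma>\<^bsub>C\<^esub> A B) = \<sigma>\<^bsub>E\<^esub> (OMap ?H A) (OMap ?H B) \<Zcomp>\<^bsub>E\<^esub> Mu ?H B A"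
      using * by (simp add: G.D.assoc E1 E2[THEN G.D.Comp_eq_assoc])
  qed (auto intro: F.OMap_Obj G.OMap_Obj)
qed

section \<open>Acting past and alongside other objects\<close>

text \<open>
  For an arrow \<open>f : X \<odot> A \<rightarrow> X \<odot> B\<close>, \<open>under\<close> inserts an idle \<open>Y\<close> between \<open>X\<close> and the tail, and
  \<open>extend\<close> adds an idle \<open>D\<close> behind the tail.  With \<open>X = R s\<close>, these are the two whiskerings of the
  process \<open>(s | f)\<close>.
\<close>

definition under :: "('o, 'a) smc \<Rightarrow> 'o \<Rightarrow> 'o \<Rightarrow> 'o \<Rightarrow> 'o \<Rightarrow> 'a \<Rightarrow> 'a" where
  "under C X A B Y f = \<omega>\<^bsub>C\<^esub> X Y A \<Zcomp>\<^bsub>C\<^esub> (Y \<rhd>\<^bsub>C\<^esub> f \<Zcomp>\<^bsub>C\<^esub> \<omega>\<^bsub>C\<^esub> Y X B)"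

definition extend :: "('o, 'a) smc \<Rightarrow> 'o \<Rightarrow> 'o \<Rightarrow> 'o \<Rightarrow> 'o \<Rightarrow> 'a \<Rightarrow> 'a" where
  "extend C X A B D f = inv\<^bsub>C\<^esub> (\<alpha>\<^bsub>C\<^esub> X A D) \<Zcomp>\<^bsub>C\<^esub> (f \<lhd>\<^bsub>C\<^esub> D \<Zcomp>\<^bsub>C\<^esub> \<alpha>\<^bsub>C\<^esub> X B D)"

context symmetric_monoidal_category
begin

lemma under_simps [simp]:
  assumes "f \<in> Arr C" "Dom C f = X \<odot> A" "Cod C f = X \<odot> B"
    "X \<in> Obj C" "A \<in> Obj C" "B \<in> Obj C" "Y \<in> Obj C"
  shows "under C X A B Y f \<in> Arr C" "Dom C (under C X A B Y f) = X \<odot> (Y \<odot> A)"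
    "Cod C (under C X A B Y f) = X \<odot> (Y \<odot> B)"
  using assms by (simp_all add: under_def)

lemma extend_simps [simp]:
  assumes "f \<in> Arr C" "Dom C f = X \<odot> A" "Cod C f = X \<odot> B"
    "X \<in> Obj C" "A \<in> Obj C" "B \<in> Obj C" "D \<in> Obj C"
  shows "extend C X A B D f \<in> Arr C" "Dom C (extend C X A B D f) = X \<odot> (A \<odot> D)"
    "Cod C (extend C X A B D f) = X \<odot> (B \<odot> D)"
  using assms by (simp_all add: extend_def)

lemma extend_lwhisker:
  assumes "u \<in> Arr C" "Dom C u = A" "Cod C u = B" "X \<in> Obj C" "D \<in> Obj C"
  shows "extend C X A B D (X \<rhd> u) = X \<rhd> (u \<lhd> D)"
  using assms by (auto simp: extend_def whisker_rebracket assoc)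

lemma extend_Comp:
  assumes "f \<in> Arr C" "Dom C f = X \<odot> A" "Cod C f = X \<odot> B"
    "g \<in> Arr C" "Dom C g = X \<odot> B" "Cod C g = X \<odot> D"
    "X \<in> Obj C" "A \<in> Obj C" "B \<in> Obj C" "D \<in> Obj C" "Y \<in> Obj C"
  shows "extend C X A D Y (f \<Zcomp> g) = extend C X A B Y f \<Zcomp> extend C X B D Y g"
  using assms by (simp add: extend_def assoc)

lemma extend_OTensor:
  assumes "f \<in> Arr C" "Dom C f = X \<odot> A" "Cod C f = X \<odot> B"
    "X \<in> Obj C" "A \<in> Obj C" "B \<in> Obj C" "D \<in> Obj C" "E \<in> Obj C"
  shows "extend C X (A \<odot> D) (B \<odot> D) E (extend C X A B D f) \<Zcomp> X \<rhd> \<alpha> B D E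
    = X \<rhd> \<alpha> A D E \<Zcomp> extend C X A B (D \<odot> E) f"
  using assms by (simp add: extend_def whisker_rebracket rwhisker_Assoc assoc)

lemma under_OTensor:
  assumes "f \<in> Arr C" "Dom C f = X \<odot> A" "Cod C f = X \<odot> B"
    "X \<in> Obj C" "A \<in> Obj C" "B \<in> Obj C" "Y \<in> Obj C" "Z \<in> Obj C"
  shows "under C X A B (Y \<odot> Z) f =
    X \<rhd> \<alpha> Y Z A \<Zcomp> (under C X (Z \<odot> A) (Z \<odot> B) Y (under C X A B Z f) \<Zcomp> inv (X \<rhd> \<alpha> Y Z B))"
  using assms swap_OTensor_left[of Y Z X B]
  by (simp add: under_def whisker_rebracket swap_OTensor_right assoc)

lemma extend_nat_tail:
  assumes "f \<in> Arr C" "Dom C f = X \<odot> A" "Cod C f = X \<odot> B" "g \<in> Arr C" "Dom C g = D" "Cod C g = E"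
    "X \<in> Obj C" "A \<in> Obj C" "B \<in> Obj C"
  shows "extend C X A B D f \<Zcomp> X \<rhd> B \<rhd> g = X \<rhd> A \<rhd> g \<Zcomp> extend C X A B E f"
proof -
  have o: "D \<in> Obj C" "E \<in> Obj C" using assms by auto
  have E1: "\<alpha> X B D \<Zcomp> X \<rhd> B \<rhd> g = (X \<odot> B) \<rhd> g \<Zcomp> \<alpha> X B E"
    using assms o by (simp add: whisker_rebracket assoc)
  have E2: "f \<lhd> D \<Zcomp> (X \<odot> B) \<rhd> g = (X \<odot> A) \<rhd> g \<Zcomp> f \<lhd> E"
    using assms by (intro whisker_exchange[symmetric])
  have E3: "inv (\<alpha> X A D) \<Zcomp> (X \<odot> A) \<rhd> g = X \<rhd> A \<rhd> g \<Zcomp> inv (\<alpha> X A E)"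
    using assms o by (simp add: whisker_rebracket assoc)
  show ?thesis
    using assms o by (simp add: extend_def assoc E1 E2[THEN Comp_eq_assoc] E3[THEN Comp_eq_assoc])
qed

text \<open>Naturality of the swap at \<open>f\<close> itself moves \<open>Y\<close> behind the
  whole of \<open>X \<odot> A\<close>. By the hexagons the swaps past \<open>X\<close> cancel, and
  only those past \<open>A\<close> and \<open>B\<close> are left.\<close>

lemma under_extend:
  assumes "f \<in> Arr C" "Dom C f = X \<odot> A" "Cod C f = X \<odot> B"
    "X \<in> Obj C" "A \<in> Obj C" "B \<in> Obj C" "Y \<in> Obj C" "D \<in> Obj C"
  shows "under C X (A \<odot> D) (B \<odot> D) Y (extend C X A B D f) =
    X \<rhd> \<omega> Y A D \<Zcomp> (extend C X A B (Y \<odot> D) f \<Zcomp> X \<rhd> \<omega> B Y D)"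
proof -
  have "Y \<rhd> (f \<lhd> D) = \<omega> Y (X \<odot> A) D \<Zcomp> (f \<lhd> (Y \<odot> D) \<Zcomp> \<omega> (X \<odot> B) Y D)"
    using assms swap_nat_left[of f Y D] by simp
  then show ?thesis
    using assms by (simp add: under_def extend_def swap_OTensor_left swap_OTensor_right assoc)
qed

lemma extend_under:
  assumes "f \<in> Arr C" "Dom C f = X \<odot> A" "Cod C f = X \<odot> B"
    "X \<in> Obj C" "A \<in> Obj C" "B \<in> Obj C" "Y \<in> Obj C" "D \<in> Obj C"
  shows "extend C X (Y \<odot> A) (Y \<odot> B) D (under C X A B Y f) \<Zcomp> X \<rhd> \<alpha> Y B D =
    X \<rhd> \<alpha> Y A D \<Zcomp> under C X (A \<odot> D) (B \<odot> D) Y (extend C X A B D f)"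
  using assms by (simp add: under_def extend_def whisker_rebracket rwhisker_swap assoc)

text \<open>By \<open>swap_Symm\<close> an idle object in front of the tail is one behind it, up to
  the symmetry. This is the source of strength on the left and of the naturality of
  \<open>\<sigma>\<close> for processes.\<close>

lemma under_Symm:
  assumes "f \<in> Arr C" "Dom C f = X \<odot> A" "Cod C f = X \<odot> B"
    "X \<in> Obj C" "A \<in> Obj C" "B \<in> Obj C" "Y \<in> Obj C"
  shows "under C X A B Y f = X \<rhd> \<sigma> Y A \<Zcomp> (extend C X A B Y f \<Zcomp> X \<rhd> \<sigma> B Y)"
proof -
  have E1: "\<omega> X Y A = X \<rhd> \<sigma> Y A \<Zcomp> (inv (\<alpha> X A Y) \<Zcomp> \<sigma> (X \<odot> A) Y)"
    using assms by (simp add: swap_Symm)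
  have "inv (\<omega> X Y B) = inv (X \<rhd> \<sigma> Y B \<Zcomp> (inv (\<alpha> X B Y) \<Zcomp> \<sigma> (X \<odot> B) Y))"
    using assms by (simp add: swap_Symm del: inv_Comp swap_inv)
  then have E2: "\<omega> Y X B = \<sigma> Y (X \<odot> B) \<Zcomp> (\<alpha> X B Y \<Zcomp> X \<rhd> \<sigma> B Y)"
    using assms by (simp add: assoc)
  have E3: "Y \<rhd> f = \<sigma> Y (X \<odot> A) \<Zcomp> (f \<lhd> Y \<Zcomp> \<sigma> (X \<odot> B) Y)"
    using assms Symm_nat_left[of f Y] by simp
  show ?thesis
    using assms by (simp add: under_def extend_def E1 E2 E3 assoc)
qed

text \<open>The strand \<open>Z\<close> crosses \<open>X\<close> and \<open>Y\<close> in two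
  different orders. Yang-Baxter changes the order before \<open>f\<close> (\<open>E1\<close>) and
  after \<open>f\<close> (\<open>E4\<close>), and naturality of the swap in its tail lets
  \<open>f\<close> and \<open>g\<close> through. Both associativity of composition and functoriality
  of whiskering on the left rest on this.\<close>

lemma under_under:
  assumes f: "f \<in> Arr C" "Dom C f = X \<odot> A" "Cod C f = X \<odot> B"
    and g: "g \<in> Arr C" "Dom C g = Y \<odot> B" "Cod C g = Y \<odot> D"
    and [simp]: "X \<in> Obj C" "A \<in> Obj C" "B \<in> Obj C" "D \<in> Obj C" "Y \<in> Obj C" "Z \<in> Obj C"
  shows "X \<rhd> \<omega> Y Z A \<Zcomp> (under C X (Y \<odot> A) (Y \<odot> D) Z (under C X A B Y f \<Zcomp> X \<rhd> g) \<Zcomp> X \<rhd> \<omega> Z Y D)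
    = under C X (Z \<odot> A) (Z \<odot> B) Y (under C X A B Z f) \<Zcomp> X \<rhd> under C Y B D Z g"
proof -
  note E1 = yang_baxter[of X Y Z A, symmetric]
  have E2: "\<omega> Y Z (X \<odot> A) \<Zcomp> Z \<rhd> Y \<rhd> f = Y \<rhd> Z \<rhd> f \<Zcomp> \<omega> Y Z (X \<odot> B)"
    using f swap_nat_tail[of Y Z f] by simp
  have E3: "Z \<rhd> X \<rhd> g \<Zcomp> \<omega> Z X (Y \<odot> D) = \<omega> Z X (Y \<odot> B) \<Zcomp> X \<rhd> Z \<rhd> g"
    using g swap_nat_tail[of Z X g] by simp
  note E4 = yang_baxter[of Y Z X B]
  show ?thesis
    using f g by (simp add: under_def assoc E1[THEN Comp_eq_assoc3] E2[THEN Comp_eq_assoc]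
      E3[THEN Comp_eq_assoc] E4[THEN Comp_eq_assoc3])
qed

text \<open>By \<open>under_extend\<close>, \<open>f\<close> runs in front of the passive tail
  \<open>Y \<odot> A'\<close>, and \<open>g\<close> acts inside that tail; so the two commute by
  \<open>extend_nat_tail\<close>, and the surrounding swaps match.\<close>

lemma under_extend_exchange:
  assumes f: "f \<in> Arr C" "Dom C f = X \<odot> A" "Cod C f = X \<odot> B"
    and g: "g \<in> Arr C" "Dom C g = Y \<odot> A'" "Cod C g = Y \<odot> B'"
    and [simp]: "X \<in> Obj C" "A \<in> Obj C" "B \<in> Obj C" "Y \<in> Obj C" "A' \<in> Obj C" "B' \<in> Obj C"
  shows "under C X (A \<odot> A') (B \<odot> A') Y (extend C X A B A' f) \<Zcomp> X \<rhd> under C Y A' B' B g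
    = X \<rhd> under C Y A' B' A g \<Zcomp> under C X (A \<odot> B') (B \<odot> B') Y (extend C X A B B' f)"
proof -
  have E: "extend C X A B (Y \<odot> A') f \<Zcomp> X \<rhd> B \<rhd> g = X \<rhd> A \<rhd> g \<Zcomp> extend C X A B (Y \<odot> B') f"
    using f g by (intro extend_nat_tail) simp_all
  show ?thesis
    using f g by (simp add: under_extend under_def[of C Y] assoc E[THEN Comp_eq_assoc])
qed

lemma tensor_under_extend:
  assumes f: "f \<in> Arr C" "Dom C f = X \<odot> A" "Cod C f = X \<odot> B"
    and g: "g \<in> Arr C" "Dom C g = Y \<odot> A'" "Cod C g = Y \<odot> B'"
    and [simp]: "X \<in> Obj C" "A \<in> Obj C" "B \<in> Obj C" "Y \<in> Obj C" "A' \<in> Obj C" "B' \<in> Obj C"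
  shows "middle_swap C X Y A A' \<Zcomp> ((f \<otimes> g) \<Zcomp> middle_swap C X B Y B') =
    \<alpha> X Y (A \<odot> A') \<Zcomp> (under C X (A \<odot> A') (B \<odot> A') Y (extend C X A B A' f)
      \<Zcomp> (X \<rhd> under C Y A' B' B g \<Zcomp> inv (\<alpha> X Y (B \<odot> B'))))"
proof -
  \<comment> \<open>Between its associators, \<open>middle_swap\<close> is a whiskered
    \<open>\<omega>\<close>, so the swaps around \<open>f \<otimes> g\<close> are those produced by
    \<open>under_extend\<close> and \<open>under\<close>.\<close>
  have m: "middle_swap C X Y A B = \<alpha> X Y (A \<odot> B) \<Zcomp> (X \<rhd> \<omega> Y A B \<Zcomp> inv (\<alpha> X A (Y \<odot> B)))"
    if "X \<in> Obj C" "A \<in> Obj C" "B \<in> Obj C" "Y \<in> Obj C" for X Y A B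
    using that by (simp add: middle_swap_def lwhisker_def rwhisker_def swap_def assoc)
  show ?thesis
    using f g by (simp add: m ATensor_whisker under_extend under_def[of C Y] extend_def[of C X A B "Y \<odot> A'"]
      whisker_rebracket assoc)
qed

lemma under_TUnit:
  assumes "X \<in> Obj C" "A \<in> Obj C" "B \<in> Obj C" "f \<in> Arr C" "Dom C f = X \<odot> A" "Cod C f = X \<odot> B"
  shows "under C X A B \<I> f \<Zcomp> X \<rhd> \<lambda>_ B = X \<rhd> \<lambda>_ A \<Zcomp> f"
proof -
  have E: "\<omega> X \<I> A \<Zcomp> \<lambda>_ (X \<odot> A) = X \<rhd> \<lambda>_ A"
    using assms by (simp flip: swap_LUnitor)
  show ?thesis
    using assms LUnitor_nat[of f "X \<odot> B"]
    by (simp add: under_def assoc swap_LUnitor E[THEN Comp_eq_assoc])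
qed

lemma extend_TUnit:
  assumes "X \<in> Obj C" "A \<in> Obj C" "B \<in> Obj C" "f \<in> Arr C" "Dom C f = X \<odot> A" "Cod C f = X \<odot> B"
  shows "extend C X A B \<I> f \<Zcomp> X \<rhd> \<rho> B = X \<rhd> \<rho> A \<Zcomp> f"
proof -
  have "\<alpha> X B \<I> \<Zcomp> X \<rhd> \<rho> B = \<rho> (X \<odot> B)" "inv (\<alpha> X A \<I>) \<Zcomp> (\<rho> (X \<odot> A) \<Zcomp> f) = X \<rhd> \<rho> A \<Zcomp> f"
    using assms by (simp_all add: RUnitor_OTensor assoc)
  then show ?thesis
    using assms RUnitor_nat[of f "X \<odot> B"] by (simp add: extend_def assoc)
qed

end

context symmetric_monoidal_functor
begin

text \<open>\<open>swap_act\<close> solved for the swap with a joint state, together with naturality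
  of \<open>act\<close> in the tail. It describes how a process is carried past the joint state of a
  composite.\<close>

lemma under_act:
  assumes "s \<in> Obj C" "t \<in> Obj C" "X \<in> Obj D" "A \<in> Obj D" "B \<in> Obj D"
    "f \<in> Arr D" "Dom D f = X \<odot> A" "Cod D f = X \<odot> B"
  shows "under D X A B (OMap F (s \<odot>\<^bsub>C\<^esub> t)) f = X \<rhd> act D F s t A \<Zcomp>
    (under D X (OMap F t \<odot> A) (OMap F t \<odot> B) (OMap F s) (under D X A B (OMap F t) f)
      \<Zcomp> inv (X \<rhd> act D F s t B))"
proof -
  have E: "\<omega> (OMap F (s \<odot>\<^bsub>C\<^esub> t)) X A = act D F s t (X \<odot> A) \<Zcomp> (OMap F s \<rhd> \<omega> (OMap F t) X A \<Zcomp>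
    (\<omega> (OMap F s) X (OMap F t \<odot> A) \<Zcomp> inv (X \<rhd> act D F s t A)))" if "A \<in> Obj D" for A
    using D.move_right[OF _ _ _ swap_act[of s t X A, symmetric]] assms that by (simp add: D.assoc)
  have "inv (\<omega> (OMap F (s \<odot>\<^bsub>C\<^esub> t)) X A) = inv (act D F s t (X \<odot> A) \<Zcomp> (OMap F s \<rhd> \<omega> (OMap F t) X A \<Zcomp>
    (\<omega> (OMap F s) X (OMap F t \<odot> A) \<Zcomp> inv (X \<rhd> act D F s t A))))"
    using assms by (simp only: E)
  then have E': "\<omega> X (OMap F (s \<odot>\<^bsub>C\<^esub> t)) A = X \<rhd> act D F s t A \<Zcomp> (\<omega> X (OMap F s) (OMap F t \<odot> A) \<Zcomp>
    (OMap F s \<rhd> \<omega> X (OMap F t) A \<Zcomp> inv (act D F s t (X \<odot> A))))"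
    using assms by (simp add: D.assoc)
  have E2: "OMap F (s \<odot>\<^bsub>C\<^esub> t) \<rhd> f \<Zcomp> act D F s t (X \<odot> B) = act D F s t (X \<odot> A) \<Zcomp> OMap F s \<rhd> OMap F t \<rhd> f"
    using assms act_nat_tail[of s t f "X \<odot> B"] by simp
  then show ?thesis
    using assms by (simp add: under_def E E' D.assoc E2[THEN D.Comp_eq_assoc])
qed

lemma under_act_unit:
  assumes "X \<in> Obj D" "A \<in> Obj D" "B \<in> Obj D" "f \<in> Arr D" "Dom D f = X \<odot> A" "Cod D f = X \<odot> B"
  shows "under D X A B (OMap F \<I>\<^bsub>C\<^esub>) f = X \<rhd> act_unit D F A \<Zcomp> (f \<Zcomp> inv (X \<rhd> act_unit D F B))"
proof -
  have E: "\<omega> (OMap F \<I>\<^bsub>C\<^esub>) X A = act_unit D F (X \<odot> A) \<Zcomp> inv (X \<rhd> act_unit D F A)" if "A \<in> Obj D" for A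
    using D.move_right[OF _ _ _ swap_act_unit[of X A, symmetric]] assms that by simp
  have "inv (\<omega> (OMap F \<I>\<^bsub>C\<^esub>) X A) = inv (act_unit D F (X \<odot> A) \<Zcomp> inv (X \<rhd> act_unit D F A))"
    using assms by (simp only: E)
  then have E': "\<omega> X (OMap F \<I>\<^bsub>C\<^esub>) A = X \<rhd> act_unit D F A \<Zcomp> inv (act_unit D F (X \<odot> A))"
    using assms by simp
  have E2: "OMap F \<I>\<^bsub>C\<^esub> \<rhd> f \<Zcomp> act_unit D F (X \<odot> B) = act_unit D F (X \<odot> A) \<Zcomp> f"
    using assms act_unit_nat[of f "X \<odot> B"] by simp
  then show ?thesis
    using assms by (simp add: under_def E E' D.assoc E2[THEN D.Comp_eq_assoc])
qed

end

section \<open>Stateful processes\<close>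

locale stateful_processes = R: symmetric_monoidal_functor S C R
  for C :: "('o, 'a) smc" (structure)
    and S :: "('s, 'h) smc"
    and R :: "('s, 'h, 'o, 'a) mfunctor"
begin

abbreviation proc where "proc \<equiv> processes C S R"
abbreviation cls where "cls A B s f \<equiv> St_class C S R A B (s, f)"
abbreviation join where "join \<equiv> join_state C R"
abbreviation \<S> where "\<S> \<equiv> St C S R"

lemma in_proc [simp]:
  "(s, f) \<in> proc A B \<longleftrightarrow>
    s \<in> Obj S \<and> f \<in> Arr C \<and> Dom C f = OMap R s \<odot> A \<and> Cod C f = OMap R s \<odot> B"
  by (auto simp: processes_def)

section \<open>The equivalence generated by sliding\<close>

lemma slides_subset:
  assumes "A \<in> Obj C" "B \<in> Obj C"
  shows "slides C S R A B \<subseteq> proc A B \<times> proc A B"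
  using assms unfolding slides_def rwhisker_def[symmetric] by auto

text \<open>The reflexive transitive closure lives on the whole type; restricting it to processes
  gives reflexivity on exactly that set, and symmetry and transitivity survive the
  restriction.\<close>

lemma equiv_process_rel: "equiv (proc A B) (process_rel C S R A B)"
proof -
  let ?r = "slides C S R A B \<union> (slides C S R A B)\<inverse>"
  have "sym (?r\<^sup>*)" by (intro sym_rtrancl) (auto simp: sym_def)
  then show ?thesis
    unfolding process_rel_def
    by (intro equivI refl_onI symI transI) (auto dest: symD intro: rtrancl_trans)
qed

lemma cls_eq_iff:
  assumes "p \<in> proc A B" "q \<in> proc A B"
  shows "St_class C S R A B p = St_class C S R A B q \<longleftrightarrow> (p, q) \<in> process_rel C S R A B"
  using assms eq_equiv_class_iff[OF equiv_process_rel] by (simp add: St_class_def)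

lemma cls_slide:
  assumes "h \<in> Arr S" "Dom S h = s" "Cod S h = t"
    and "f \<in> Arr C" "Dom C f = OMap R t \<odot> A" "Cod C f = OMap R s \<odot> B" "A \<in> Obj C" "B \<in> Obj C"
  shows "cls A B s (AMap R h \<lhd> A \<Zcomp> f) = cls A B t (f \<Zcomp> AMap R h \<lhd> B)"
proof -
  have "((s, AMap R h \<lhd> A \<Zcomp> f), (t, f \<Zcomp> AMap R h \<lhd> B)) \<in> slides C S R A B"
    using assms unfolding slides_def rwhisker_def by auto
  then show ?thesis
    using slides_subset[of A B] assms
    by (subst cls_eq_iff) (auto simp: process_rel_def)
qed

lemma cls_iso:
  assumes "is_iso S h" "Dom S h = s" "Cod S h = t" "(s, f) \<in> proc A B" "(t, g) \<in> proc A B"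
    "A \<in> Obj C" "B \<in> Obj C" "f \<Zcomp> AMap R h \<lhd> B = AMap R h \<lhd> A \<Zcomp> g"
  shows "cls A B s f = cls A B t g"
proof -
  have [simp]: "h \<in> Arr S" using assms R.C.iso_Arr by auto
  have o: "s \<in> Obj S" "t \<in> Obj S" using assms by auto
  \<comment> \<open>The middle arrow of the slide: both processes factor through it,
    \<open>f\<close> with \<open>R h\<close> before it and \<open>g\<close> with \<open>R h\<close>
    after it.\<close>
  let ?k = "g \<Zcomp> inv (AMap R h \<lhd> B)"
  have "f = AMap R h \<lhd> A \<Zcomp> ?k"
    using assms o R.D.move_right[of "AMap R h \<lhd> B" f, OF _ _ _ assms(8)[symmetric]]
    by (simp add: R.D.assoc)
  moreover have "g = ?k \<Zcomp> AMap R h \<lhd> B"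
    using assms o by (simp add: R.D.assoc)
  moreover have "cls A B s (AMap R h \<lhd> A \<Zcomp> ?k) = cls A B t (?k \<Zcomp> AMap R h \<lhd> B)"
    using assms o by (intro cls_slide) auto
  ultimately show ?thesis by simp
qed

text \<open>Equality is an equivalence, so a function that does not change along a single slide does
  not change along zigzags of slides and their converses.\<close>

lemma process_rel_induct:
  assumes pq: "(p, q) \<in> process_rel C S R A B" and AB: "A \<in> Obj C" "B \<in> Obj C"
    and slide: "\<And>s t h f. \<lbrakk>h \<in> Arr S; Dom S h = s; Cod S h = t; f \<in> Arr C;
      Dom C f = OMap R t \<odot> A; Cod C f = OMap R s \<odot> B\<rbrakk>
      \<Longrightarrow> \<phi> (s, AMap R h \<lhd> A \<Zcomp> f) = \<phi> (t, f \<Zcomp> AMap R h \<lhd> B)"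
  shows "\<phi> p = \<phi> q"
proof -
  have "(p, q) \<in> (slides C S R A B \<union> (slides C S R A B)\<inverse>)\<^sup>*"
    using pq by (auto simp: process_rel_def)
  then show ?thesis
  proof (induction rule: rtrancl_induct)
    case (step y z)
    have sl: "\<phi> y = \<phi> z" if "(y, z) \<in> slides C S R A B" for y z
      using that slide unfolding slides_def rwhisker_def by auto
    show ?case using step sl[of y z] sl[of z y] by (simp only: Un_iff converse_iff) metis
  qed simp
qed

text \<open>For an invariant \<open>\<phi>\<close> all members of the union coincide, so an
  operation defined by a union over representatives can be evaluated at any chosen one.\<close>

lemma cls_slide_arrow:
  assumes "\<And>s t h f. \<lbrakk>h \<in> Arr S; Dom S h = s; Cod S h = t; f \<in> Arr C;
      Dom C f = OMap R t \<odot> A; Cod C f = OMap R s \<odot> B\<rbrakk>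
      \<Longrightarrow> \<phi> (s, AMap R h \<lhd> A \<Zcomp> f) = \<phi> (t, f \<Zcomp> AMap R h \<lhd> B)"
    and "A \<in> Obj C" "B \<in> Obj C" "p \<in> proc A B"
  shows "(\<Union>q \<in> process_rel C S R A B `` {p}. \<phi> q) = \<phi> p"
proof -
  have "\<phi> q = \<phi> p" if "q \<in> process_rel C S R A B `` {p}" for q
    using process_rel_induct[of p q A B \<phi>] that assms by auto
  moreover have "p \<in> process_rel C S R A B `` {p}"
    using equiv_class_self[OF equiv_process_rel] assms by blast
  ultimately show ?thesis by blast
qed

lemma St_select [simp]:
  "Obj \<S> = Obj C" "TUnit \<S> = \<I>" "OTensor \<S> = (\<odot>)"
  "Dom \<S> (A, B, X) = A" "Cod \<S> (A, B, X) = B"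
  by (simp_all add: St_def)

lemma St_structure:
  "Assoc \<S> A B D = iota_arr C S R (\<alpha> A B D)" "LUnitor \<S> A = iota_arr C S R (\<lambda>_ A)"
  "RUnitor \<S> A = iota_arr C S R (\<rho> A)" "Symm \<S> A B = iota_arr C S R (\<sigma> A B)"
  by (simp_all add: St_def)

lemma Ide_St: "Ide \<S> A = cls A A \<I>\<^bsub>S\<^esub> (\<one> (OMap R \<I>\<^bsub>S\<^esub> \<odot> A))"
  by (simp add: St_def)

lemma cls_Dom_Cod [simp]: "Dom \<S> (cls A B s f) = A" "Cod \<S> (cls A B s f) = B"
  by (simp_all add: St_class_def)

lemma Arr_St: "Arr \<S> = St_Arr C S R"
  by (simp add: St_def)

lemma cls_Arr [simp]:
  assumes "(s, f) \<in> proc A B" "A \<in> Obj C" "B \<in> Obj C"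
  shows "cls A B s f \<in> Arr \<S>"
  using assms by (auto simp: Arr_St St_Arr_def St_class_def intro!: quotientI)

lemma St_Arr_cases:
  assumes "X \<in> Arr \<S>"
  obtains A B s f where "A \<in> Obj C" "B \<in> Obj C" "s \<in> Obj S" "f \<in> Arr C"
    "Dom C f = OMap R s \<odot> A" "Cod C f = OMap R s \<odot> B" "X = cls A B s f"
  using assms by (auto simp: Arr_St St_Arr_def St_class_def elim!: quotientE)

lemma St_hom_cases:
  assumes "X \<in> hom \<S> A B"
  obtains s f where "A \<in> Obj C" "B \<in> Obj C" "s \<in> Obj S" "f \<in> Arr C"
    "Dom C f = OMap R s \<odot> A" "Cod C f = OMap R s \<odot> B" "X = cls A B s f"
  using assms by (auto elim!: St_Arr_cases)

section \<open>Processes whose state is a tensor product\<close>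

lemma join_simps [simp]:
  assumes "s \<in> Obj S" "t \<in> Obj S" "A \<in> Obj C" "B \<in> Obj C"
    "f \<in> Arr C" "Dom C f = OMap R s \<odot> (OMap R t \<odot> A)" "Cod C f = OMap R s \<odot> (OMap R t \<odot> B)"
  shows "join s t A B f \<in> Arr C" "Dom C (join s t A B f) = OMap R (s \<odot>\<^bsub>S\<^esub> t) \<odot> A"
    "Cod C (join s t A B f) = OMap R (s \<odot>\<^bsub>S\<^esub> t) \<odot> B"
  using assms by (simp_all add: R.join_state_act)

lemma join_Comp:
  assumes "s \<in> Obj S" "t \<in> Obj S" "A \<in> Obj C" "B \<in> Obj C" "D \<in> Obj C"
    "f \<in> Arr C" "Dom C f = OMap R s \<odot> (OMap R t \<odot> A)" "Cod C f = OMap R s \<odot> (OMap R t \<odot> B)"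
    "g \<in> Arr C" "Dom C g = OMap R s \<odot> (OMap R t \<odot> B)" "Cod C g = OMap R s \<odot> (OMap R t \<odot> D)"
  shows "join s t A B f \<Zcomp> join s t B D g = join s t A D (f \<Zcomp> g)"
  using assms by (simp add: R.join_state_act R.D.assoc)

lemma join_lwhisker:
  assumes "s \<in> Obj S" "t \<in> Obj S" "u \<in> Arr C" "Dom C u = A" "Cod C u = B"
  shows "OMap R (s \<odot>\<^bsub>S\<^esub> t) \<rhd> u = join s t A B (OMap R s \<rhd> OMap R t \<rhd> u)"
proof -
  have o: "A \<in> Obj C" "B \<in> Obj C" using assms by auto
  have "OMap R (s \<odot>\<^bsub>S\<^esub> t) \<rhd> u = (OMap R (s \<odot>\<^bsub>S\<^esub> t) \<rhd> u \<Zcomp> act C R s t B) \<Zcomp> inv (act C R s t B)"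
    using assms o by (simp add: R.D.assoc)
  also have "\<dots> = join s t A B (OMap R s \<rhd> OMap R t \<rhd> u)"
    using assms o by (subst R.act_nat_tail) (simp_all add: R.join_state_act R.D.assoc)
  finally show ?thesis .
qed

lemma under_join:
  assumes "s \<in> Obj S" "t \<in> Obj S" "A \<in> Obj C" "B \<in> Obj C" "X \<in> Obj C"
    "f \<in> Arr C" "Dom C f = OMap R s \<odot> (OMap R t \<odot> A)" "Cod C f = OMap R s \<odot> (OMap R t \<odot> B)"
  shows "under C (OMap R (s \<odot>\<^bsub>S\<^esub> t)) A B X (join s t A B f) = join s t (X \<odot> A) (X \<odot> B)
    (OMap R s \<rhd> \<omega> (OMap R t) X A \<Zcomp> (under C (OMap R s) (OMap R t \<odot> A) (OMap R t \<odot> B) X f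
      \<Zcomp> OMap R s \<rhd> \<omega> X (OMap R t) B))"
proof -
  note E1 = R.swap_act[of s t X A, THEN R.D.Comp_eq_assoc]
  have "inv (\<omega> (OMap R (s \<odot>\<^bsub>S\<^esub> t)) X B \<Zcomp> X \<rhd> act C R s t B)
    = inv (act C R s t (X \<odot> B) \<Zcomp> (OMap R s \<rhd> \<omega> (OMap R t) X B \<Zcomp> \<omega> (OMap R s) X (OMap R t \<odot> B)))"
    using assms by (simp only: R.swap_act)
  then have E2: "inv (X \<rhd> act C R s t B) \<Zcomp> \<omega> X (OMap R (s \<odot>\<^bsub>S\<^esub> t)) B =
    \<omega> X (OMap R s) (OMap R t \<odot> B) \<Zcomp> (OMap R s \<rhd> \<omega> X (OMap R t) B \<Zcomp> inv (act C R s t (X \<odot> B)))"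
    using assms by (simp add: R.D.assoc)
  show ?thesis
    using assms by (simp add: R.join_state_act under_def R.D.assoc E1 E2)
qed

lemma extend_join:
  assumes "s \<in> Obj S" "t \<in> Obj S" "A \<in> Obj C" "B \<in> Obj C" "D \<in> Obj C"
    "f \<in> Arr C" "Dom C f = OMap R s \<odot> (OMap R t \<odot> A)" "Cod C f = OMap R s \<odot> (OMap R t \<odot> B)"
  shows "extend C (OMap R (s \<odot>\<^bsub>S\<^esub> t)) A B D (join s t A B f) = join s t (A \<odot> D) (B \<odot> D)
    (inv (OMap R s \<rhd> \<alpha> (OMap R t) A D) \<Zcomp> (extend C (OMap R s) (OMap R t \<odot> A) (OMap R t \<odot> B) D f
      \<Zcomp> OMap R s \<rhd> \<alpha> (OMap R t) B D))"
  using assms by (simp add: R.join_state_act extend_def R.rwhisker_act R.D.assoc)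

text \<open>Naturality of \<open>act\<close> in the states turns a simultaneous slide along
  \<open>h\<close> and \<open>k\<close> into one slide along \<open>h \<otimes> k\<close> in
  \<open>S\<close>.\<close>

lemma cls_slide_join:
  assumes "h \<in> Arr S" "Dom S h = s" "Cod S h = s'" "k \<in> Arr S" "Dom S k = t" "Cod S k = t'"
    "f \<in> Arr C" "Dom C f = OMap R s' \<odot> (OMap R t' \<odot> A)" "Cod C f = OMap R s \<odot> (OMap R t \<odot> B)"
    "A \<in> Obj C" "B \<in> Obj C"
  shows "cls A B (s \<odot>\<^bsub>S\<^esub> t) (join s t A B ((AMap R h \<otimes> (AMap R k \<lhd> A)) \<Zcomp> f))
    = cls A B (s' \<odot>\<^bsub>S\<^esub> t') (join s' t' A B (f \<Zcomp> (AMap R h \<otimes> (AMap R k \<lhd> B))))"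
proof -
  have o: "s \<in> Obj S" "t \<in> Obj S" "s' \<in> Obj S" "t' \<in> Obj S" using assms by auto
  let ?k = "act C R s' t' A \<Zcomp> (f \<Zcomp> inv (act C R s t B))"
  have E1: "AMap R (h \<otimes>\<^bsub>S\<^esub> k) \<lhd> A \<Zcomp> act C R s' t' A = act C R s t A \<Zcomp> (AMap R h \<otimes> (AMap R k \<lhd> A))"
    using R.act_nat_state[of h k A] assms by simp
  have E2: "AMap R h \<otimes> (AMap R k \<lhd> B) = inv (act C R s t B) \<Zcomp> (AMap R (h \<otimes>\<^bsub>S\<^esub> k) \<lhd> B \<Zcomp> act C R s' t' B)"
    using R.act_nat_state[of h k B] assms o by simp
  have "cls A B (s \<odot>\<^bsub>S\<^esub> t) (AMap R (h \<otimes>\<^bsub>S\<^esub> k) \<lhd> A \<Zcomp> ?k)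
     = cls A B (s' \<odot>\<^bsub>S\<^esub> t') (?k \<Zcomp> AMap R (h \<otimes>\<^bsub>S\<^esub> k) \<lhd> B)"
    using assms o by (intro cls_slide) auto
  then show ?thesis
    using assms o by (simp add: R.join_state_act R.D.assoc E1[THEN R.D.Comp_eq_assoc] E2)
qed

lemma cls_slide_join_left:
  assumes "h \<in> Arr S" "Dom S h = s" "Cod S h = s'" "t \<in> Obj S"
    "f \<in> Arr C" "Dom C f = OMap R s' \<odot> (OMap R t \<odot> A)" "Cod C f = OMap R s \<odot> (OMap R t \<odot> B)"
    "A \<in> Obj C" "B \<in> Obj C"
  shows "cls A B (s \<odot>\<^bsub>S\<^esub> t) (join s t A B (AMap R h \<lhd> (OMap R t \<odot> A) \<Zcomp> f))
    = cls A B (s' \<odot>\<^bsub>S\<^esub> t) (join s' t A B (f \<Zcomp> AMap R h \<lhd> (OMap R t \<odot> B)))"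
  using cls_slide_join[of h s s' "\<one>\<^bsub>S\<^esub> t" t t f A B] assms by (simp add: rwhisker_def)

lemma cls_slide_join_right:
  assumes "k \<in> Arr S" "Dom S k = t" "Cod S k = t'" "s \<in> Obj S"
    "f \<in> Arr C" "Dom C f = OMap R s \<odot> (OMap R t' \<odot> A)" "Cod C f = OMap R s \<odot> (OMap R t \<odot> B)"
    "A \<in> Obj C" "B \<in> Obj C"
  shows "cls A B (s \<odot>\<^bsub>S\<^esub> t) (join s t A B (OMap R s \<rhd> (AMap R k \<lhd> A) \<Zcomp> f))
    = cls A B (s \<odot>\<^bsub>S\<^esub> t') (join s t' A B (f \<Zcomp> OMap R s \<rhd> (AMap R k \<lhd> B)))"
  using cls_slide_join[of "\<one>\<^bsub>S\<^esub> s" s s k t t' f A B] assms by (simp add: lwhisker_def)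

text \<open>The nested \<open>join\<close> on the left separates \<open>u\<close> from
  \<open>s \<odot> t\<close>; on the right the inner conjugation by \<open>act\<close> separates
  \<open>u\<close> from \<open>t\<close>. By \<open>act_Assoc\<close> the two ways of unpacking
  differ by \<open>R\<close> of the associator, along which \<open>cls_iso\<close> slides.\<close>

lemma cls_join_Assoc:
  assumes "s \<in> Obj S" "t \<in> Obj S" "u \<in> Obj S" "A \<in> Obj C" "B \<in> Obj C"
    "f \<in> Arr C" "Dom C f = OMap R s \<odot> (OMap R t \<odot> (OMap R u \<odot> A))"
    "Cod C f = OMap R s \<odot> (OMap R t \<odot> (OMap R u \<odot> B))"
  shows "cls A B (s \<odot>\<^bsub>S\<^esub> t \<odot>\<^bsub>S\<^esub> u) (join (s \<odot>\<^bsub>S\<^esub> t) u A B (join s t (OMap R u \<odot> A) (OMap R u \<odot> B) f))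
    = cls A B (s \<odot>\<^bsub>S\<^esub> (t \<odot>\<^bsub>S\<^esub> u)) (join s (t \<odot>\<^bsub>S\<^esub> u) A B
        (OMap R s \<rhd> act C R t u A \<Zcomp> (f \<Zcomp> inv (OMap R s \<rhd> act C R t u B))))"
proof -
  note E1 = R.act_Assoc[of s t u A, THEN R.D.Comp_eq_assoc3]
  have "AMap R (\<alpha>\<^bsub>S\<^esub> s t u) \<lhd> B \<Zcomp> (act C R s (t \<odot>\<^bsub>S\<^esub> u) B \<Zcomp> OMap R s \<rhd> act C R t u B)
    = act C R (s \<odot>\<^bsub>S\<^esub> t) u B \<Zcomp> act C R s t (OMap R u \<odot> B)"
    using assms by (simp add: R.act_Assoc)
  from R.D.move_right[OF _ _ _ this[symmetric]]
  have E2: "AMap R (\<alpha>\<^bsub>S\<^esub> s t u) \<lhd> B = act C R (s \<odot>\<^bsub>S\<^esub> t) u B \<Zcomp> (act C R s t (OMap R u \<odot> B)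
    \<Zcomp> (inv (OMap R s \<rhd> act C R t u B) \<Zcomp> inv (act C R s (t \<odot>\<^bsub>S\<^esub> u) B)))"
    using assms by (simp add: R.D.assoc)
  show ?thesis
    by (rule cls_iso[of "\<alpha>\<^bsub>S\<^esub> s t u"])
      (use assms in \<open>simp_all add: R.join_state_act R.D.assoc E1 E2\<close>)
qed

lemma cls_join_Symm:
  assumes "s \<in> Obj S" "t \<in> Obj S" "A \<in> Obj C" "B \<in> Obj C"
    "f \<in> Arr C" "Dom C f = OMap R s \<odot> (OMap R t \<odot> A)" "Cod C f = OMap R s \<odot> (OMap R t \<odot> B)"
  shows "cls A B (s \<odot>\<^bsub>S\<^esub> t) (join s t A B f) = cls A B (t \<odot>\<^bsub>S\<^esub> s) (join t s A B
    (\<omega> (OMap R t) (OMap R s) A \<Zcomp> (f \<Zcomp> \<omega> (OMap R s) (OMap R t) B)))"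
proof -
  note E1 = R.act_Symm[of s t A, THEN R.D.Comp_eq_assoc]
  have E2: "AMap R (\<sigma>\<^bsub>S\<^esub> s t) \<lhd> B = act C R s t B \<Zcomp> (\<omega> (OMap R s) (OMap R t) B \<Zcomp> inv (act C R t s B))"
    using R.D.move_right[OF _ _ _ R.act_Symm[symmetric], of t s B] assms by (simp add: R.D.assoc)
  show ?thesis
    by (rule cls_iso[of "\<sigma>\<^bsub>S\<^esub> s t"])
      (use assms in \<open>simp_all add: R.join_state_act R.D.assoc E1 E2\<close>)
qed

lemma cls_join_LUnitor:
  assumes "s \<in> Obj S" "A \<in> Obj C" "B \<in> Obj C"
    "f \<in> Arr C" "Dom C f = OMap R s \<odot> A" "Cod C f = OMap R s \<odot> B"
  shows "cls A B (\<I>\<^bsub>S\<^esub> \<odot>\<^bsub>S\<^esub> s) (join \<I>\<^bsub>S\<^esub> s A B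
    (act_unit C R (OMap R s \<odot> A) \<Zcomp> (f \<Zcomp> inv (act_unit C R (OMap R s \<odot> B))))) = cls A B s f"
  by (rule cls_iso[of "\<lambda>\<^bsub>S\<^esub>_ s"]) (use assms in \<open>simp_all add: R.join_state_act R.D.assoc R.act_LUnitor\<close>)

lemma cls_join_RUnitor:
  assumes "s \<in> Obj S" "A \<in> Obj C" "B \<in> Obj C"
    "f \<in> Arr C" "Dom C f = OMap R s \<odot> A" "Cod C f = OMap R s \<odot> B"
  shows "cls A B (s \<odot>\<^bsub>S\<^esub> \<I>\<^bsub>S\<^esub>) (join s \<I>\<^bsub>S\<^esub> A B
    (OMap R s \<rhd> act_unit C R A \<Zcomp> (f \<Zcomp> inv (OMap R s \<rhd> act_unit C R B)))) = cls A B s f"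
  by (rule cls_iso[of "\<rho>\<^bsub>S\<^esub> s"]) (use assms in \<open>simp_all add: R.join_state_act R.D.assoc R.act_RUnitor\<close>)

text \<open>The two occurrences of \<open>\<sigma>\<close> in \<open>comp_state\<close> enclose
  \<open>f\<close> as swaps: \<open>f\<close> runs while \<open>R t\<close> is idle, and
  \<open>g\<close> runs while \<open>R s\<close> is idle.\<close>

lemma comp_state_join:
  assumes "(s, f) \<in> proc A B" "(t, g) \<in> proc B D" "A \<in> Obj C" "B \<in> Obj C" "D \<in> Obj C"
  shows "comp_state C S R A B D (s, f) (t, g) = (s \<odot>\<^bsub>S\<^esub> t,
    join s t A D (under C (OMap R s) A B (OMap R t) f \<Zcomp> OMap R s \<rhd> g))"
proof -
  have "Mu R s t \<lhd> D = inv (inv (Mu R s t) \<lhd> D)" using assms by auto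
  then show ?thesis
    unfolding comp_state_def case_prod_conv lwhisker_def[symmetric] rwhisker_def[symmetric]
    using assms by (simp add: R.join_state_act act_def under_def swap_def R.D.assoc)
qed

lemma cls_comp_slide_left:
  assumes h: "h \<in> Arr S" "Dom S h = s" "Cod S h = t"
    and f: "f \<in> Arr C" "Dom C f = OMap R t \<odot> A" "Cod C f = OMap R s \<odot> B"
    and g: "(u, g) \<in> proc B D" and [simp]: "A \<in> Obj C" "B \<in> Obj C" "D \<in> Obj C"
  shows "cls A D (s \<odot>\<^bsub>S\<^esub> u) (join s u A D
      (under C (OMap R s) A B (OMap R u) (AMap R h \<lhd> A \<Zcomp> f) \<Zcomp> OMap R s \<rhd> g))
    = cls A D (t \<odot>\<^bsub>S\<^esub> u) (join t u A D
      (under C (OMap R t) A B (OMap R u) (f \<Zcomp> AMap R h \<lhd> B) \<Zcomp> OMap R t \<rhd> g))"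
proof -
  have o [simp]: "s \<in> Obj S" "t \<in> Obj S" "u \<in> Obj S" using h g by auto
  \<comment> \<open>The composite of the bare middle arrow of the slide with \<open>g\<close>, of
    type \<open>R t \<odot> (R u \<odot> A) \<rightarrow> R s \<odot> (R u \<odot> D)\<close>. Its
    ends carry different states, so the swaps of \<open>under\<close> are written out.\<close>
  let ?f = "\<omega> (OMap R t) (OMap R u) A \<Zcomp> (OMap R u \<rhd> f \<Zcomp> (\<omega> (OMap R u) (OMap R s) B \<Zcomp> OMap R s \<rhd> g))"
  have E1: "OMap R u \<rhd> (AMap R h \<lhd> A) = \<omega> (OMap R u) (OMap R s) A \<Zcomp> (AMap R h \<lhd> (OMap R u \<odot> A)
    \<Zcomp> \<omega> (OMap R t) (OMap R u) A)"
    using h R.D.swap_nat_left[of "AMap R h" "OMap R u" A] by simp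
  have E2: "OMap R u \<rhd> (AMap R h \<lhd> B) = \<omega> (OMap R u) (OMap R s) B \<Zcomp> (AMap R h \<lhd> (OMap R u \<odot> B)
    \<Zcomp> \<omega> (OMap R t) (OMap R u) B)"
    using h R.D.swap_nat_left[of "AMap R h" "OMap R u" B] by simp
  have E3: "AMap R h \<lhd> (OMap R u \<odot> B) \<Zcomp> OMap R t \<rhd> g = OMap R s \<rhd> g \<Zcomp> AMap R h \<lhd> (OMap R u \<odot> D)"
    using h g by (intro R.D.whisker_exchange[symmetric]) auto
  have "cls A D (s \<odot>\<^bsub>S\<^esub> u) (join s u A D (AMap R h \<lhd> (OMap R u \<odot> A) \<Zcomp> ?f))
    = cls A D (t \<odot>\<^bsub>S\<^esub> u) (join t u A D (?f \<Zcomp> AMap R h \<lhd> (OMap R u \<odot> D)))"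
    using h f g by (intro cls_slide_join_left) simp_all
  then show ?thesis
    using h f g by (simp add: under_def R.D.assoc E1 E2 E3)
qed

lemma cls_comp_slide_right:
  assumes h: "h \<in> Arr S" "Dom S h = s" "Cod S h = t"
    and f: "f \<in> Arr C" "Dom C f = OMap R t \<odot> B" "Cod C f = OMap R s \<odot> D"
    and g: "(u, g) \<in> proc A B" and [simp]: "A \<in> Obj C" "B \<in> Obj C" "D \<in> Obj C"
  shows "cls A D (u \<odot>\<^bsub>S\<^esub> s) (join u s A D
      (under C (OMap R u) A B (OMap R s) g \<Zcomp> OMap R u \<rhd> (AMap R h \<lhd> B \<Zcomp> f)))
    = cls A D (u \<odot>\<^bsub>S\<^esub> t) (join u t A D
      (under C (OMap R u) A B (OMap R t) g \<Zcomp> OMap R u \<rhd> (f \<Zcomp> AMap R h \<lhd> D)))"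
proof -
  have o [simp]: "s \<in> Obj S" "t \<in> Obj S" "u \<in> Obj S" using h g by auto
  \<comment> \<open>Here the middle arrow has type \<open>R u \<odot> (R t \<odot> A) \<rightarrow>
    R u \<odot> (R s \<odot> D)\<close>, and the slide takes place in the second state
    component.\<close>
  let ?f = "\<omega> (OMap R u) (OMap R t) A \<Zcomp> (OMap R t \<rhd> g \<Zcomp> (\<omega> (OMap R t) (OMap R u) B \<Zcomp> OMap R u \<rhd> f))"
  have E1: "OMap R u \<rhd> (AMap R h \<lhd> A) = \<omega> (OMap R u) (OMap R s) A \<Zcomp> (AMap R h \<lhd> (OMap R u \<odot> A)
    \<Zcomp> \<omega> (OMap R t) (OMap R u) A)"
    using h R.D.swap_nat_left[of "AMap R h" "OMap R u" A] by simp
  have E2: "OMap R u \<rhd> (AMap R h \<lhd> B) = \<omega> (OMap R u) (OMap R s) B \<Zcomp> (AMap R h \<lhd> (OMap R u \<odot> B)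
    \<Zcomp> \<omega> (OMap R t) (OMap R u) B)"
    using h R.D.swap_nat_left[of "AMap R h" "OMap R u" B] by simp
  have E3: "AMap R h \<lhd> (OMap R u \<odot> A) \<Zcomp> OMap R t \<rhd> g = OMap R s \<rhd> g \<Zcomp> AMap R h \<lhd> (OMap R u \<odot> B)"
    using h g by (intro R.D.whisker_exchange[symmetric]) auto
  have "cls A D (u \<odot>\<^bsub>S\<^esub> s) (join u s A D (OMap R u \<rhd> (AMap R h \<lhd> A) \<Zcomp> ?f))
    = cls A D (u \<odot>\<^bsub>S\<^esub> t) (join u t A D (?f \<Zcomp> OMap R u \<rhd> (AMap R h \<lhd> D)))"
    using h f g by (intro cls_slide_join_right) simp_all
  then show ?thesis
    using h f g by (simp add: under_def R.D.assoc E1 E2 E3[THEN R.D.Comp_eq_assoc])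
qed

lemma rel_eq_iff:
  "process_rel C S R A B `` {p} = process_rel C S R A B `` {q} \<longleftrightarrow>
    St_class C S R A B p = St_class C S R A B q"
  by (simp add: St_class_def)

text \<open>Invariance in two variables is checked one variable at a time. The first assumption
  ranges over all processes because the inner union is evaluated at every member of the outer
  class.\<close>

lemma class_map2:
  assumes "\<And>p. p \<in> proc A B \<Longrightarrow> (\<Union>q \<in> process_rel C S R A' B' `` {p'}. \<phi> p q) = \<phi> p p'"
    and "(\<Union>q \<in> process_rel C S R A B `` {p}. \<phi> q p') = \<phi> p p'"
  shows "(\<Union>q \<in> process_rel C S R A B `` {p}. \<Union>q' \<in> process_rel C S R A' B' `` {p'}. \<phi> q q') = \<phi> p p'"
proof -
  have "q \<in> proc A B" if "q \<in> process_rel C S R A B `` {p}" for q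
    using that by (auto simp: process_rel_def)
  then show ?thesis using assms by auto
qed

lemma cls_Comp:
  assumes f: "(s, f) \<in> proc A B" and g: "(t, g) \<in> proc B D"
    and o: "A \<in> Obj C" "B \<in> Obj C" "D \<in> Obj C"
  shows "cls A B s f \<Zcomp>\<^bsub>\<S>\<^esub> cls B D t g =
    cls A D (s \<odot>\<^bsub>S\<^esub> t) (join s t A D (under C (OMap R s) A B (OMap R t) f \<Zcomp> OMap R s \<rhd> g))"
proof -
  have "(\<Union>p \<in> process_rel C S R A B `` {(s, f)}. \<Union>q \<in> process_rel C S R B D `` {(t, g)}.
      process_rel C S R A D `` {comp_state C S R A B D p q}) =
    process_rel C S R A D `` {comp_state C S R A B D (s, f) (t, g)}"
  proof (rule class_map2)
    fix p assume p: "p \<in> proc A B"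
    obtain u k where [simp]: "p = (u, k)" by (cases p)
    show "(\<Union>q \<in> process_rel C S R B D `` {(t, g)}.
        process_rel C S R A D `` {comp_state C S R A B D p q}) =
      process_rel C S R A D `` {comp_state C S R A B D p (t, g)}"
    proof (rule cls_slide_arrow)
      fix x y h l
      assume *: "h \<in> Arr S" "Dom S h = x" "Cod S h = y" "l \<in> Arr C"
        "Dom C l = OMap R y \<odot> B" "Cod C l = OMap R x \<odot> D"
      then have [simp]: "x \<in> Obj S" "y \<in> Obj S" by auto
      show "process_rel C S R A D `` {comp_state C S R A B D p (x, AMap R h \<lhd> B \<Zcomp> l)} =
        process_rel C S R A D `` {comp_state C S R A B D p (y, l \<Zcomp> AMap R h \<lhd> D)}"
        using cls_comp_slide_right[OF *, of u k A] p o *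
        by (simp add: comp_state_join rel_eq_iff)
    qed (use g o in auto)
  next
    show "(\<Union>p \<in> process_rel C S R A B `` {(s, f)}.
        process_rel C S R A D `` {comp_state C S R A B D p (t, g)}) =
      process_rel C S R A D `` {comp_state C S R A B D (s, f) (t, g)}"
    proof (rule cls_slide_arrow)
      fix x y h l
      assume *: "h \<in> Arr S" "Dom S h = x" "Cod S h = y" "l \<in> Arr C"
        "Dom C l = OMap R y \<odot> A" "Cod C l = OMap R x \<odot> B"
      then have [simp]: "x \<in> Obj S" "y \<in> Obj S" by auto
      show "process_rel C S R A D `` {comp_state C S R A B D (x, AMap R h \<lhd> A \<Zcomp> l) (t, g)} =
        process_rel C S R A D `` {comp_state C S R A B D (y, l \<Zcomp> AMap R h \<lhd> B) (t, g)}"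
        using cls_comp_slide_left[OF *, of t g D] g o *
        by (simp add: comp_state_join rel_eq_iff)
    qed (use f o in auto)
  qed
  then show ?thesis
    using assms by (simp add: St_def St_class_def comp_state_join)
qed

section \<open>Stateless processes\<close>

lemma under_unit_state:
  assumes "X \<in> Obj C" "u \<in> Arr C" "Dom C u = A" "Cod C u = B"
  shows "under C (OMap R \<I>\<^bsub>S\<^esub>) A B X (unit_state C R A B u) = unit_state C R (X \<odot> A) (X \<odot> B) (X \<rhd> u)"
proof -
  have o: "A \<in> Obj C" "B \<in> Obj C" using assms by auto
  have "inv (\<omega> (OMap R \<I>\<^bsub>S\<^esub>) X B \<Zcomp> X \<rhd> act_unit C R B) = inv (act_unit C R (X \<odot> B))"
    using assms o by (simp only: R.swap_act_unit)
  then have E: "inv (X \<rhd> act_unit C R B) \<Zcomp> \<omega> X (OMap R \<I>\<^bsub>S\<^esub>) B = inv (act_unit C R (X \<odot> B))"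
    using assms o by simp
  show ?thesis
    using assms o by (simp add: R.unit_state_act under_def R.D.assoc E
      R.swap_act_unit[THEN R.D.Comp_eq_assoc])
qed

lemma iota_arr_cls:
  "u \<in> Arr C \<Longrightarrow> iota_arr C S R u = cls (Dom C u) (Cod C u) \<I>\<^bsub>S\<^esub> (unit_state C R (Dom C u) (Cod C u) u)"
  by (simp add: iota_arr_def)

lemma unit_state_simps [simp]:
  assumes "u \<in> Arr C" "Dom C u = A" "Cod C u = B"
  shows "unit_state C R A B u \<in> Arr C" "Dom C (unit_state C R A B u) = OMap R \<I>\<^bsub>S\<^esub> \<odot> A"
    "Cod C (unit_state C R A B u) = OMap R \<I>\<^bsub>S\<^esub> \<odot> B"
  using assms by (auto simp: R.unit_state_act)

lemma iota_arr_simps [simp]: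
  assumes "u \<in> Arr C"
  shows "iota_arr C S R u \<in> Arr \<S>" "Dom \<S> (iota_arr C S R u) = Dom C u"
    "Cod \<S> (iota_arr C S R u) = Cod C u"
  using assms by (simp_all add: iota_arr_cls)

text \<open>Carrying \<open>f\<close> past the unit state is conjugation by \<open>act_unit\<close>
  (equation \<open>E\<close>), so the left unitor of \<open>S\<close> removes that state and
  composition in \<open>St\<close> becomes composition in \<open>C\<close>.\<close>

lemma iota_arr_Comp_cls:
  assumes "(s, f) \<in> proc A B" "u \<in> Arr C" "Cod C u = A" "A \<in> Obj C" "B \<in> Obj C"
  shows "iota_arr C S R u \<Zcomp>\<^bsub>\<S>\<^esub> cls A B s f = cls (Dom C u) B s (OMap R s \<rhd> u \<Zcomp> f)"
proof -
  have E: "OMap R \<I>\<^bsub>S\<^esub> \<rhd> f = act_unit C R (OMap R s \<odot> A) \<Zcomp> (f \<Zcomp> inv (act_unit C R (OMap R s \<odot> B)))"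
    using assms R.act_unit_nat[of f "OMap R s \<odot> B"]
      R.D.move_right[of "act_unit C R (OMap R s \<odot> B)" "OMap R \<I>\<^bsub>S\<^esub> \<rhd> f", OF _ _ _ R.act_unit_nat[symmetric]]
    by (simp add: R.D.assoc)
  have "iota_arr C S R u \<Zcomp>\<^bsub>\<S>\<^esub> cls A B s f = cls (Dom C u) B (\<I>\<^bsub>S\<^esub> \<odot>\<^bsub>S\<^esub> s) (join \<I>\<^bsub>S\<^esub> s (Dom C u) B
    (act_unit C R (OMap R s \<odot> Dom C u) \<Zcomp> ((OMap R s \<rhd> u \<Zcomp> f) \<Zcomp> inv (act_unit C R (OMap R s \<odot> B)))))"
    using assms by (simp add: iota_arr_cls cls_Comp under_unit_state)
      (simp add: R.unit_state_act R.D.assoc E)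
  then show ?thesis
    using assms by (simp add: cls_join_LUnitor)
qed

lemma cls_Comp_iota_arr:
  assumes "(s, f) \<in> proc A B" "v \<in> Arr C" "Dom C v = B" "A \<in> Obj C" "B \<in> Obj C"
  shows "cls A B s f \<Zcomp>\<^bsub>\<S>\<^esub> iota_arr C S R v = cls A (Cod C v) s (f \<Zcomp> OMap R s \<rhd> v)"
proof -
  have "cls A B s f \<Zcomp>\<^bsub>\<S>\<^esub> iota_arr C S R v = cls A (Cod C v) (s \<odot>\<^bsub>S\<^esub> \<I>\<^bsub>S\<^esub>) (join s \<I>\<^bsub>S\<^esub> A (Cod C v)
    (OMap R s \<rhd> act_unit C R A \<Zcomp> ((f \<Zcomp> OMap R s \<rhd> v) \<Zcomp> inv (OMap R s \<rhd> act_unit C R (Cod C v)))))"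
    using assms by (simp add: iota_arr_cls cls_Comp R.under_act_unit R.unit_state_act R.D.assoc)
  then show ?thesis
    using assms by (simp add: cls_join_RUnitor)
qed

lemma iota_arr_Ide: "A \<in> Obj C \<Longrightarrow> iota_arr C S R (\<one> A) = \<one>\<^bsub>\<S>\<^esub> A"
  by (simp add: iota_arr_cls R.unit_state_act Ide_St)

text \<open>Both bracketings have the states \<open>s\<close>, \<open>t\<close>, \<open>u\<close> in
  this order. \<open>under_under\<close> compares the ways in which \<open>f\<close> and
  \<open>g\<close> are carried past \<open>u\<close>, and \<open>cls_join_Assoc\<close> rebrackets
  the state.\<close>

lemma cls_Comp_assoc:
  assumes f: "(s, f) \<in> proc A B" and g: "(t, g) \<in> proc B D" and h: "(u, h) \<in> proc D E"
    and o [simp]: "A \<in> Obj C" "B \<in> Obj C" "D \<in> Obj C" "E \<in> Obj C"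
  shows "cls A B s f \<Zcomp>\<^bsub>\<S>\<^esub> cls B D t g \<Zcomp>\<^bsub>\<S>\<^esub> cls D E u h = cls A B s f \<Zcomp>\<^bsub>\<S>\<^esub> (cls B D t g \<Zcomp>\<^bsub>\<S>\<^esub> cls D E u h)"
proof -
  have E: "OMap R s \<rhd> \<omega> (OMap R t) (OMap R u) A \<Zcomp> (under C (OMap R s) (OMap R t \<odot> A) (OMap R t \<odot> D) (OMap R u)
      (under C (OMap R s) A B (OMap R t) f \<Zcomp> OMap R s \<rhd> g) \<Zcomp> OMap R s \<rhd> \<omega> (OMap R u) (OMap R t) D)
    = under C (OMap R s) (OMap R u \<odot> A) (OMap R u \<odot> B) (OMap R t) (under C (OMap R s) A B (OMap R u) f)
      \<Zcomp> OMap R s \<rhd> under C (OMap R t) B D (OMap R u) g"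
    using f g h by (intro R.D.under_under) auto
  have E2: "join s t (OMap R u \<odot> A) (OMap R u \<odot> D) f1 \<Zcomp> OMap R (s \<odot>\<^bsub>S\<^esub> t) \<rhd> h =
    join s t (OMap R u \<odot> A) (OMap R u \<odot> E) (f1 \<Zcomp> OMap R s \<rhd> OMap R t \<rhd> h)"
    if "f1 \<in> Arr C" "Dom C f1 = OMap R s \<odot> (OMap R t \<odot> (OMap R u \<odot> A))"
      "Cod C f1 = OMap R s \<odot> (OMap R t \<odot> (OMap R u \<odot> D))" for f1
    using that f g h join_lwhisker[of s t h "OMap R u \<odot> D" "OMap R u \<odot> E"] by (simp add: join_Comp)
  show ?thesis
    using f g h
    by (simp add: cls_Comp under_join E E2 cls_join_Assoc R.under_act)
      (simp add: R.join_state_act R.D.assoc)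
qed

lemma category_St: "category \<S>"
proof
  fix X A B Y D Z E
  show "Dom \<S> X \<in> Obj \<S>" "Cod \<S> X \<in> Obj \<S>" if "X \<in> Arr \<S>"
    using that by (auto elim: St_Arr_cases)
  show "\<one>\<^bsub>\<S>\<^esub> A \<in> hom \<S> A A" if "A \<in> Obj \<S>"
    using that by (simp add: Ide_St)
  show "X \<Zcomp>\<^bsub>\<S>\<^esub> Y \<in> hom \<S> A D" if "X \<in> hom \<S> A B" "Y \<in> hom \<S> B D"
    using that by (elim St_hom_cases) (simp add: cls_Comp)
  \<comment> \<open>The identity of \<open>St\<close> is the image of the identity of
    \<open>C\<close>, so the unit laws are compositions with a stateless process.\<close>
  show "\<one>\<^bsub>\<S>\<^esub> A \<Zcomp>\<^bsub>\<S>\<^esub> X = X" if "X \<in> hom \<S> A B"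
    using that by (elim St_hom_cases) (simp add: iota_arr_Comp_cls flip: iota_arr_Ide)
  show "X \<Zcomp>\<^bsub>\<S>\<^esub> \<one>\<^bsub>\<S>\<^esub> B = X" if "X \<in> hom \<S> A B"
    using that by (elim St_hom_cases) (simp add: cls_Comp_iota_arr flip: iota_arr_Ide)
  show "X \<Zcomp>\<^bsub>\<S>\<^esub> Y \<Zcomp>\<^bsub>\<S>\<^esub> Z = X \<Zcomp>\<^bsub>\<S>\<^esub> (Y \<Zcomp>\<^bsub>\<S>\<^esub> Z)" if "X \<in> hom \<S> A B" "Y \<in> hom \<S> B D" "Z \<in> hom \<S> D E"
    using that by (elim St_hom_cases) (simp add: cls_Comp_assoc)
qed

section \<open>Tensor products of stateful processes\<close>

sublocale St: category \<S>
  by (rule category_St)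

section \<open>The two whiskerings of a process\<close>

lemma cls_extend_slide:
  assumes "h \<in> Arr S" "Dom S h = s" "Cod S h = t"
    and "f \<in> Arr C" "Dom C f = OMap R t \<odot> A" "Cod C f = OMap R s \<odot> B"
    and "A \<in> Obj C" "B \<in> Obj C" "D \<in> Obj C"
  shows "cls (A \<odot> D) (B \<odot> D) s (extend C (OMap R s) A B D (AMap R h \<lhd> A \<Zcomp> f))
    = cls (A \<odot> D) (B \<odot> D) t (extend C (OMap R t) A B D (f \<Zcomp> AMap R h \<lhd> B))"
proof -
  have [simp]: "s \<in> Obj S" "t \<in> Obj S" using assms by auto
  \<comment> \<open>The whiskered middle arrow of the slide; its two associators belong to different
    states, so it is not an instance of \<open>extend\<close>.\<close>
  let ?f = "inv (\<alpha> (OMap R t) A D) \<Zcomp> (f \<lhd> D \<Zcomp> \<alpha> (OMap R s) B D)"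
  have "cls (A \<odot> D) (B \<odot> D) s (AMap R h \<lhd> (A \<odot> D) \<Zcomp> ?f)
     = cls (A \<odot> D) (B \<odot> D) t (?f \<Zcomp> AMap R h \<lhd> (B \<odot> D))"
    using assms by (intro cls_slide) simp_all
  then show ?thesis
    using assms by (simp add: extend_def R.D.whisker_rebracket R.D.assoc)
qed

lemma cls_under_slide:
  assumes "h \<in> Arr S" "Dom S h = s" "Cod S h = t"
    and "f \<in> Arr C" "Dom C f = OMap R t \<odot> A" "Cod C f = OMap R s \<odot> B"
    and "A \<in> Obj C" "B \<in> Obj C" "D \<in> Obj C"
  shows "cls (D \<odot> A) (D \<odot> B) s (under C (OMap R s) A B D (AMap R h \<lhd> A \<Zcomp> f))
    = cls (D \<odot> A) (D \<odot> B) t (under C (OMap R t) A B D (f \<Zcomp> AMap R h \<lhd> B))"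
proof -
  have [simp]: "s \<in> Obj S" "t \<in> Obj S" using assms by auto
  let ?f = "\<omega> (OMap R t) D A \<Zcomp> (D \<rhd> f \<Zcomp> \<omega> D (OMap R s) B)"
  have E: "D \<rhd> (AMap R h \<lhd> A) = \<omega> D (OMap R s) A \<Zcomp> (AMap R h \<lhd> (D \<odot> A) \<Zcomp> \<omega> (OMap R t) D A)"
    if "A \<in> Obj C" for A
    using R.D.swap_nat_left[of "AMap R h" D A] assms that by simp
  have "cls (D \<odot> A) (D \<odot> B) s (AMap R h \<lhd> (D \<odot> A) \<Zcomp> ?f)
     = cls (D \<odot> A) (D \<odot> B) t (?f \<Zcomp> AMap R h \<lhd> (D \<odot> B))"
    using assms by (intro cls_slide) simp_all
  then show ?thesis
    using assms by (simp add: under_def E R.D.assoc)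
qed

lemma tensor_state_comp:
  assumes "(s, f) \<in> proc A B" "(t, g) \<in> proc A' B'"
    "A \<in> Obj C" "B \<in> Obj C" "A' \<in> Obj C" "B' \<in> Obj C"
  shows "St_class C S R (A \<odot> A') (B \<odot> B') (tensor_state C S R A B A' B' (s, f) (t, g)) =
    cls (A \<odot> A') (B \<odot> A') s (extend C (OMap R s) A B A' f) \<Zcomp>\<^bsub>\<S>\<^esub>
    cls (B \<odot> A') (B \<odot> B') t (under C (OMap R t) A' B' B g)"
proof -
  let ?s = "OMap R s" and ?t = "OMap R t"
  have E: "middle_swap C ?s ?t A A' \<Zcomp> ((f \<otimes> g) \<Zcomp> middle_swap C ?s B ?t B') =
    \<alpha> ?s ?t (A \<odot> A') \<Zcomp> (under C ?s (A \<odot> A') (B \<odot> A') ?t (extend C ?s A B A' f)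
      \<Zcomp> (?s \<rhd> under C ?t A' B' B g \<Zcomp> inv (\<alpha> ?s ?t (B \<odot> B'))))"
    using assms by (intro R.D.tensor_under_extend) simp_all
  have m [simp]: "middle_swap C X Y A B \<in> Arr C" "Dom C (middle_swap C X Y A B) = (X \<odot> Y) \<odot> (A \<odot> B)"
    "Cod C (middle_swap C X Y A B) = (X \<odot> A) \<odot> (Y \<odot> B)"
    if "X \<in> Obj C" "A \<in> Obj C" "B \<in> Obj C" "Y \<in> Obj C" for X Y A B
    using that by (simp_all add: middle_swap_def)
  have "Mu R s t \<lhd> (B \<odot> B') = inv (inv (Mu R s t) \<lhd> (B \<odot> B'))" using assms by auto
  then show ?thesis
    using assms
    by (simp add: cls_Comp R.join_state_act act_def tensor_state_def R.D.assoc
        E[THEN R.D.Comp_eq_assoc3] flip: rwhisker_def)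
qed

text \<open>\<open>tensor_state_comp\<close> writes the class of a tensor as a composite of classes
  in \<open>St\<close>. Independence of representatives thus reduces to that of the two whiskerings,
  since composition is already well defined.\<close>

lemma cls_ATensor:
  assumes f: "(s, f) \<in> proc A B" and g: "(t, g) \<in> proc A' B'"
    and o: "A \<in> Obj C" "B \<in> Obj C" "A' \<in> Obj C" "B' \<in> Obj C"
  shows "cls A B s f \<otimes>\<^bsub>\<S>\<^esub> cls A' B' t g =
    cls (A \<odot> A') (B \<odot> A') s (extend C (OMap R s) A B A' f) \<Zcomp>\<^bsub>\<S>\<^esub>
    cls (B \<odot> A') (B \<odot> B') t (under C (OMap R t) A' B' B g)"
proof -
  let ?r = "process_rel C S R (A \<odot> A') (B \<odot> B')"
  have "(\<Union>p \<in> process_rel C S R A B `` {(s, f)}. \<Union>q \<in> process_rel C S R A' B' `` {(t, g)}.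
      ?r `` {tensor_state C S R A B A' B' p q}) = ?r `` {tensor_state C S R A B A' B' (s, f) (t, g)}"
  proof (rule class_map2)
    fix p assume p: "p \<in> proc A B"
    obtain u k where [simp]: "p = (u, k)" by (cases p)
    show "(\<Union>q \<in> process_rel C S R A' B' `` {(t, g)}. ?r `` {tensor_state C S R A B A' B' p q}) =
      ?r `` {tensor_state C S R A B A' B' p (t, g)}"
    proof (rule cls_slide_arrow)
      fix x y h l
      assume *: "h \<in> Arr S" "Dom S h = x" "Cod S h = y" "l \<in> Arr C"
        "Dom C l = OMap R y \<odot> A'" "Cod C l = OMap R x \<odot> B'"
      then have [simp]: "x \<in> Obj S" "y \<in> Obj S" by auto
      have "St_class C S R (A \<odot> A') (B \<odot> B') (tensor_state C S R A B A' B' p (x, AMap R h \<lhd> A' \<Zcomp> l)) =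
        cls (A \<odot> A') (B \<odot> A') u (extend C (OMap R u) A B A' k) \<Zcomp>\<^bsub>\<S>\<^esub>
        cls (B \<odot> A') (B \<odot> B') x (under C (OMap R x) A' B' B (AMap R h \<lhd> A' \<Zcomp> l))"
        using p o * by (subst \<open>p = _\<close>, subst tensor_state_comp) simp_all
      also have "\<dots> = St_class C S R (A \<odot> A') (B \<odot> B') (tensor_state C S R A B A' B' p (y, l \<Zcomp> AMap R h \<lhd> B'))"
        using p o * by (subst \<open>p = _\<close>, subst tensor_state_comp) (simp_all only: cls_under_slide, simp_all)
      finally show "?r `` {tensor_state C S R A B A' B' p (x, AMap R h \<lhd> A' \<Zcomp> l)} =
        ?r `` {tensor_state C S R A B A' B' p (y, l \<Zcomp> AMap R h \<lhd> B')}"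
        by (simp only: rel_eq_iff)
    qed (use g o in auto)
  next
    show "(\<Union>p \<in> process_rel C S R A B `` {(s, f)}. ?r `` {tensor_state C S R A B A' B' p (t, g)}) =
      ?r `` {tensor_state C S R A B A' B' (s, f) (t, g)}"
    proof (rule cls_slide_arrow)
      fix x y h l
      assume *: "h \<in> Arr S" "Dom S h = x" "Cod S h = y" "l \<in> Arr C"
        "Dom C l = OMap R y \<odot> A" "Cod C l = OMap R x \<odot> B"
      then have [simp]: "x \<in> Obj S" "y \<in> Obj S" by auto
      have "St_class C S R (A \<odot> A') (B \<odot> B') (tensor_state C S R A B A' B' (x, AMap R h \<lhd> A \<Zcomp> l) (t, g)) =
        cls (A \<odot> A') (B \<odot> A') x (extend C (OMap R x) A B A' (AMap R h \<lhd> A \<Zcomp> l)) \<Zcomp>\<^bsub>\<S>\<^esub>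
        cls (B \<odot> A') (B \<odot> B') t (under C (OMap R t) A' B' B g)"
        using g o * by (subst tensor_state_comp) simp_all
      also have "\<dots> = St_class C S R (A \<odot> A') (B \<odot> B') (tensor_state C S R A B A' B' (y, l \<Zcomp> AMap R h \<lhd> B) (t, g))"
        using g o * by (subst tensor_state_comp) (simp_all only: cls_extend_slide, simp_all)
      finally show "?r `` {tensor_state C S R A B A' B' (x, AMap R h \<lhd> A \<Zcomp> l) (t, g)} =
        ?r `` {tensor_state C S R A B A' B' (y, l \<Zcomp> AMap R h \<lhd> B) (t, g)}"
        by (simp only: rel_eq_iff)
    qed (use f o in auto)
  qed
  then have "cls A B s f \<otimes>\<^bsub>\<S>\<^esub> cls A' B' t g
    = St_class C S R (A \<odot> A') (B \<odot> B') (tensor_state C S R A B A' B' (s, f) (t, g))"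
    using assms by (simp add: St_def St_class_def)
  then show ?thesis
    using assms by (simp add: tensor_state_comp)
qed

text \<open>By \<open>extend_under\<close>, adding the tail \<open>E\<close> commutes with carrying
  \<open>f\<close> past \<open>R t\<close>, up to the associators that \<open>extend_join\<close>
  introduces.\<close>

lemma cls_extend_Comp:
  assumes f: "(s, f) \<in> proc A B" and g: "(t, g) \<in> proc B D"
    and o [simp]: "A \<in> Obj C" "B \<in> Obj C" "D \<in> Obj C" "E \<in> Obj C"
  shows "cls (A \<odot> E) (D \<odot> E) (s \<odot>\<^bsub>S\<^esub> t) (extend C (OMap R (s \<odot>\<^bsub>S\<^esub> t)) A D E
      (join s t A D (under C (OMap R s) A B (OMap R t) f \<Zcomp> OMap R s \<rhd> g)))
    = cls (A \<odot> E) (B \<odot> E) s (extend C (OMap R s) A B E f) \<Zcomp>\<^bsub>\<S>\<^esub>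
      cls (B \<odot> E) (D \<odot> E) t (extend C (OMap R t) B D E g)"
proof -
  have E1: "extend C (OMap R s) (OMap R t \<odot> A) (OMap R t \<odot> B) E (under C (OMap R s) A B (OMap R t) f)
    = OMap R s \<rhd> \<alpha> (OMap R t) A E \<Zcomp> (under C (OMap R s) (A \<odot> E) (B \<odot> E) (OMap R t)
        (extend C (OMap R s) A B E f) \<Zcomp> inv (OMap R s \<rhd> \<alpha> (OMap R t) B E))"
    using R.D.move_right[OF _ _ _ R.D.extend_under[of f "OMap R s" A B "OMap R t" E, symmetric]] f g
    by (simp add: R.D.assoc)
  have E2: "extend C (OMap R s) (OMap R t \<odot> A) (OMap R t \<odot> D) E (under C (OMap R s) A B (OMap R t) f \<Zcomp> OMap R s \<rhd> g)
    = extend C (OMap R s) (OMap R t \<odot> A) (OMap R t \<odot> B) E (under C (OMap R s) A B (OMap R t) f) \<Zcomp> OMap R s \<rhd> (g \<lhd> E)"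
    using f g R.D.extend_Comp[of "under C (OMap R s) A B (OMap R t) f" "OMap R s" "OMap R t \<odot> A" "OMap R t \<odot> B"
        "OMap R s \<rhd> g" "OMap R t \<odot> D" E]
    by (simp add: R.D.extend_lwhisker)
  show ?thesis
    using f g by (simp add: cls_Comp extend_join E2 E1 R.D.assoc) (simp add: extend_def[of C "OMap R t"] R.D.assoc)
qed

lemma cls_under_Comp:
  assumes f: "(s, f) \<in> proc A B" and g: "(t, g) \<in> proc B D"
    and o [simp]: "A \<in> Obj C" "B \<in> Obj C" "D \<in> Obj C" "E \<in> Obj C"
  shows "cls (E \<odot> A) (E \<odot> D) (s \<odot>\<^bsub>S\<^esub> t) (under C (OMap R (s \<odot>\<^bsub>S\<^esub> t)) A D E
      (join s t A D (under C (OMap R s) A B (OMap R t) f \<Zcomp> OMap R s \<rhd> g)))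
    = cls (E \<odot> A) (E \<odot> B) s (under C (OMap R s) A B E f) \<Zcomp>\<^bsub>\<S>\<^esub>
      cls (E \<odot> B) (E \<odot> D) t (under C (OMap R t) B D E g)"
  using f g by (simp add: cls_Comp under_join R.D.under_under)

lemma cls_exchange:
  assumes f: "(s, f) \<in> proc A B" and g: "(t, g) \<in> proc A' B'"
    and o [simp]: "A \<in> Obj C" "B \<in> Obj C" "A' \<in> Obj C" "B' \<in> Obj C"
  shows "cls (A \<odot> A') (B \<odot> A') s (extend C (OMap R s) A B A' f) \<Zcomp>\<^bsub>\<S>\<^esub>
      cls (B \<odot> A') (B \<odot> B') t (under C (OMap R t) A' B' B g)
    = cls (A \<odot> A') (A \<odot> B') t (under C (OMap R t) A' B' A g) \<Zcomp>\<^bsub>\<S>\<^esub>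
      cls (A \<odot> B') (B \<odot> B') s (extend C (OMap R s) A B B' f)"
proof -
  let ?s = "OMap R s" and ?t = "OMap R t"
  let ?f = "extend C ?s A B B' f" and ?g = "under C ?t A' B' A g"
  \<comment> \<open>The second composite lists its states as \<open>t\<close>, \<open>s\<close>.
    Conjugation by \<open>\<omega>\<close>, supplied by \<open>cls_join_Symm\<close>, turns it into
    the arrow that \<open>under_extend_exchange\<close> produces from the first composite.\<close>
  have "\<omega> ?s ?t (A \<odot> A') \<Zcomp> ((under C ?t (A \<odot> A') (A \<odot> B') ?s ?g \<Zcomp> ?t \<rhd> ?f) \<Zcomp> \<omega> ?t ?s (B \<odot> B'))
    = ?s \<rhd> ?g \<Zcomp> under C ?s (A \<odot> B') (B \<odot> B') ?t ?f"
    using f g by (simp add: under_def[of C ?t "A \<odot> A'"] under_def[of C ?s "A \<odot> B'"] R.D.assoc)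
  then show ?thesis
    using f g by (simp add: cls_Comp R.D.under_extend_exchange)
      (subst (2) cls_join_Symm, simp_all)
qed

section \<open>Tensor products with stateless processes\<close>

lemma iota_arr_extend:
  assumes "u \<in> Arr C" "Dom C u = A" "Cod C u = B" "D \<in> Obj C"
  shows "cls (A \<odot> D) (B \<odot> D) \<I>\<^bsub>S\<^esub> (extend C (OMap R \<I>\<^bsub>S\<^esub>) A B D (unit_state C R A B u)) = iota_arr C S R (u \<lhd> D)"
proof -
  have [simp]: "A \<in> Obj C" "B \<in> Obj C" using assms by auto
  show ?thesis
    using assms by (simp add: iota_arr_cls R.unit_state_act extend_def R.rwhisker_act_unit R.D.assoc)
qed

lemma iota_arr_under:
  assumes "u \<in> Arr C" "Dom C u = A" "Cod C u = B" "D \<in> Obj C"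
  shows "cls (D \<odot> A) (D \<odot> B) \<I>\<^bsub>S\<^esub> (under C (OMap R \<I>\<^bsub>S\<^esub>) A B D (unit_state C R A B u)) = iota_arr C S R (D \<rhd> u)"
  using assms by (simp add: iota_arr_cls under_unit_state)

lemma iota_arr_Comp:
  assumes "u \<in> Arr C" "v \<in> Arr C" "Cod C u = Dom C v"
  shows "iota_arr C S R (u \<Zcomp> v) = iota_arr C S R u \<Zcomp>\<^bsub>\<S>\<^esub> iota_arr C S R v"
proof -
  have "OMap R \<I>\<^bsub>S\<^esub> \<rhd> u \<Zcomp> unit_state C R (Dom C v) (Cod C v) v = unit_state C R (Dom C u) (Cod C v) (u \<Zcomp> v)"
    using assms by (simp add: R.unit_state_act R.D.assoc R.act_unit_nat[of u "Dom C v", THEN R.D.Comp_eq_assoc])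
  then show ?thesis
    using assms iota_arr_Comp_cls[of "\<I>\<^bsub>S\<^esub>" "unit_state C R (Dom C v) (Cod C v) v" "Dom C v" "Cod C v" u]
    by (simp add: iota_arr_cls)
qed

lemma iota_arr_ATensor_cls:
  assumes "(s, f) \<in> proc A B" "A \<in> Obj C" "B \<in> Obj C" "u \<in> Arr C"
  shows "iota_arr C S R u \<otimes>\<^bsub>\<S>\<^esub> cls A B s f = iota_arr C S R (u \<lhd> A) \<Zcomp>\<^bsub>\<S>\<^esub>
    cls (Cod C u \<odot> A) (Cod C u \<odot> B) s (under C (OMap R s) A B (Cod C u) f)"
  using assms by (simp add: iota_arr_cls[of u] cls_ATensor iota_arr_extend)

lemma cls_ATensor_iota_arr:
  assumes "(s, f) \<in> proc A B" "A \<in> Obj C" "B \<in> Obj C" "u \<in> Arr C"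
  shows "cls A B s f \<otimes>\<^bsub>\<S>\<^esub> iota_arr C S R u =
    cls (A \<odot> Dom C u) (B \<odot> Dom C u) s (extend C (OMap R s) A B (Dom C u) f) \<Zcomp>\<^bsub>\<S>\<^esub> iota_arr C S R (B \<rhd> u)"
  using assms by (simp add: iota_arr_cls[of u] cls_ATensor iota_arr_under)

lemma iota_arr_ATensor:
  assumes "u \<in> Arr C" "v \<in> Arr C"
  shows "iota_arr C S R (u \<otimes> v) = iota_arr C S R u \<otimes>\<^bsub>\<S>\<^esub> iota_arr C S R v"
  using assms by (simp add: R.D.ATensor_whisker iota_arr_Comp iota_arr_cls[of u] cls_ATensor_iota_arr iota_arr_extend)

lemma iota_arr_inverse:
  assumes "is_iso C u"
  shows "inverse_arrows \<S> (iota_arr C S R u) (iota_arr C S R (inv u))"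
  using assms by (intro St.inverse_arrowsI)
    (simp_all add: R.D.iso_Arr iota_arr_Ide flip: iota_arr_Comp)

lemma is_iso_iota_arr [simp]: "is_iso C u \<Longrightarrow> is_iso \<S> (iota_arr C S R u)"
  and inv_iota_arr [simp]: "is_iso C u \<Longrightarrow> inv\<^bsub>\<S>\<^esub> (iota_arr C S R u) = iota_arr C S R (inv u)"
  using iota_arr_inverse St.inverse_arrows_is_iso St.inv_eqI by metis+

section \<open>Functoriality of the tensor and naturality of the coherence maps\<close>

lemma cls_comp_ATensor:
  assumes "(s, f) \<in> proc A B" "(t, g) \<in> proc B D" "(u, h) \<in> proc A' B'"
    "A \<in> Obj C" "B \<in> Obj C" "D \<in> Obj C" "A' \<in> Obj C" "B' \<in> Obj C"
  shows "(cls A B s f \<Zcomp>\<^bsub>\<S>\<^esub> cls B D t g) \<otimes>\<^bsub>\<S>\<^esub> cls A' B' u h =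
    cls (A \<odot> A') (B \<odot> A') s (extend C (OMap R s) A B A' f) \<Zcomp>\<^bsub>\<S>\<^esub>
    (cls (B \<odot> A') (D \<odot> A') t (extend C (OMap R t) B D A' g) \<Zcomp>\<^bsub>\<S>\<^esub>
     cls (D \<odot> A') (D \<odot> B') u (under C (OMap R u) A' B' D h))"
proof -
  have "(cls A B s f \<Zcomp>\<^bsub>\<S>\<^esub> cls B D t g) \<otimes>\<^bsub>\<S>\<^esub> cls A' B' u h =
    cls (A \<odot> A') (B \<odot> A') s (extend C (OMap R s) A B A' f) \<Zcomp>\<^bsub>\<S>\<^esub>
    cls (B \<odot> A') (D \<odot> A') t (extend C (OMap R t) B D A' g) \<Zcomp>\<^bsub>\<S>\<^esub>
    cls (D \<odot> A') (D \<odot> B') u (under C (OMap R u) A' B' D h)"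
    using assms by (simp add: cls_Comp[of s f] cls_ATensor flip: cls_extend_Comp)
  then show ?thesis
    using assms by (simp add: St.assoc)
qed

lemma cls_ATensor_comp:
  assumes "(s, f) \<in> proc A B" "(t, g) \<in> proc A' B'" "(u, h) \<in> proc B' D'"
    "A \<in> Obj C" "B \<in> Obj C" "A' \<in> Obj C" "B' \<in> Obj C" "D' \<in> Obj C"
  shows "cls A B s f \<otimes>\<^bsub>\<S>\<^esub> (cls A' B' t g \<Zcomp>\<^bsub>\<S>\<^esub> cls B' D' u h) =
    cls (A \<odot> A') (B \<odot> A') s (extend C (OMap R s) A B A' f) \<Zcomp>\<^bsub>\<S>\<^esub>
    (cls (B \<odot> A') (B \<odot> B') t (under C (OMap R t) A' B' B g) \<Zcomp>\<^bsub>\<S>\<^esub>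
     cls (B \<odot> B') (B \<odot> D') u (under C (OMap R u) B' D' B h))"
  using assms by (simp add: cls_Comp[of t g] cls_ATensor flip: cls_under_Comp)

text \<open>Each side expands to four whiskerings that differ in the middle pair: on the left
  \<open>f'\<close> precedes \<open>g\<close>, on the right \<open>g\<close> precedes
  \<open>f'\<close>. \<open>cls_exchange\<close> interchanges that pair.\<close>

lemma cls_ATensor_Comp:
  assumes f: "(s, f) \<in> proc A B" and f': "(t, f') \<in> proc B D"
    and g: "(u, g) \<in> proc A' B'" and g': "(v, g') \<in> proc B' D'"
    and o [simp]: "A \<in> Obj C" "B \<in> Obj C" "D \<in> Obj C" "A' \<in> Obj C" "B' \<in> Obj C" "D' \<in> Obj C"
  shows "(cls A B s f \<Zcomp>\<^bsub>\<S>\<^esub> cls B D t f') \<otimes>\<^bsub>\<S>\<^esub> (cls A' B' u g \<Zcomp>\<^bsub>\<S>\<^esub> cls B' D' v g') =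
    (cls A B s f \<otimes>\<^bsub>\<S>\<^esub> cls A' B' u g) \<Zcomp>\<^bsub>\<S>\<^esub> (cls B D t f' \<otimes>\<^bsub>\<S>\<^esub> cls B' D' v g')"
proof -
  let ?F = "cls (A \<odot> A') (B \<odot> A') s (extend C (OMap R s) A B A' f)"
    and ?F' = "cls (B \<odot> A') (D \<odot> A') t (extend C (OMap R t) B D A' f')"
    and ?F'' = "cls (B \<odot> B') (D \<odot> B') t (extend C (OMap R t) B D B' f')"
    and ?G = "cls (D \<odot> A') (D \<odot> B') u (under C (OMap R u) A' B' D g)"
    and ?G'' = "cls (B \<odot> A') (B \<odot> B') u (under C (OMap R u) A' B' B g)"
    and ?G' = "cls (D \<odot> B') (D \<odot> D') v (under C (OMap R v) B' D' D g')"
  have E: "?F' \<Zcomp>\<^bsub>\<S>\<^esub> ?G = ?G'' \<Zcomp>\<^bsub>\<S>\<^esub> ?F''"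
    using f' g by (intro cls_exchange) auto
  have "(cls A B s f \<Zcomp>\<^bsub>\<S>\<^esub> cls B D t f') \<otimes>\<^bsub>\<S>\<^esub> (cls A' B' u g \<Zcomp>\<^bsub>\<S>\<^esub> cls B' D' v g')
    = (?F \<Zcomp>\<^bsub>\<S>\<^esub> ?F') \<Zcomp>\<^bsub>\<S>\<^esub> (?G \<Zcomp>\<^bsub>\<S>\<^esub> ?G')"
    using assms by (simp add: cls_Comp[of s f] cls_ATensor_comp flip: cls_extend_Comp)
  also have "\<dots> = ?F \<Zcomp>\<^bsub>\<S>\<^esub> ((?F' \<Zcomp>\<^bsub>\<S>\<^esub> ?G) \<Zcomp>\<^bsub>\<S>\<^esub> ?G')"
    using assms by (simp add: St.assoc)
  also have "\<dots> = (?F \<Zcomp>\<^bsub>\<S>\<^esub> ?G'') \<Zcomp>\<^bsub>\<S>\<^esub> (?F'' \<Zcomp>\<^bsub>\<S>\<^esub> ?G')"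
    unfolding E using assms by (simp add: St.assoc)
  also have "\<dots> = (cls A B s f \<otimes>\<^bsub>\<S>\<^esub> cls A' B' u g) \<Zcomp>\<^bsub>\<S>\<^esub> (cls B D t f' \<otimes>\<^bsub>\<S>\<^esub> cls B' D' v g')"
    using assms by (simp add: cls_ATensor)
  finally show ?thesis .
qed

text \<open>A triple tensor is a composite of three whiskered processes, and the associator passes
  them from the last to the first: \<open>h\<close> by \<open>under_OTensor\<close>,
  \<open>g\<close> by \<open>extend_under\<close>, \<open>f\<close> by
  \<open>extend_OTensor\<close>.\<close>

lemma cls_Assoc_natural:
  assumes f: "(s, f) \<in> proc A A'" and g: "(t, g) \<in> proc B B'" and h: "(u, h) \<in> proc D D'"
    and o [simp]: "A \<in> Obj C" "B \<in> Obj C" "D \<in> Obj C" "A' \<in> Obj C" "B' \<in> Obj C" "D' \<in> Obj C"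
  shows "cls A A' s f \<otimes>\<^bsub>\<S>\<^esub> cls B B' t g \<otimes>\<^bsub>\<S>\<^esub> cls D D' u h \<Zcomp>\<^bsub>\<S>\<^esub> iota_arr C S R (\<alpha> A' B' D') =
    iota_arr C S R (\<alpha> A B D) \<Zcomp>\<^bsub>\<S>\<^esub> (cls A A' s f \<otimes>\<^bsub>\<S>\<^esub> (cls B B' t g \<otimes>\<^bsub>\<S>\<^esub> cls D D' u h))"
proof -
  let ?f = "extend C (OMap R s) A A' B f" and ?g = "under C (OMap R t) B B' A' g"
  have N1: "cls (A \<odot> B \<odot> D) (A' \<odot> B \<odot> D) s (extend C (OMap R s) (A \<odot> B) (A' \<odot> B) D ?f) \<Zcomp>\<^bsub>\<S>\<^esub> iota_arr C S R (\<alpha> A' B D)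
    = iota_arr C S R (\<alpha> A B D) \<Zcomp>\<^bsub>\<S>\<^esub> cls (A \<odot> (B \<odot> D)) (A' \<odot> (B \<odot> D)) s (extend C (OMap R s) A A' (B \<odot> D) f)"
    using f by (simp add: cls_Comp_iota_arr iota_arr_Comp_cls R.D.extend_OTensor)
  have N2: "cls (A' \<odot> B \<odot> D) (A' \<odot> B' \<odot> D) t (extend C (OMap R t) (A' \<odot> B) (A' \<odot> B') D ?g) \<Zcomp>\<^bsub>\<S>\<^esub> iota_arr C S R (\<alpha> A' B' D)
    = iota_arr C S R (\<alpha> A' B D) \<Zcomp>\<^bsub>\<S>\<^esub> cls (A' \<odot> (B \<odot> D)) (A' \<odot> (B' \<odot> D)) t (under C (OMap R t) (B \<odot> D) (B' \<odot> D) A' (extend C (OMap R t) B B' D g))"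
    using g by (simp add: cls_Comp_iota_arr iota_arr_Comp_cls R.D.extend_under)
  have N3: "cls (A' \<odot> B' \<odot> D) (A' \<odot> B' \<odot> D') u (under C (OMap R u) D D' (A' \<odot> B') h) \<Zcomp>\<^bsub>\<S>\<^esub> iota_arr C S R (\<alpha> A' B' D')
    = iota_arr C S R (\<alpha> A' B' D) \<Zcomp>\<^bsub>\<S>\<^esub> cls (A' \<odot> (B' \<odot> D)) (A' \<odot> (B' \<odot> D')) u (under C (OMap R u) (B' \<odot> D) (B' \<odot> D') A' (under C (OMap R u) D D' B' h))"
    using h by (simp add: cls_Comp_iota_arr iota_arr_Comp_cls R.D.under_OTensor R.D.assoc)
  show ?thesis
    using f g h by (simp add: cls_ATensor[of s f] cls_ATensor[of t g] cls_comp_ATensor cls_ATensor_comp St.assoc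
        N3 N2[THEN St.Comp_eq_assoc] N1[THEN St.Comp_eq_assoc])
qed

text \<open>\<open>under_Symm\<close> lets the symmetry turn each whiskering into the one on the
  other side. This leaves the two processes in the wrong order, which \<open>cls_exchange\<close>
  repairs (\<open>N3\<close>).\<close>

lemma cls_Symm_natural:
  assumes f: "(s, f) \<in> proc A A'" and g: "(t, g) \<in> proc B B'"
    and o [simp]: "A \<in> Obj C" "B \<in> Obj C" "A' \<in> Obj C" "B' \<in> Obj C"
  shows "(cls A A' s f \<otimes>\<^bsub>\<S>\<^esub> cls B B' t g) \<Zcomp>\<^bsub>\<S>\<^esub> iota_arr C S R (\<sigma> A' B') =
    iota_arr C S R (\<sigma> A B) \<Zcomp>\<^bsub>\<S>\<^esub> (cls B B' t g \<otimes>\<^bsub>\<S>\<^esub> cls A A' s f)"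
proof -
  have lw: "X \<rhd> \<sigma> Y Z \<Zcomp> X \<rhd> \<sigma> Z Y = \<one> (X \<odot> (Y \<odot> Z))"
    if "X \<in> Obj C" "Y \<in> Obj C" "Z \<in> Obj C" for X Y Z
    using that by (simp flip: R.D.whisker_Comp)
  have lw': "X \<rhd> \<sigma> Y Z \<Zcomp> (X \<rhd> \<sigma> Z Y \<Zcomp> k) = k"
    if "X \<in> Obj C" "Y \<in> Obj C" "Z \<in> Obj C" "k \<in> Arr C" "Dom C k = X \<odot> (Y \<odot> Z)" for X Y Z k
    using that by (simp add: lw flip: R.D.assoc)
  have N1: "cls (A' \<odot> B) (A' \<odot> B') t (under C (OMap R t) B B' A' g) \<Zcomp>\<^bsub>\<S>\<^esub> iota_arr C S R (\<sigma> A' B')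
    = iota_arr C S R (\<sigma> A' B) \<Zcomp>\<^bsub>\<S>\<^esub> cls (B \<odot> A') (B' \<odot> A') t (extend C (OMap R t) B B' A' g)"
    using g by (simp add: cls_Comp_iota_arr iota_arr_Comp_cls R.D.under_Symm R.D.assoc lw)
  have N2: "cls (A \<odot> B) (A' \<odot> B) s (extend C (OMap R s) A A' B f) \<Zcomp>\<^bsub>\<S>\<^esub> iota_arr C S R (\<sigma> A' B)
    = iota_arr C S R (\<sigma> A B) \<Zcomp>\<^bsub>\<S>\<^esub> cls (B \<odot> A) (B \<odot> A') s (under C (OMap R s) A A' B f)"
    using f by (simp add: cls_Comp_iota_arr iota_arr_Comp_cls R.D.under_Symm R.D.assoc lw')
  have N3: "cls (B \<odot> A) (B' \<odot> A) t (extend C (OMap R t) B B' A g) \<Zcomp>\<^bsub>\<S>\<^esub> cls (B' \<odot> A) (B' \<odot> A') s (under C (OMap R s) A A' B' f)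
    = cls (B \<odot> A) (B \<odot> A') s (under C (OMap R s) A A' B f) \<Zcomp>\<^bsub>\<S>\<^esub> cls (B \<odot> A') (B' \<odot> A') t (extend C (OMap R t) B B' A' g)"
    using f g by (intro cls_exchange) auto
  show ?thesis
    using f g by (simp add: cls_ATensor St.assoc N1 N2[THEN St.Comp_eq_assoc] N3)
qed

lemma cls_LUnitor_natural:
  assumes "(s, f) \<in> proc A B" "A \<in> Obj C" "B \<in> Obj C"
  shows "(\<one>\<^bsub>\<S>\<^esub> \<I> \<otimes>\<^bsub>\<S>\<^esub> cls A B s f) \<Zcomp>\<^bsub>\<S>\<^esub> iota_arr C S R (\<lambda>_ B) = iota_arr C S R (\<lambda>_ A) \<Zcomp>\<^bsub>\<S>\<^esub> cls A B s f"
  using assms by (simp add: iota_arr_ATensor_cls iota_arr_Comp_cls cls_Comp_iota_arr R.D.under_TUnit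
    flip: iota_arr_Ide)

lemma cls_RUnitor_natural:
  assumes "(s, f) \<in> proc A B" "A \<in> Obj C" "B \<in> Obj C"
  shows "(cls A B s f \<otimes>\<^bsub>\<S>\<^esub> \<one>\<^bsub>\<S>\<^esub> \<I>) \<Zcomp>\<^bsub>\<S>\<^esub> iota_arr C S R (\<rho> B) = iota_arr C S R (\<rho> A) \<Zcomp>\<^bsub>\<S>\<^esub> cls A B s f"
  using assms by (simp add: cls_ATensor_iota_arr iota_arr_Comp_cls cls_Comp_iota_arr R.D.extend_TUnit
    flip: iota_arr_Ide)

lemma symmetric_monoidal_category_St: "symmetric_monoidal_category \<S>"
proof
  \<comment> \<open>All structure maps of \<open>St\<close> are images of those of \<open>C\<close>.
    These equations collect a composite of images into one image, so the coherence axioms are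
    inherited from \<open>C\<close>.\<close>
  note \<iota> = iota_arr_Ide[symmetric] iota_arr_Comp[symmetric] iota_arr_ATensor[symmetric]
  fix A B D E
  show "\<I>\<^bsub>\<S>\<^esub> \<in> Obj \<S>" by simp
  { assume [simp]: "A \<in> Obj \<S>"
    show "\<lambda>\<^bsub>\<S>\<^esub>_ A \<in> hom \<S> (\<I>\<^bsub>\<S>\<^esub> \<odot>\<^bsub>\<S>\<^esub> A) A" "is_iso \<S> (\<lambda>\<^bsub>\<S>\<^esub>_ A)"
      "\<rho>\<^bsub>\<S>\<^esub> A \<in> hom \<S> (A \<odot>\<^bsub>\<S>\<^esub> \<I>\<^bsub>\<S>\<^esub>) A" "is_iso \<S> (\<rho>\<^bsub>\<S>\<^esub> A)"
      using \<open>A \<in> Obj \<S>\<close> by (simp_all add: St_structure) }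
  { assume AB: "A \<in> Obj \<S>" "B \<in> Obj \<S>"
    then show "A \<odot>\<^bsub>\<S>\<^esub> B \<in> Obj \<S>" "\<one>\<^bsub>\<S>\<^esub> A \<otimes>\<^bsub>\<S>\<^esub> \<one>\<^bsub>\<S>\<^esub> B = \<one>\<^bsub>\<S>\<^esub> (A \<odot>\<^bsub>\<S>\<^esub> B)"
      "\<sigma>\<^bsub>\<S>\<^esub> A B \<in> hom \<S> (A \<odot>\<^bsub>\<S>\<^esub> B) (B \<odot>\<^bsub>\<S>\<^esub> A)" "\<sigma>\<^bsub>\<S>\<^esub> A B \<Zcomp>\<^bsub>\<S>\<^esub> \<sigma>\<^bsub>\<S>\<^esub> B A = \<one>\<^bsub>\<S>\<^esub> (A \<odot>\<^bsub>\<S>\<^esub> B)"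
      by (simp_all add: St_structure \<iota>)
    show "\<alpha>\<^bsub>\<S>\<^esub> A \<I>\<^bsub>\<S>\<^esub> B \<Zcomp>\<^bsub>\<S>\<^esub> (\<one>\<^bsub>\<S>\<^esub> A \<otimes>\<^bsub>\<S>\<^esub> \<lambda>\<^bsub>\<S>\<^esub>_ B) = \<rho>\<^bsub>\<S>\<^esub> A \<otimes>\<^bsub>\<S>\<^esub> \<one>\<^bsub>\<S>\<^esub> B"
      using AB by (simp add: St_structure \<iota> R.D.triangle) }
  { assume ABD: "A \<in> Obj \<S>" "B \<in> Obj \<S>" "D \<in> Obj \<S>"
    then show "\<alpha>\<^bsub>\<S>\<^esub> A B D \<in> hom \<S> (A \<odot>\<^bsub>\<S>\<^esub> B \<odot>\<^bsub>\<S>\<^esub> D) (A \<odot>\<^bsub>\<S>\<^esub> (B \<odot>\<^bsub>\<S>\<^esub> D))" "is_iso \<S> (\<alpha>\<^bsub>\<S>\<^esub> A B D)"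
      by (simp_all add: St_structure)
    show "\<alpha>\<^bsub>\<S>\<^esub> A B D \<Zcomp>\<^bsub>\<S>\<^esub> \<sigma>\<^bsub>\<S>\<^esub> A (B \<odot>\<^bsub>\<S>\<^esub> D) \<Zcomp>\<^bsub>\<S>\<^esub> \<alpha>\<^bsub>\<S>\<^esub> B D A
          = (\<sigma>\<^bsub>\<S>\<^esub> A B \<otimes>\<^bsub>\<S>\<^esub> \<one>\<^bsub>\<S>\<^esub> D) \<Zcomp>\<^bsub>\<S>\<^esub> \<alpha>\<^bsub>\<S>\<^esub> B A D \<Zcomp>\<^bsub>\<S>\<^esub> (\<one>\<^bsub>\<S>\<^esub> B \<otimes>\<^bsub>\<S>\<^esub> \<sigma>\<^bsub>\<S>\<^esub> A D)"
      using ABD by (simp add: St_structure \<iota> R.D.hexagon) }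
  { assume ABDE: "A \<in> Obj \<S>" "B \<in> Obj \<S>" "D \<in> Obj \<S>" "E \<in> Obj \<S>"
    show "(\<alpha>\<^bsub>\<S>\<^esub> A B D \<otimes>\<^bsub>\<S>\<^esub> \<one>\<^bsub>\<S>\<^esub> E) \<Zcomp>\<^bsub>\<S>\<^esub> \<alpha>\<^bsub>\<S>\<^esub> A (B \<odot>\<^bsub>\<S>\<^esub> D) E \<Zcomp>\<^bsub>\<S>\<^esub> (\<one>\<^bsub>\<S>\<^esub> A \<otimes>\<^bsub>\<S>\<^esub> \<alpha>\<^bsub>\<S>\<^esub> B D E)
          = \<alpha>\<^bsub>\<S>\<^esub> (A \<odot>\<^bsub>\<S>\<^esub> B) D E \<Zcomp>\<^bsub>\<S>\<^esub> \<alpha>\<^bsub>\<S>\<^esub> A B (D \<odot>\<^bsub>\<S>\<^esub> E)"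
      using ABDE by (simp add: St_structure \<iota> R.D.pentagon) }
next
  fix X A B Y A' B'
  assume "X \<in> hom \<S> A B" "Y \<in> hom \<S> A' B'"
  then show "X \<otimes>\<^bsub>\<S>\<^esub> Y \<in> hom \<S> (A \<odot>\<^bsub>\<S>\<^esub> A') (B \<odot>\<^bsub>\<S>\<^esub> B')"
    by (elim St_hom_cases) (simp add: cls_ATensor)
next
  fix X A B Y D X' A' B' Y' D'
  assume "X \<in> hom \<S> A B" "Y \<in> hom \<S> B D" "X' \<in> hom \<S> A' B'" "Y' \<in> hom \<S> B' D'"
  then show "(X \<Zcomp>\<^bsub>\<S>\<^esub> Y) \<otimes>\<^bsub>\<S>\<^esub> (X' \<Zcomp>\<^bsub>\<S>\<^esub> Y') = (X \<otimes>\<^bsub>\<S>\<^esub> X') \<Zcomp>\<^bsub>\<S>\<^esub> (Y \<otimes>\<^bsub>\<S>\<^esub> Y')"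
    by (elim St_hom_cases) (simp add: cls_ATensor_Comp)
next
  fix X A A' Y B B' Z D D'
  assume "X \<in> hom \<S> A A'" "Y \<in> hom \<S> B B'" "Z \<in> hom \<S> D D'"
  then show "(X \<otimes>\<^bsub>\<S>\<^esub> Y \<otimes>\<^bsub>\<S>\<^esub> Z) \<Zcomp>\<^bsub>\<S>\<^esub> \<alpha>\<^bsub>\<S>\<^esub> A' B' D' = \<alpha>\<^bsub>\<S>\<^esub> A B D \<Zcomp>\<^bsub>\<S>\<^esub> (X \<otimes>\<^bsub>\<S>\<^esub> (Y \<otimes>\<^bsub>\<S>\<^esub> Z))"
    by (elim St_hom_cases) (simp add: St_structure cls_Assoc_natural)
next
  fix X A B
  assume "X \<in> hom \<S> A B"
  then show "(\<one>\<^bsub>\<S>\<^esub> \<I>\<^bsub>\<S>\<^esub> \<otimes>\<^bsub>\<S>\<^esub> X) \<Zcomp>\<^bsub>\<S>\<^esub> \<lambda>\<^bsub>\<S>\<^esub>_ B = \<lambda>\<^bsub>\<S>\<^esub>_ A \<Zcomp>\<^bsub>\<S>\<^esub> X"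
    "(X \<otimes>\<^bsub>\<S>\<^esub> \<one>\<^bsub>\<S>\<^esub> \<I>\<^bsub>\<S>\<^esub>) \<Zcomp>\<^bsub>\<S>\<^esub> \<rho>\<^bsub>\<S>\<^esub> B = \<rho>\<^bsub>\<S>\<^esub> A \<Zcomp>\<^bsub>\<S>\<^esub> X"
    by (elim St_hom_cases; simp add: St_structure cls_LUnitor_natural cls_RUnitor_natural)+
next
  fix X A A' Y B B'
  assume "X \<in> hom \<S> A A'" "Y \<in> hom \<S> B B'"
  then show "(X \<otimes>\<^bsub>\<S>\<^esub> Y) \<Zcomp>\<^bsub>\<S>\<^esub> \<sigma>\<^bsub>\<S>\<^esub> A' B' = \<sigma>\<^bsub>\<S>\<^esub> A B \<Zcomp>\<^bsub>\<S>\<^esub> (Y \<otimes>\<^bsub>\<S>\<^esub> X)"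
    by (elim St_hom_cases) (simp add: St_structure cls_Symm_natural)
qed

section \<open>The feedback structure on stateful processes\<close>

sublocale St: symmetric_monoidal_category \<S>
  by (rule symmetric_monoidal_category_St)

section \<open>The canonical functor and the induced action on processes\<close>

lemma iota_arr_whisker:
  assumes "u \<in> Arr C" "A \<in> Obj C"
  shows "iota_arr C S R u \<lhd>\<^bsub>\<S>\<^esub> A = iota_arr C S R (u \<lhd> A)" "A \<rhd>\<^bsub>\<S>\<^esub> iota_arr C S R u = iota_arr C S R (A \<rhd> u)"
  using assms by (simp_all add: lwhisker_def rwhisker_def iota_arr_ATensor iota_arr_Ide)

lemma iota_select [simp]:
  "OMap (iota C S R) A = A" "AMap (iota C S R) = iota_arr C S R"
  "Eps (iota C S R) = \<one>\<^bsub>\<S>\<^esub> \<I>" "Mu (iota C S R) A B = \<one>\<^bsub>\<S>\<^esub> (A \<odot> B)"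
  by (simp_all add: iota_def)

lemma symmetric_monoidal_functor_iota: "symmetric_monoidal_functor C \<S> (iota C S R)"
proof
  note \<iota> = iota_arr_Ide[symmetric] iota_arr_Comp[symmetric] iota_arr_ATensor[symmetric]
  fix A B E
  show "Eps (iota C S R) \<in> hom \<S> \<I>\<^bsub>\<S>\<^esub> (OMap (iota C S R) \<I>)" "is_iso \<S> (Eps (iota C S R))"
    by simp_all
  { assume "A \<in> Obj C"
    then show "OMap (iota C S R) A \<in> Obj \<S>" "AMap (iota C S R) (\<one> A) = \<one>\<^bsub>\<S>\<^esub> (OMap (iota C S R) A)"
      "(Eps (iota C S R) \<otimes>\<^bsub>\<S>\<^esub> \<one>\<^bsub>\<S>\<^esub> (OMap (iota C S R) A)) \<Zcomp>\<^bsub>\<S>\<^esub> Mu (iota C S R) \<I> A \<Zcomp>\<^bsub>\<S>\<^esub> AMap (iota C S R) (\<lambda>_ A)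
        = \<lambda>\<^bsub>\<S>\<^esub>_ (OMap (iota C S R) A)"
      "(\<one>\<^bsub>\<S>\<^esub> (OMap (iota C S R) A) \<otimes>\<^bsub>\<S>\<^esub> Eps (iota C S R)) \<Zcomp>\<^bsub>\<S>\<^esub> Mu (iota C S R) A \<I> \<Zcomp>\<^bsub>\<S>\<^esub> AMap (iota C S R) (\<rho> A)
        = \<rho>\<^bsub>\<S>\<^esub> (OMap (iota C S R) A)"
      by (simp_all add: iota_arr_Ide St_structure) }
  { assume "A \<in> Obj C" "B \<in> Obj C"
    then show "Mu (iota C S R) A B \<in> hom \<S> (OMap (iota C S R) A \<odot>\<^bsub>\<S>\<^esub> OMap (iota C S R) B) (OMap (iota C S R) (A \<odot> B))"
      "is_iso \<S> (Mu (iota C S R) A B)"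
      "Mu (iota C S R) A B \<Zcomp>\<^bsub>\<S>\<^esub> AMap (iota C S R) (\<sigma> A B) =
        \<sigma>\<^bsub>\<S>\<^esub> (OMap (iota C S R) A) (OMap (iota C S R) B) \<Zcomp>\<^bsub>\<S>\<^esub> Mu (iota C S R) B A"
      by (simp_all add: St_structure) }
  { assume "A \<in> Obj C" "B \<in> Obj C" "E \<in> Obj C"
    then show "(Mu (iota C S R) A B \<otimes>\<^bsub>\<S>\<^esub> \<one>\<^bsub>\<S>\<^esub> (OMap (iota C S R) E)) \<Zcomp>\<^bsub>\<S>\<^esub> Mu (iota C S R) (A \<odot> B) E
        \<Zcomp>\<^bsub>\<S>\<^esub> AMap (iota C S R) (\<alpha> A B E)
      = \<alpha>\<^bsub>\<S>\<^esub> (OMap (iota C S R) A) (OMap (iota C S R) B) (OMap (iota C S R) E)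
        \<Zcomp>\<^bsub>\<S>\<^esub> (\<one>\<^bsub>\<S>\<^esub> (OMap (iota C S R) A) \<otimes>\<^bsub>\<S>\<^esub> Mu (iota C S R) B E) \<Zcomp>\<^bsub>\<S>\<^esub> Mu (iota C S R) A (B \<odot> E)"
      by (simp add: St_structure) }
next
  fix f A B g A' B'
  show "AMap (iota C S R) f \<in> hom \<S> (OMap (iota C S R) A) (OMap (iota C S R) B)" if "f \<in> hom C A B"
    using that by simp
  show "AMap (iota C S R) (f \<Zcomp> g) = AMap (iota C S R) f \<Zcomp>\<^bsub>\<S>\<^esub> AMap (iota C S R) g"
    if "f \<in> hom C A B" "g \<in> hom C B B'"
    using that by (simp add: iota_arr_Comp)
  show "(AMap (iota C S R) f \<otimes>\<^bsub>\<S>\<^esub> AMap (iota C S R) g) \<Zcomp>\<^bsub>\<S>\<^esub> Mu (iota C S R) B B'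
    = Mu (iota C S R) A A' \<Zcomp>\<^bsub>\<S>\<^esub> AMap (iota C S R) (f \<otimes> g)"
    if "f \<in> hom C A B" "g \<in> hom C A' B'"
    using that by (auto simp: iota_arr_ATensor)
qed

abbreviation R\<iota> where "R\<iota> \<equiv> mf_comp \<S> R (iota C S R)"

sublocale R\<iota>: symmetric_monoidal_functor S \<S> R\<iota>
  using symmetric_monoidal_functor_mf_comp R.symmetric_monoidal_functor_axioms
    symmetric_monoidal_functor_iota .

lemma R\<iota>_select:
  shows "OMap R\<iota> s = OMap R s" "AMap R\<iota> h = iota_arr C S R (AMap R h)"
    "Eps R\<iota> = iota_arr C S R (Eps R)"
    "\<lbrakk>s \<in> Obj S; t \<in> Obj S\<rbrakk> \<Longrightarrow> Mu R\<iota> s t = iota_arr C S R (Mu R s t)"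
  by (simp_all add: mf_comp_def)

lemma act_R\<iota>:
  "\<lbrakk>s \<in> Obj S; t \<in> Obj S; A \<in> Obj C\<rbrakk> \<Longrightarrow> act \<S> R\<iota> s t A = iota_arr C S R (act C R s t A)"
  "A \<in> Obj C \<Longrightarrow> act_unit \<S> R\<iota> A = iota_arr C S R (act_unit C R A)"
  by (simp_all add: act_def act_unit_def R\<iota>_select iota_arr_whisker iota_arr_Comp St_structure
    del: R.D.is_iso_whisker(3,4) St.is_iso_whisker(3,4))

section \<open>Storing state\<close>

lemma cls_store:
  assumes f: "(s, f) \<in> proc (OMap R t \<odot> A) (OMap R t \<odot> B)"
    and o: "t \<in> Obj S" "A \<in> Obj C" "B \<in> Obj C"
  shows "store C S R t A B (cls (OMap R t \<odot> A) (OMap R t \<odot> B) s f) = cls A B (s \<odot>\<^bsub>S\<^esub> t) (join s t A B f)"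
proof -
  let ?\<phi> = "\<lambda>(s, f). process_rel C S R A B `` {(s \<odot>\<^bsub>S\<^esub> t, join s t A B f)}"
  have "(\<Union>p \<in> process_rel C S R (OMap R t \<odot> A) (OMap R t \<odot> B) `` {(s, f)}. ?\<phi> p) = ?\<phi> (s, f)"
  proof (rule cls_slide_arrow)
    fix x y h l
    assume *: "h \<in> Arr S" "Dom S h = x" "Cod S h = y" "l \<in> Arr C"
      "Dom C l = OMap R y \<odot> (OMap R t \<odot> A)" "Cod C l = OMap R x \<odot> (OMap R t \<odot> B)"
    show "?\<phi> (x, AMap R h \<lhd> (OMap R t \<odot> A) \<Zcomp> l) = ?\<phi> (y, l \<Zcomp> AMap R h \<lhd> (OMap R t \<odot> B))"
      unfolding case_prod_conv rel_eq_iff using * o by (intro cls_slide_join_left) simp_all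
  qed (use f o in auto)
  then show ?thesis by (simp add: store_def St_class_def)
qed

lemma act_Symm_right:
  assumes "t \<in> Obj S" "u \<in> Obj S" "X \<in> Obj C" "A \<in> Obj C"
  shows "X \<rhd> (AMap R (\<sigma>\<^bsub>S\<^esub> t u) \<lhd> A) = X \<rhd> act C R t u A \<Zcomp> (X \<rhd> \<omega> (OMap R t) (OMap R u) A
    \<Zcomp> inv (X \<rhd> act C R u t A))"
proof -
  have "AMap R (\<sigma>\<^bsub>S\<^esub> t u) \<lhd> A = act C R t u A \<Zcomp> (\<omega> (OMap R t) (OMap R u) A \<Zcomp> inv (act C R u t A))"
    using R.D.move_right[OF _ _ _ R.act_Symm[of t u A, symmetric]] assms by (simp add: R.D.assoc)
  then show ?thesis using assms by simp
qed

text \<open>Rebracketing groups the last two of three state components, and a slide along the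
  symmetry of \<open>S\<close> in the second component exchanges them.\<close>

lemma cls_join_join_Symm:
  assumes "s \<in> Obj S" "t \<in> Obj S" "u \<in> Obj S" "A \<in> Obj C" "B \<in> Obj C"
    and f: "f \<in> Arr C" "Dom C f = OMap R s \<odot> (OMap R u \<odot> (OMap R t \<odot> A))"
    "Cod C f = OMap R s \<odot> (OMap R u \<odot> (OMap R t \<odot> B))"
  shows "cls A B (s \<odot>\<^bsub>S\<^esub> t \<odot>\<^bsub>S\<^esub> u) (join (s \<odot>\<^bsub>S\<^esub> t) u A B (join s t (OMap R u \<odot> A) (OMap R u \<odot> B)
      (OMap R s \<rhd> \<omega> (OMap R t) (OMap R u) A \<Zcomp> (f \<Zcomp> OMap R s \<rhd> \<omega> (OMap R u) (OMap R t) B))))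
    = cls A B (s \<odot>\<^bsub>S\<^esub> u \<odot>\<^bsub>S\<^esub> t) (join (s \<odot>\<^bsub>S\<^esub> u) t A B (join s u (OMap R t \<odot> A) (OMap R t \<odot> B) f))"
proof -
  let ?s = "OMap R s" and ?t = "OMap R t" and ?u = "OMap R u"
  \<comment> \<open>It starts from the unpacked state \<open>u \<odot> t\<close> and ends in the
    packed state \<open>t \<odot> u\<close>, which is the type that the middle arrow of a slide
    along \<open>\<sigma> t u\<close> must have.\<close>
  let ?f = "?s \<rhd> act C R u t A \<Zcomp> (f \<Zcomp> (?s \<rhd> \<omega> ?u ?t B \<Zcomp> inv (?s \<rhd> act C R t u B)))"
  have "cls A B (s \<odot>\<^bsub>S\<^esub> (t \<odot>\<^bsub>S\<^esub> u)) (join s (t \<odot>\<^bsub>S\<^esub> u) A B (?s \<rhd> (AMap R (\<sigma>\<^bsub>S\<^esub> t u) \<lhd> A) \<Zcomp> ?f))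
    = cls A B (s \<odot>\<^bsub>S\<^esub> (u \<odot>\<^bsub>S\<^esub> t)) (join s (u \<odot>\<^bsub>S\<^esub> t) A B (?f \<Zcomp> ?s \<rhd> (AMap R (\<sigma>\<^bsub>S\<^esub> t u) \<lhd> B)))"
    using assms by (intro cls_slide_join_right) simp_all
  then show ?thesis
    using assms by (simp add: cls_join_Assoc act_Symm_right R.D.assoc)
qed

lemma lwhisker_cls:
  assumes "(s, f) \<in> proc A B" "A \<in> Obj C" "B \<in> Obj C" "X \<in> Obj C"
  shows "X \<rhd>\<^bsub>\<S>\<^esub> cls A B s f = cls (X \<odot> A) (X \<odot> B) s (under C (OMap R s) A B X f)"
  using assms iota_arr_ATensor_cls[of s f A B "\<one> X"] by (simp add: lwhisker_def iota_arr_Ide)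

text \<open>Storing before the composition gives the states \<open>s\<close>, \<open>t\<close>,
  \<open>u\<close>, and storing after it gives \<open>s\<close>, \<open>u\<close>, \<open>t\<close>;
  hence the exchange of the last two components.\<close>

lemma tightening_right:
  assumes f: "(s, f) \<in> proc (OMap R t \<odot> A) (OMap R t \<odot> B)" and g: "(u, g) \<in> proc B D"
    and [simp]: "t \<in> Obj S" "A \<in> Obj C" "B \<in> Obj C" "D \<in> Obj C"
  shows "store C S R t A B (cls (OMap R t \<odot> A) (OMap R t \<odot> B) s f) \<Zcomp>\<^bsub>\<S>\<^esub> cls B D u g
    = store C S R t A D (cls (OMap R t \<odot> A) (OMap R t \<odot> B) s f \<Zcomp>\<^bsub>\<S>\<^esub> (OMap R t \<rhd>\<^bsub>\<S>\<^esub> cls B D u g))"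
proof -
  let ?s = "OMap R s" and ?t = "OMap R t" and ?u = "OMap R u"
  let ?f = "under C ?s (?t \<odot> A) (?t \<odot> B) ?u f \<Zcomp> ?s \<rhd> under C ?u B D ?t g"
  have E: "join s t (?u \<odot> A) (?u \<odot> B) h \<Zcomp> OMap R (s \<odot>\<^bsub>S\<^esub> t) \<rhd> g =
    join s t (?u \<odot> A) (?u \<odot> D) (h \<Zcomp> ?s \<rhd> ?t \<rhd> g)"
    if "h \<in> Arr C" "Dom C h = ?s \<odot> (?t \<odot> (?u \<odot> A))" "Cod C h = ?s \<odot> (?t \<odot> (?u \<odot> B))" for h
    using that f g join_lwhisker[of s t g "?u \<odot> B" "?u \<odot> D"] by (simp add: join_Comp)
  have "store C S R t A B (cls (?t \<odot> A) (?t \<odot> B) s f) \<Zcomp>\<^bsub>\<S>\<^esub> cls B D u g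
    = cls A D (s \<odot>\<^bsub>S\<^esub> t \<odot>\<^bsub>S\<^esub> u) (join (s \<odot>\<^bsub>S\<^esub> t) u A D (join s t (?u \<odot> A) (?u \<odot> D)
      (?s \<rhd> \<omega> ?t ?u A \<Zcomp> (?f \<Zcomp> ?s \<rhd> \<omega> ?u ?t D))))"
    using f g by (simp add: cls_store cls_Comp under_join E)
      (simp add: under_def[of C ?u] R.D.assoc)
  also have "\<dots> = cls A D (s \<odot>\<^bsub>S\<^esub> u \<odot>\<^bsub>S\<^esub> t) (join (s \<odot>\<^bsub>S\<^esub> u) t A D (join s u (?t \<odot> A) (?t \<odot> D) ?f))"
    using f g by (intro cls_join_join_Symm) simp_all
  also have "\<dots> = store C S R t A D (cls (?t \<odot> A) (?t \<odot> B) s f \<Zcomp>\<^bsub>\<S>\<^esub> (?t \<rhd>\<^bsub>\<S>\<^esub> cls B D u g))"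
    using f g by (simp add: lwhisker_cls cls_Comp cls_store)
  finally show ?thesis .
qed

text \<open>Both sides have the states \<open>u\<close>, \<open>s\<close>, \<open>t\<close> in this
  order, so a rebracketing suffices here.\<close>

lemma tightening_left:
  assumes f: "(s, f) \<in> proc (OMap R t \<odot> A) (OMap R t \<odot> B)" and g: "(u, g) \<in> proc D A"
    and [simp]: "t \<in> Obj S" "A \<in> Obj C" "B \<in> Obj C" "D \<in> Obj C"
  shows "cls D A u g \<Zcomp>\<^bsub>\<S>\<^esub> store C S R t A B (cls (OMap R t \<odot> A) (OMap R t \<odot> B) s f)
    = store C S R t D B ((OMap R t \<rhd>\<^bsub>\<S>\<^esub> cls D A u g) \<Zcomp>\<^bsub>\<S>\<^esub> cls (OMap R t \<odot> A) (OMap R t \<odot> B) s f)"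
  using f g by (simp add: lwhisker_cls cls_store cls_Comp cls_join_Assoc R.under_act)
    (simp add: R.join_state_act R.D.assoc)

text \<open>The tensor is the whiskering of the stored process followed by the whiskered second
  process \<open>?G\<close>. \<open>extend_join\<close> moves the store past the first, and
  \<open>tightening_right\<close> brings the second inside.\<close>

lemma strength_cls:
  assumes f: "(s, f) \<in> proc (OMap R t \<odot> A) (OMap R t \<odot> B)" and g: "(u, g) \<in> proc A' B'"
    and [simp]: "t \<in> Obj S" "A \<in> Obj C" "B \<in> Obj C" "A' \<in> Obj C" "B' \<in> Obj C"
  shows "store C S R t A B (cls (OMap R t \<odot> A) (OMap R t \<odot> B) s f) \<otimes>\<^bsub>\<S>\<^esub> cls A' B' u g =
    store C S R t (A \<odot> A') (B \<odot> B') (inv\<^bsub>\<S>\<^esub> (\<alpha>\<^bsub>\<S>\<^esub> (OMap R t) A A') \<Zcomp>\<^bsub>\<S>\<^esub>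
      (cls (OMap R t \<odot> A) (OMap R t \<odot> B) s f \<otimes>\<^bsub>\<S>\<^esub> cls A' B' u g) \<Zcomp>\<^bsub>\<S>\<^esub> \<alpha>\<^bsub>\<S>\<^esub> (OMap R t) B B')"
proof -
  let ?s = "OMap R s" and ?t = "OMap R t" and ?u = "OMap R u"
  let ?f = "inv (?s \<rhd> \<alpha> ?t A A') \<Zcomp> (extend C ?s (?t \<odot> A) (?t \<odot> B) A' f \<Zcomp> ?s \<rhd> \<alpha> ?t B A')"
  let ?F = "cls (?t \<odot> (A \<odot> A')) (?t \<odot> (B \<odot> A')) s ?f"
  let ?G = "cls (B \<odot> A') (B \<odot> B') u (under C ?u A' B' B g)"
  have "store C S R t A B (cls (?t \<odot> A) (?t \<odot> B) s f) \<otimes>\<^bsub>\<S>\<^esub> cls A' B' u g =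
    store C S R t (A \<odot> A') (B \<odot> A') ?F \<Zcomp>\<^bsub>\<S>\<^esub> ?G"
    using f g by (simp add: cls_store cls_ATensor extend_join)
  also have "\<dots> = store C S R t (A \<odot> A') (B \<odot> B') (?F \<Zcomp>\<^bsub>\<S>\<^esub> (?t \<rhd>\<^bsub>\<S>\<^esub> ?G))"
    using f g by (intro tightening_right) simp_all
  also have "?F \<Zcomp>\<^bsub>\<S>\<^esub> (?t \<rhd>\<^bsub>\<S>\<^esub> ?G) = inv\<^bsub>\<S>\<^esub> (\<alpha>\<^bsub>\<S>\<^esub> ?t A A') \<Zcomp>\<^bsub>\<S>\<^esub>
      (cls (?t \<odot> A) (?t \<odot> B) s f \<otimes>\<^bsub>\<S>\<^esub> cls A' B' u g) \<Zcomp>\<^bsub>\<S>\<^esub> \<alpha>\<^bsub>\<S>\<^esub> ?t B B'"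
  proof -
    have E1: "?F = iota_arr C S R (inv (\<alpha> ?t A A')) \<Zcomp>\<^bsub>\<S>\<^esub>
        (cls (?t \<odot> A \<odot> A') (?t \<odot> B \<odot> A') s (extend C ?s (?t \<odot> A) (?t \<odot> B) A' f) \<Zcomp>\<^bsub>\<S>\<^esub> iota_arr C S R (\<alpha> ?t B A'))"
      using f g by (simp add: iota_arr_Comp_cls cls_Comp_iota_arr)
    have E2: "cls (?t \<odot> B \<odot> A') (?t \<odot> B \<odot> B') u (under C ?u A' B' (?t \<odot> B) g) \<Zcomp>\<^bsub>\<S>\<^esub> iota_arr C S R (\<alpha> ?t B B')
      = iota_arr C S R (\<alpha> ?t B A') \<Zcomp>\<^bsub>\<S>\<^esub> (?t \<rhd>\<^bsub>\<S>\<^esub> ?G)"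
      using f g by (simp add: lwhisker_cls iota_arr_Comp_cls cls_Comp_iota_arr R.D.under_OTensor R.D.assoc)
    show ?thesis
      using f g unfolding E1 by (simp add: cls_ATensor St_structure St.assoc E2)
  qed
  finally show ?thesis .
qed

lemma structured_feedback_category_St:
  "structured_feedback_category \<S> S R\<iota> (store C S R)"
proof
  fix s A B X
  assume "s \<in> Obj S" "A \<in> Obj \<S>" "B \<in> Obj \<S>"
    "X \<in> hom \<S> (OMap R\<iota> s \<odot>\<^bsub>\<S>\<^esub> A) (OMap R\<iota> s \<odot>\<^bsub>\<S>\<^esub> B)"
  then show "store C S R s A B X \<in> hom \<S> A B"
    unfolding R\<iota>_select by (elim St_hom_cases) (simp add: cls_store)
next
  fix s A B X U V A' B'
  assume *: "s \<in> Obj S" "A \<in> Obj \<S>" "B \<in> Obj \<S>"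
    "X \<in> hom \<S> (OMap R\<iota> s \<odot>\<^bsub>\<S>\<^esub> A) (OMap R\<iota> s \<odot>\<^bsub>\<S>\<^esub> B)" "U \<in> hom \<S> A' A" "V \<in> hom \<S> B B'"
  obtain t f u g v h where
    X: "X = cls (OMap R s \<odot> A) (OMap R s \<odot> B) t f" "(t, f) \<in> proc (OMap R s \<odot> A) (OMap R s \<odot> B)" and
    U: "U = cls A' A u g" "(u, g) \<in> proc A' A" "A' \<in> Obj C" and
    V: "V = cls B B' v h" "(v, h) \<in> proc B B'" "B' \<in> Obj C"
    using *(4-6) unfolding R\<iota>_select by (elim St_hom_cases) auto
  have "U \<Zcomp>\<^bsub>\<S>\<^esub> store C S R s A B X \<Zcomp>\<^bsub>\<S>\<^esub> V
    = store C S R s A' B ((OMap R s \<rhd>\<^bsub>\<S>\<^esub> U) \<Zcomp>\<^bsub>\<S>\<^esub> X) \<Zcomp>\<^bsub>\<S>\<^esub> V"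
    using X U *(1-3) tightening_left[of t f s A B u g A'] by simp
  also have "(OMap R s \<rhd>\<^bsub>\<S>\<^esub> U) \<Zcomp>\<^bsub>\<S>\<^esub> X \<in> hom \<S> (OMap R s \<odot> A') (OMap R s \<odot> B)"
    using X U *(1-3) by simp
  \<comment> \<open>The composite is written as a single class again because
    \<open>tightening_right\<close> is stated for classes.\<close>
  then obtain w k where
    W: "(OMap R s \<rhd>\<^bsub>\<S>\<^esub> U) \<Zcomp>\<^bsub>\<S>\<^esub> X = cls (OMap R s \<odot> A') (OMap R s \<odot> B) w k"
      "(w, k) \<in> proc (OMap R s \<odot> A') (OMap R s \<odot> B)"
    by (elim St_hom_cases) auto
  have "store C S R s A' B ((OMap R s \<rhd>\<^bsub>\<S>\<^esub> U) \<Zcomp>\<^bsub>\<S>\<^esub> X) \<Zcomp>\<^bsub>\<S>\<^esub> V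
    = store C S R s A' B' ((OMap R s \<rhd>\<^bsub>\<S>\<^esub> U) \<Zcomp>\<^bsub>\<S>\<^esub> X \<Zcomp>\<^bsub>\<S>\<^esub> (OMap R s \<rhd>\<^bsub>\<S>\<^esub> V))"
    using W U(3) V *(1-3) tightening_right[of w k s A' B v h B'] by simp
  finally show "U \<Zcomp>\<^bsub>\<S>\<^esub> store C S R s A B X \<Zcomp>\<^bsub>\<S>\<^esub> V = store C S R s A' B'
      ((\<one>\<^bsub>\<S>\<^esub> (OMap R\<iota> s) \<otimes>\<^bsub>\<S>\<^esub> U) \<Zcomp>\<^bsub>\<S>\<^esub> X \<Zcomp>\<^bsub>\<S>\<^esub> (\<one>\<^bsub>\<S>\<^esub> (OMap R\<iota> s) \<otimes>\<^bsub>\<S>\<^esub> V))"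
    unfolding R\<iota>_select lwhisker_def .
next
  fix X A B assume *: "X \<in> hom \<S> A B"
  then obtain s f where X: "X = cls A B s f" "(s, f) \<in> proc A B" "A \<in> Obj C" "B \<in> Obj C"
    by (elim St_hom_cases) auto
  \<comment> \<open>\<open>store\<close> places the unit state behind \<open>s\<close>, so the right
    unitor of \<open>S\<close> removes it.\<close>
  have "store C S R \<I>\<^bsub>S\<^esub> A B (act_unit \<S> R\<iota> A \<Zcomp>\<^bsub>\<S>\<^esub> (X \<Zcomp>\<^bsub>\<S>\<^esub> inv\<^bsub>\<S>\<^esub> (act_unit \<S> R\<iota> B))) = X"
    using X by (simp add: act_R\<iota> iota_arr_Comp_cls cls_Comp_iota_arr cls_store cls_join_RUnitor)
  then show "store C S R \<I>\<^bsub>S\<^esub> A B (unit_state \<S> R\<iota> A B X) = X"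
    using * by (simp add: R\<iota>.unit_state_act)
next
  fix s t A B X
  assume *: "s \<in> Obj S" "t \<in> Obj S" "A \<in> Obj \<S>" "B \<in> Obj \<S>"
    "X \<in> hom \<S> (OMap R\<iota> s \<odot>\<^bsub>\<S>\<^esub> (OMap R\<iota> t \<odot>\<^bsub>\<S>\<^esub> A)) (OMap R\<iota> s \<odot>\<^bsub>\<S>\<^esub> (OMap R\<iota> t \<odot>\<^bsub>\<S>\<^esub> B))"
  obtain r f where X: "X = cls (OMap R s \<odot> (OMap R t \<odot> A)) (OMap R s \<odot> (OMap R t \<odot> B)) r f"
    "(r, f) \<in> proc (OMap R s \<odot> (OMap R t \<odot> A)) (OMap R s \<odot> (OMap R t \<odot> B))"
    using *(5) unfolding R\<iota>_select by (elim St_hom_cases) auto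
  have J: "join_state \<S> R\<iota> s t A B X = act \<S> R\<iota> s t A \<Zcomp>\<^bsub>\<S>\<^esub> (X \<Zcomp>\<^bsub>\<S>\<^esub> inv\<^bsub>\<S>\<^esub> (act \<S> R\<iota> s t B))"
    using * by (intro R\<iota>.join_state_act) simp_all
  show "store C S R t A B (store C S R s (OMap R\<iota> t \<odot>\<^bsub>\<S>\<^esub> A) (OMap R\<iota> t \<odot>\<^bsub>\<S>\<^esub> B) X) =
    store C S R (s \<odot>\<^bsub>S\<^esub> t) A B (join_state \<S> R\<iota> s t A B X)"
    unfolding J using X *(1-4)
    by (simp add: R\<iota>_select act_R\<iota> iota_arr_Comp_cls cls_Comp_iota_arr cls_store cls_join_Assoc R.D.assoc)
next
  fix s A B X Y A' B'
  assume *: "s \<in> Obj S" "A \<in> Obj \<S>" "B \<in> Obj \<S>"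
    "X \<in> hom \<S> (OMap R\<iota> s \<odot>\<^bsub>\<S>\<^esub> A) (OMap R\<iota> s \<odot>\<^bsub>\<S>\<^esub> B)" "Y \<in> hom \<S> A' B'"
  then show "store C S R s A B X \<otimes>\<^bsub>\<S>\<^esub> Y = store C S R s (A \<odot>\<^bsub>\<S>\<^esub> A') (B \<odot>\<^bsub>\<S>\<^esub> B')
    (inv\<^bsub>\<S>\<^esub> (\<alpha>\<^bsub>\<S>\<^esub> (OMap R\<iota> s) A A') \<Zcomp>\<^bsub>\<S>\<^esub> (X \<otimes>\<^bsub>\<S>\<^esub> Y) \<Zcomp>\<^bsub>\<S>\<^esub> \<alpha>\<^bsub>\<S>\<^esub> (OMap R\<iota> s) B B')"
    unfolding R\<iota>_select by (elim St_hom_cases) (simp add: strength_cls)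
next
  fix h s t A B X
  assume *: "h \<in> hom S s t" "A \<in> Obj \<S>" "B \<in> Obj \<S>"
    "X \<in> hom \<S> (OMap R\<iota> t \<odot>\<^bsub>\<S>\<^esub> A) (OMap R\<iota> s \<odot>\<^bsub>\<S>\<^esub> B)"
  have o: "s \<in> Obj S" "t \<in> Obj S" using * by auto
  obtain r f where X: "X = cls (OMap R t \<odot> A) (OMap R s \<odot> B) r f" "r \<in> Obj S" "f \<in> Arr C"
    "Dom C f = OMap R r \<odot> (OMap R t \<odot> A)" "Cod C f = OMap R r \<odot> (OMap R s \<odot> B)"
    using *(4) unfolding R\<iota>_select by (elim St_hom_cases) auto
  \<comment> \<open>The stored state is the second component of the joint state, so the slide along
    \<open>h\<close> happens there.\<close>
  have "cls A B (r \<odot>\<^bsub>S\<^esub> s) (join r s A B (OMap R r \<rhd> (AMap R h \<lhd> A) \<Zcomp> f))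
    = cls A B (r \<odot>\<^bsub>S\<^esub> t) (join r t A B (f \<Zcomp> OMap R r \<rhd> (AMap R h \<lhd> B)))"
    using X * by (intro cls_slide_join_right) auto
  then show "store C S R t A B (X \<Zcomp>\<^bsub>\<S>\<^esub> (AMap R\<iota> h \<otimes>\<^bsub>\<S>\<^esub> \<one>\<^bsub>\<S>\<^esub> B)) =
    store C S R s A B ((AMap R\<iota> h \<otimes>\<^bsub>\<S>\<^esub> \<one>\<^bsub>\<S>\<^esub> A) \<Zcomp>\<^bsub>\<S>\<^esub> X)"
    using X * o unfolding R\<iota>_select rwhisker_def[symmetric]
    by (simp add: iota_arr_whisker iota_arr_Comp_cls cls_Comp_iota_arr cls_store)
qed

end

section \<open>Structured feedback categories\<close>

context structured_feedback_category
begin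

lemma fbk_simps [simp]:
  assumes "s \<in> Obj S" "A \<in> Obj C" "B \<in> Obj C" "f \<in> Arr C" "Dom C f = OMap R s \<odot> A" "Cod C f = OMap R s \<odot> B"
  shows "fbk s A B f \<in> Arr C" "Dom C (fbk s A B f) = A" "Cod C (fbk s A B f) = B"
  using fbk_hom[of s A B f] assms by simp_all

lemma tightening_left:
  assumes "s \<in> Obj S" "A \<in> Obj C" "B \<in> Obj C" "f \<in> Arr C" "Dom C f = OMap R s \<odot> A" "Cod C f = OMap R s \<odot> B"
    "u \<in> Arr C" "Cod C u = A" "Dom C u = A'"
  shows "u \<Zcomp> fbk s A B f = fbk s A' B (OMap R s \<rhd> u \<Zcomp> f)"
proof -
  have "A' \<in> Obj C" using assms by auto
  then show ?thesis
    using tightening[of s A B f u A' "\<one> B" B] assms unfolding lwhisker_def[symmetric] by simp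
qed

lemma tightening_right:
  assumes "s \<in> Obj S" "A \<in> Obj C" "B \<in> Obj C" "f \<in> Arr C" "Dom C f = OMap R s \<odot> A" "Cod C f = OMap R s \<odot> B"
    "v \<in> Arr C" "Dom C v = B" "Cod C v = B'"
  shows "fbk s A B f \<Zcomp> v = fbk s A B' (f \<Zcomp> OMap R s \<rhd> v)"
proof -
  have "B' \<in> Obj C" using assms by auto
  then show ?thesis
    using tightening[of s A B f "\<one> A" A v B'] assms unfolding lwhisker_def[symmetric] by simp
qed

lemma strength_right:
  assumes "s \<in> Obj S" "A \<in> Obj C" "B \<in> Obj C" "f \<in> Arr C" "Dom C f = OMap R s \<odot> A" "Cod C f = OMap R s \<odot> B"
    "D \<in> Obj C"
  shows "fbk s A B f \<lhd> D = fbk s (A \<odot> D) (B \<odot> D) (extend C (OMap R s) A B D f)"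
  using strength[of s A B f "\<one> D" D D] assms unfolding rwhisker_def[symmetric]
  by (simp add: extend_def R.D.assoc)

text \<open>The strength axiom tensors on the right. Conjugating by the symmetry and tightening
  gives the left version, and \<open>under_Symm\<close> identifies the resulting arrow.\<close>

lemma strength_left:
  assumes "s \<in> Obj S" "A \<in> Obj C" "B \<in> Obj C" "f \<in> Arr C" "Dom C f = OMap R s \<odot> A" "Cod C f = OMap R s \<odot> B"
    "D \<in> Obj C"
  shows "D \<rhd> fbk s A B f = fbk s (D \<odot> A) (D \<odot> B) (under C (OMap R s) A B D f)"
proof -
  have "D \<rhd> fbk s A B f = \<sigma> D A \<Zcomp> (\<sigma> A D \<Zcomp> D \<rhd> fbk s A B f)"
    using assms by simp
  also have "\<dots> = \<sigma> D A \<Zcomp> (fbk s A B f \<lhd> D \<Zcomp> \<sigma> B D)"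
    using assms R.D.Symm_nat_left[of "fbk s A B f" D B] by simp
  also have "\<dots> = fbk s (D \<odot> A) (D \<odot> B) (under C (OMap R s) A B D f)"
    using assms by (simp add: strength_right tightening_left tightening_right R.D.under_Symm)
  finally show ?thesis .
qed

lemma sliding_whisker:
  assumes "h \<in> Arr S" "Dom S h = s" "Cod S h = t" "A \<in> Obj C" "B \<in> Obj C"
    "f \<in> Arr C" "Dom C f = OMap R t \<odot> A" "Cod C f = OMap R s \<odot> B"
  shows "fbk s A B (AMap R h \<lhd> A \<Zcomp> f) = fbk t A B (f \<Zcomp> AMap R h \<lhd> B)"
  using sliding[of h s t A B f] assms by (simp add: rwhisker_def)

text \<open>Splitting off \<open>inv (AMap R h \<lhd> B)\<close> gives an arrow to slide, so
  feedback does not see conjugation by an isomorphism of states. This absorbs the structure maps of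
  \<open>G\<close> in the next lemma.\<close>

lemma sliding_iso:
  assumes "is_iso S h" "Dom S h = s" "Cod S h = t" "A \<in> Obj C" "B \<in> Obj C"
    "f \<in> Arr C" "Dom C f = OMap R t \<odot> A" "Cod C f = OMap R t \<odot> B"
  shows "fbk s A B (AMap R h \<lhd> A \<Zcomp> (f \<Zcomp> inv (AMap R h \<lhd> B))) = fbk t A B f"
  using sliding_whisker[of h s t A B "f \<Zcomp> inv (AMap R h \<lhd> B)"] assms
  by (auto simp: R.C.iso_Arr R.D.assoc)

end

text \<open>Vanishing and joining involve the structure maps of the functor. For the composite they
  contain \<open>Eps G\<close> and \<open>Mu G\<close>, which are isomorphisms of states in
  \<open>S'\<close> and disappear by \<open>sliding_iso\<close>; the other axioms are instances of
  those for \<open>R\<close>.\<close>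

lemma structured_feedback_category_pullback:
  assumes "structured_feedback_category C S' R fbk" "symmetric_monoidal_functor S S' G"
  shows "structured_feedback_category C S (mf_comp C G R) (\<lambda>s. fbk (OMap G s))"
proof -
  interpret R: structured_feedback_category C S' R fbk by fact
  interpret G: symmetric_monoidal_functor S S' G by fact
  let ?K = "mf_comp C G R"
  interpret K: symmetric_monoidal_functor S C ?K
    using assms(2) R.R.symmetric_monoidal_functor_axioms by (rule symmetric_monoidal_functor_mf_comp)
  have sel [simp]: "OMap ?K s = OMap R (OMap G s)" "AMap ?K h = AMap R (AMap G h)" for s h
    by (simp_all add: mf_comp_def)
  have u: "act_unit C ?K A = AMap R (inv\<^bsub>S'\<^esub> (Eps G)) \<lhd>\<^bsub>C\<^esub> A \<Zcomp>\<^bsub>C\<^esub> act_unit C R A" if "A \<in> Obj C" for A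
    using that by (simp add: act_unit_def mf_comp_def R.R.D.assoc)
  have a: "act C ?K s t A = AMap R (inv\<^bsub>S'\<^esub> (Mu G s t)) \<lhd>\<^bsub>C\<^esub> A \<Zcomp>\<^bsub>C\<^esub> act C R (OMap G s) (OMap G t) A"
    if "s \<in> Obj S" "t \<in> Obj S" "A \<in> Obj C" for s t A
    using that by (simp add: act_def mf_comp_def R.R.D.assoc)
  show ?thesis
  proof
    fix s A B f assume "s \<in> Obj S" "A \<in> Obj C" "B \<in> Obj C"
      "f \<in> hom C (OMap ?K s \<odot>\<^bsub>C\<^esub> A) (OMap ?K s \<odot>\<^bsub>C\<^esub> B)"
    then show "fbk (OMap G s) A B f \<in> hom C A B"
      by (intro R.fbk_hom) auto
  next
    fix s A B f u A' v B' assume "s \<in> Obj S" "A \<in> Obj C" "B \<in> Obj C"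
      "f \<in> hom C (OMap ?K s \<odot>\<^bsub>C\<^esub> A) (OMap ?K s \<odot>\<^bsub>C\<^esub> B)" "u \<in> hom C A' A" "v \<in> hom C B B'"
    then show "u \<Zcomp>\<^bsub>C\<^esub> fbk (OMap G s) A B f \<Zcomp>\<^bsub>C\<^esub> v = fbk (OMap G s) A' B'
        ((\<one>\<^bsub>C\<^esub> (OMap ?K s) \<otimes>\<^bsub>C\<^esub> u) \<Zcomp>\<^bsub>C\<^esub> f \<Zcomp>\<^bsub>C\<^esub> (\<one>\<^bsub>C\<^esub> (OMap ?K s) \<otimes>\<^bsub>C\<^esub> v))"
      unfolding sel by (intro R.tightening) auto
  next
    fix f A B assume f: "f \<in> hom C A B"
    then have o [simp]: "A \<in> Obj C" "B \<in> Obj C" by auto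
    let ?h = "AMap R (inv\<^bsub>S'\<^esub> (Eps G))"
    have "fbk (OMap G \<I>\<^bsub>S\<^esub>) A B (unit_state C ?K A B f) = fbk (OMap G \<I>\<^bsub>S\<^esub>) A B
      (?h \<lhd>\<^bsub>C\<^esub> A \<Zcomp>\<^bsub>C\<^esub> (unit_state C R A B f \<Zcomp>\<^bsub>C\<^esub> inv\<^bsub>C\<^esub> (?h \<lhd>\<^bsub>C\<^esub> B)))"
      using f by (simp add: K.unit_state_act R.R.unit_state_act u R.R.D.assoc)
    also have "\<dots> = fbk \<I>\<^bsub>S'\<^esub> A B (unit_state C R A B f)"
      using f by (intro R.sliding_iso) (simp_all add: R.R.unit_state_act)
    also have "\<dots> = f" using f by (rule R.vanishing)
    finally show "fbk (OMap G \<I>\<^bsub>S\<^esub>) A B (unit_state C ?K A B f) = f" .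
  next
    fix s t A B f
    assume o: "s \<in> Obj S" "t \<in> Obj S" "A \<in> Obj C" "B \<in> Obj C" and
      f: "f \<in> hom C (OMap ?K s \<odot>\<^bsub>C\<^esub> (OMap ?K t \<odot>\<^bsub>C\<^esub> A)) (OMap ?K s \<odot>\<^bsub>C\<^esub> (OMap ?K t \<odot>\<^bsub>C\<^esub> B))"
    let ?h = "AMap R (inv\<^bsub>S'\<^esub> (Mu G s t))"
    have "fbk (OMap G t) A B (fbk (OMap G s) (OMap R (OMap G t) \<odot>\<^bsub>C\<^esub> A) (OMap R (OMap G t) \<odot>\<^bsub>C\<^esub> B) f) =
      fbk (OMap G s \<odot>\<^bsub>S'\<^esub> OMap G t) A B (join_state C R (OMap G s) (OMap G t) A B f)"
      using o f by (intro R.joining) auto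
    also have "\<dots> = fbk (OMap G (s \<odot>\<^bsub>S\<^esub> t)) A B
      (?h \<lhd>\<^bsub>C\<^esub> A \<Zcomp>\<^bsub>C\<^esub> (join_state C R (OMap G s) (OMap G t) A B f \<Zcomp>\<^bsub>C\<^esub> inv\<^bsub>C\<^esub> (?h \<lhd>\<^bsub>C\<^esub> B)))"
      using o f by (intro R.sliding_iso[symmetric]) (simp_all add: R.R.join_state_act)
    also have "\<dots> = fbk (OMap G (s \<odot>\<^bsub>S\<^esub> t)) A B (join_state C ?K s t A B f)"
      using o f by (simp add: K.join_state_act R.R.join_state_act a R.R.D.assoc)
    finally show "fbk (OMap G t) A B (fbk (OMap G s) (OMap ?K t \<odot>\<^bsub>C\<^esub> A) (OMap ?K t \<odot>\<^bsub>C\<^esub> B) f) =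
      fbk (OMap G (s \<odot>\<^bsub>S\<^esub> t)) A B (join_state C ?K s t A B f)"
      by simp
  next
    fix s A B f g A' B' assume "s \<in> Obj S" "A \<in> Obj C" "B \<in> Obj C"
      "f \<in> hom C (OMap ?K s \<odot>\<^bsub>C\<^esub> A) (OMap ?K s \<odot>\<^bsub>C\<^esub> B)" "g \<in> hom C A' B'"
    then show "fbk (OMap G s) A B f \<otimes>\<^bsub>C\<^esub> g = fbk (OMap G s) (A \<odot>\<^bsub>C\<^esub> A') (B \<odot>\<^bsub>C\<^esub> B')
      (inv\<^bsub>C\<^esub> (\<alpha>\<^bsub>C\<^esub> (OMap ?K s) A A') \<Zcomp>\<^bsub>C\<^esub> (f \<otimes>\<^bsub>C\<^esub> g) \<Zcomp>\<^bsub>C\<^esub> \<alpha>\<^bsub>C\<^esub> (OMap ?K s) B B')"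
      unfolding sel by (intro R.strength) auto
  next
    fix h s t A B f assume "h \<in> hom S s t" "A \<in> Obj C" "B \<in> Obj C"
      "f \<in> hom C (OMap ?K t \<odot>\<^bsub>C\<^esub> A) (OMap ?K s \<odot>\<^bsub>C\<^esub> B)"
    then show "fbk (OMap G t) A B (f \<Zcomp>\<^bsub>C\<^esub> (AMap ?K h \<otimes>\<^bsub>C\<^esub> \<one>\<^bsub>C\<^esub> B)) =
      fbk (OMap G s) A B ((AMap ?K h \<otimes>\<^bsub>C\<^esub> \<one>\<^bsub>C\<^esub> A) \<Zcomp>\<^bsub>C\<^esub> f)"
      unfolding sel by (intro R.sliding) auto
  qed
qed

text \<open>\<open>mf_eq\<close> compares values on carriers only, so the functors cannot simply be
  identified; in every axiom, however, they are applied to objects and arrows of \<open>S\<close>,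
  where they agree. This carries the feedback from \<open>G ; R'\<close> over to
  \<open>R ; F\<close>.\<close>

lemma structured_feedback_category_mf_eq:
  assumes "structured_feedback_category C S R fbk" "symmetric_monoidal_functor S C R'" "mf_eq S R R'"
  shows "structured_feedback_category C S R' fbk"
proof -
  interpret R: structured_feedback_category C S R fbk by fact
  interpret R': symmetric_monoidal_functor S C R' by fact
  have o: "OMap R s = OMap R' s" if "s \<in> Obj S" for s using assms(3) that by (simp add: mf_eq_def)
  have a: "AMap R h = AMap R' h" if "h \<in> Arr S" for h using assms(3) that by (simp add: mf_eq_def)
  have e: "Eps R = Eps R'" using assms(3) by (simp add: mf_eq_def)
  have m: "Mu R s t = Mu R' s t" if "s \<in> Obj S" "t \<in> Obj S" for s t
    using assms(3) that by (simp add: mf_eq_def)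
  show ?thesis
  proof
    fix s A B f
    show "fbk s A B f \<in> hom C A B" if "s \<in> Obj S" "A \<in> Obj C" "B \<in> Obj C"
      "f \<in> hom C (OMap R' s \<odot>\<^bsub>C\<^esub> A) (OMap R' s \<odot>\<^bsub>C\<^esub> B)"
      using that by (intro R.fbk_hom) (auto simp: o)
    show "fbk \<I>\<^bsub>S\<^esub> A B (unit_state C R' A B f) = f" if "f \<in> hom C A B"
      using R.vanishing[OF that] unfolding unit_state_def e .
  next
    fix s A B f u A' v B'
    show "u \<Zcomp>\<^bsub>C\<^esub> fbk s A B f \<Zcomp>\<^bsub>C\<^esub> v = fbk s A' B'
        ((\<one>\<^bsub>C\<^esub> (OMap R' s) \<otimes>\<^bsub>C\<^esub> u) \<Zcomp>\<^bsub>C\<^esub> f \<Zcomp>\<^bsub>C\<^esub> (\<one>\<^bsub>C\<^esub> (OMap R' s) \<otimes>\<^bsub>C\<^esub> v))"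
      if "s \<in> Obj S" "A \<in> Obj C" "B \<in> Obj C" "f \<in> hom C (OMap R' s \<odot>\<^bsub>C\<^esub> A) (OMap R' s \<odot>\<^bsub>C\<^esub> B)"
        "u \<in> hom C A' A" "v \<in> hom C B B'"
      using that R.tightening[of s A B f u A' v B'] by (simp add: o)
    show "fbk s A B f \<otimes>\<^bsub>C\<^esub> v = fbk s (A \<odot>\<^bsub>C\<^esub> A') (B \<odot>\<^bsub>C\<^esub> B')
      (inv\<^bsub>C\<^esub> (\<alpha>\<^bsub>C\<^esub> (OMap R' s) A A') \<Zcomp>\<^bsub>C\<^esub> (f \<otimes>\<^bsub>C\<^esub> v) \<Zcomp>\<^bsub>C\<^esub> \<alpha>\<^bsub>C\<^esub> (OMap R' s) B B')"
      if "s \<in> Obj S" "A \<in> Obj C" "B \<in> Obj C" "f \<in> hom C (OMap R' s \<odot>\<^bsub>C\<^esub> A) (OMap R' s \<odot>\<^bsub>C\<^esub> B)"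
        "v \<in> hom C A' B'"
      using that R.strength[of s A B f v A' B'] by (simp add: o)
  next
    fix s t A B f
    show "fbk t A B (fbk s (OMap R' t \<odot>\<^bsub>C\<^esub> A) (OMap R' t \<odot>\<^bsub>C\<^esub> B) f) =
      fbk (s \<odot>\<^bsub>S\<^esub> t) A B (join_state C R' s t A B f)"
      if "s \<in> Obj S" "t \<in> Obj S" "A \<in> Obj C" "B \<in> Obj C"
        "f \<in> hom C (OMap R' s \<odot>\<^bsub>C\<^esub> (OMap R' t \<odot>\<^bsub>C\<^esub> A)) (OMap R' s \<odot>\<^bsub>C\<^esub> (OMap R' t \<odot>\<^bsub>C\<^esub> B))"
      using that R.joining[of s t A B f] by (simp add: o m join_state_def)
  next
    fix h s t A B f
    show "fbk t A B (f \<Zcomp>\<^bsub>C\<^esub> (AMap R' h \<otimes>\<^bsub>C\<^esub> \<one>\<^bsub>C\<^esub> B)) = fbk s A B ((AMap R' h \<otimes>\<^bsub>C\<^esub> \<one>\<^bsub>C\<^esub> A) \<Zcomp>\<^bsub>C\<^esub> f)"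
      if h: "h \<in> hom S s t" "A \<in> Obj C" "B \<in> Obj C" "f \<in> hom C (OMap R' t \<odot>\<^bsub>C\<^esub> A) (OMap R' s \<odot>\<^bsub>C\<^esub> B)"
    proof -
      have "s \<in> Obj S" "t \<in> Obj S" using h(1) by auto
      then show ?thesis using h R.sliding[of h s t A B f] by (simp add: o a)
    qed
  qed
qed

text \<open>The argument of \<open>fbk'\<close> in \<open>preserves_fbk\<close>, bracketed to the
  right.\<close>

definition conj_Mu :: "('p, 'b) smc \<Rightarrow> ('o, 'a, 'p, 'b) mfunctor \<Rightarrow> 'o \<Rightarrow> 'o \<Rightarrow> 'o \<Rightarrow> 'a \<Rightarrow> 'b" where
  "conj_Mu D F X A B f = Mu F X A \<Zcomp>\<^bsub>D\<^esub> (AMap F f \<Zcomp>\<^bsub>D\<^esub> inv\<^bsub>D\<^esub> (Mu F X B))"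

context symmetric_monoidal_functor
begin

section \<open>Conjugation by the structure maps of a monoidal functor\<close>

lemma conj_Mu_simps [simp]:
  assumes "f \<in> Arr C" "Dom C f = X \<odot>\<^bsub>C\<^esub> A" "Cod C f = X \<odot>\<^bsub>C\<^esub> B" "X \<in> Obj C" "A \<in> Obj C" "B \<in> Obj C"
  shows "conj_Mu D F X A B f \<in> Arr D" "Dom D (conj_Mu D F X A B f) = OMap F X \<odot> OMap F A"
    "Cod D (conj_Mu D F X A B f) = OMap F X \<odot> OMap F B"
  using assms by (simp_all add: conj_Mu_def)

lemma conj_Mu_Comp:
  assumes "f \<in> Arr C" "Dom C f = X \<odot>\<^bsub>C\<^esub> A" "Cod C f = X \<odot>\<^bsub>C\<^esub> B"
    "g \<in> Arr C" "Dom C g = X \<odot>\<^bsub>C\<^esub> B" "Cod C g = X \<odot>\<^bsub>C\<^esub> E"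
    "X \<in> Obj C" "A \<in> Obj C" "B \<in> Obj C" "E \<in> Obj C"
  shows "conj_Mu D F X A E (f \<Zcomp>\<^bsub>C\<^esub> g) = conj_Mu D F X A B f \<Zcomp> conj_Mu D F X B E g"
  using assms by (simp add: conj_Mu_def D.assoc)

lemma conj_Mu_lwhisker:
  assumes "f \<in> Arr C" "Dom C f = A" "Cod C f = B" "X \<in> Obj C"
  shows "conj_Mu D F X A B (X \<rhd>\<^bsub>C\<^esub> f) = OMap F X \<rhd> AMap F f"
proof -
  have o: "A \<in> Obj C" "B \<in> Obj C" using assms by auto
  have "Mu F X A \<Zcomp> AMap F (X \<rhd>\<^bsub>C\<^esub> f) = OMap F X \<rhd> AMap F f \<Zcomp> Mu F X B"
    using assms Mu_nat_right[of f X B] by simp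
  from this[THEN D.Comp_eq_assoc] show ?thesis
    using assms o by (simp add: conj_Mu_def D.assoc)
qed

lemma AMap_swap:
  assumes "X \<in> Obj C" "Y \<in> Obj C" "A \<in> Obj C"
  shows "OMap F X \<rhd> Mu F Y A \<Zcomp> (Mu F X (Y \<odot>\<^bsub>C\<^esub> A) \<Zcomp> AMap F (\<omega>\<^bsub>C\<^esub> X Y A)) =
    \<omega> (OMap F X) (OMap F Y) (OMap F A) \<Zcomp> (OMap F Y \<rhd> Mu F X A \<Zcomp> Mu F Y (X \<odot>\<^bsub>C\<^esub> A))"
proof -
  have E: "AMap F (\<sigma>\<^bsub>C\<^esub> X Y) = inv (Mu F X Y) \<Zcomp> (\<sigma> (OMap F X) (OMap F Y) \<Zcomp> Mu F Y X)"
    using assms by (simp flip: Mu_Symm)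
  show ?thesis
    using assms unfolding swap_def by (simp add: AMap_Assoc AMap_rwhisker E D.assoc)
qed

text \<open>A symmetric monoidal functor preserves the swaps (\<open>AMap_swap\<close>), hence also
  the operation built from them; \<open>Mu\<close> is natural with respect to the arrow in
  between.\<close>

lemma conj_Mu_under:
  assumes "f \<in> Arr C" "Dom C f = X \<odot>\<^bsub>C\<^esub> A" "Cod C f = X \<odot>\<^bsub>C\<^esub> B"
    and [simp]: "X \<in> Obj C" "A \<in> Obj C" "B \<in> Obj C" "Y \<in> Obj C"
  shows "OMap F X \<rhd> Mu F Y A \<Zcomp> conj_Mu D F X (Y \<odot>\<^bsub>C\<^esub> A) (Y \<odot>\<^bsub>C\<^esub> B) (under C X A B Y f) =
    under D (OMap F X) (OMap F A) (OMap F B) (OMap F Y) (conj_Mu D F X A B f) \<Zcomp> OMap F X \<rhd> Mu F Y B"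
proof -
  note E1 = AMap_swap[of X Y A, THEN D.Comp_eq_assoc3]
  have E2: "Mu F Y (X \<odot>\<^bsub>C\<^esub> A) \<Zcomp> AMap F (Y \<rhd>\<^bsub>C\<^esub> f) = OMap F Y \<rhd> AMap F f \<Zcomp> Mu F Y (X \<odot>\<^bsub>C\<^esub> B)"
    using assms Mu_nat_right[of f Y "X \<odot>\<^bsub>C\<^esub> B"] by simp
  have "AMap F (\<omega>\<^bsub>C\<^esub> Y X B) = inv (Mu F Y (X \<odot>\<^bsub>C\<^esub> B)) \<Zcomp> (inv (OMap F Y \<rhd> Mu F X B) \<Zcomp>
    (\<omega> (OMap F Y) (OMap F X) (OMap F B) \<Zcomp> (OMap F X \<rhd> Mu F Y B \<Zcomp> Mu F X (Y \<odot>\<^bsub>C\<^esub> B))))"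
    by (simp flip: AMap_swap)
  then have E4: "Mu F Y (X \<odot>\<^bsub>C\<^esub> B) \<Zcomp> (AMap F (\<omega>\<^bsub>C\<^esub> Y X B) \<Zcomp> inv (Mu F X (Y \<odot>\<^bsub>C\<^esub> B))) =
     inv (OMap F Y \<rhd> Mu F X B) \<Zcomp> (\<omega> (OMap F Y) (OMap F X) (OMap F B) \<Zcomp> OMap F X \<rhd> Mu F Y B)"
    by (simp add: D.assoc)
  show ?thesis
    using assms by (simp add: conj_Mu_def under_def D.assoc E1 E2[THEN D.Comp_eq_assoc] E4)
qed

lemma conj_Mu_extend:
  assumes "f \<in> Arr C" "Dom C f = X \<odot>\<^bsub>C\<^esub> A" "Cod C f = X \<odot>\<^bsub>C\<^esub> B"
    and [simp]: "X \<in> Obj C" "A \<in> Obj C" "B \<in> Obj C" "E \<in> Obj C"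
  shows "OMap F X \<rhd> Mu F A E \<Zcomp> conj_Mu D F X (A \<odot>\<^bsub>C\<^esub> E) (B \<odot>\<^bsub>C\<^esub> E) (extend C X A B E f) =
    extend D (OMap F X) (OMap F A) (OMap F B) (OMap F E) (conj_Mu D F X A B f) \<Zcomp> OMap F X \<rhd> Mu F B E"
  using assms by (simp add: conj_Mu_def extend_def AMap_Assoc AMap_rwhisker D.assoc)

end

section \<open>The universal property\<close>

text \<open>The feedback of \<open>C'\<close> is indexed by \<open>S\<close> through
  \<open>R ; F\<close>, so neither \<open>S'\<close> nor \<open>G\<close> appears in the
  construction of the extension.\<close>

locale stateful_extension = stateful_processes C S R +
  F: symmetric_monoidal_functor C C' F +
  K: structured_feedback_category C' S "mf_comp C' R F" fbk
  for C :: "('o, 'a) smc" (structure)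
    and S :: "('s, 'h) smc"
    and R :: "('s, 'h, 'o, 'a) mfunctor"
    and C' :: "('p, 'b) smc"
    and F :: "('o, 'a, 'p, 'b) mfunctor"
    and fbk :: "'s \<Rightarrow> 'p \<Rightarrow> 'p \<Rightarrow> 'b \<Rightarrow> 'b"
begin

abbreviation K where "K \<equiv> mf_comp C' R F"

lemma OMap_K [simp]: "OMap K s = OMap F (OMap R s)"
  and AMap_K [simp]: "AMap K h = AMap F (AMap R h)"
  by (simp_all add: mf_comp_def)

section \<open>Compatibility of F with the actions on C and C'\<close>

lemma AMap_act:
  assumes "s \<in> Obj S" "t \<in> Obj S" "A \<in> Obj C"
  shows "Mu F (OMap R (s \<odot>\<^bsub>S\<^esub> t)) A \<Zcomp>\<^bsub>C'\<^esub> AMap F (act C R s t A) = act C' K s t (OMap F A) \<Zcomp>\<^bsub>C'\<^esub>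
    (OMap F (OMap R s) \<rhd>\<^bsub>C'\<^esub> Mu F (OMap R t) A \<Zcomp>\<^bsub>C'\<^esub> Mu F (OMap R s) (OMap R t \<odot> A))"
  using assms by (simp add: act_def mf_comp_def F.AMap_Assoc F.AMap_rwhisker F.D.assoc
    del: R.D.is_iso_whisker(3,4))

lemma AMap_act_unit:
  assumes "A \<in> Obj C"
  shows "Mu F (OMap R \<I>\<^bsub>S\<^esub>) A \<Zcomp>\<^bsub>C'\<^esub> AMap F (act_unit C R A) = act_unit C' K (OMap F A)"
proof -
  have "AMap F (\<lambda>_ A) = inv\<^bsub>C'\<^esub> (Mu F \<I> A) \<Zcomp>\<^bsub>C'\<^esub> (inv\<^bsub>C'\<^esub> (Eps F \<lhd>\<^bsub>C'\<^esub> OMap F A) \<Zcomp>\<^bsub>C'\<^esub> \<lambda>\<^bsub>C'\<^esub>_ (OMap F A))"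
    using assms by (simp flip: F.Mu_LUnitor_whisker)
  then show ?thesis
    using assms by (simp add: act_unit_def mf_comp_def F.AMap_rwhisker F.D.assoc
      del: R.D.is_iso_whisker(3,4))
qed

lemma conj_Mu_join:
  assumes "s \<in> Obj S" "t \<in> Obj S" "A \<in> Obj C" "B \<in> Obj C"
    "f \<in> Arr C" "Dom C f = OMap R s \<odot> (OMap R t \<odot> A)" "Cod C f = OMap R s \<odot> (OMap R t \<odot> B)"
  shows "conj_Mu C' F (OMap R (s \<odot>\<^bsub>S\<^esub> t)) A B (join s t A B f) = join_state C' K s t (OMap F A) (OMap F B)
    (OMap F (OMap R s) \<rhd>\<^bsub>C'\<^esub> Mu F (OMap R t) A \<Zcomp>\<^bsub>C'\<^esub>
      (conj_Mu C' F (OMap R s) (OMap R t \<odot> A) (OMap R t \<odot> B) f \<Zcomp>\<^bsub>C'\<^esub>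
       inv\<^bsub>C'\<^esub> (OMap F (OMap R s) \<rhd>\<^bsub>C'\<^esub> Mu F (OMap R t) B)))"
proof -
  have E: "AMap F (act C R s t A) = inv\<^bsub>C'\<^esub> (Mu F (OMap R (s \<odot>\<^bsub>S\<^esub> t)) A) \<Zcomp>\<^bsub>C'\<^esub> (act C' K s t (OMap F A) \<Zcomp>\<^bsub>C'\<^esub>
    (OMap F (OMap R s) \<rhd>\<^bsub>C'\<^esub> Mu F (OMap R t) A \<Zcomp>\<^bsub>C'\<^esub> Mu F (OMap R s) (OMap R t \<odot> A)))"
    if "A \<in> Obj C" for A
    using assms that by (simp flip: AMap_act)
  show ?thesis
    using assms by (simp add: R.join_state_act K.R.join_state_act conj_Mu_def E F.D.assoc)
qed

text \<open>The choice of a representative is harmless: by the sliding axiom of \<open>C'\<close>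
  all of them give the same value, which is the content of \<open>ext_cls\<close>.\<close>

definition ext_arr :: "'o \<times> 'o \<times> ('s \<times> 'a) set \<Rightarrow> 'b" where
  "ext_arr = (\<lambda>(A, B, P). case (SOME p. p \<in> P) of (s, f) \<Rightarrow>
     fbk s (OMap F A) (OMap F B) (conj_Mu C' F (OMap R s) A B f))"

text \<open>As \<iota> is strict and the identity on objects, \<open>\<iota> ; ext = F\<close>
  forces the object map on objects of \<open>C\<close> and the structure maps to be those of
  \<open>F\<close>.\<close>

definition ext :: "('o, 'o \<times> 'o \<times> ('s \<times> 'a) set, 'p, 'b) mfunctor" where
  "ext = \<lparr>OMap = OMap F, AMap = ext_arr, Eps = Eps F, Mu = Mu F\<rparr>"

lemma ext_select [simp]: "OMap ext = OMap F" "AMap ext = ext_arr" "Eps ext = Eps F" "Mu ext = Mu F"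
  by (simp_all add: ext_def)

lemma ext_cls:
  assumes "(s, f) \<in> proc A B" "A \<in> Obj C" "B \<in> Obj C"
  shows "ext_arr (cls A B s f) = fbk s (OMap F A) (OMap F B) (conj_Mu C' F (OMap R s) A B f)"
proof -
  let ?\<phi> = "\<lambda>(s, f). fbk s (OMap F A) (OMap F B) (conj_Mu C' F (OMap R s) A B f)"
  let ?p = "SOME p. p \<in> process_rel C S R A B `` {(s, f)}"
  have "?p \<in> process_rel C S R A B `` {(s, f)}"
    using equiv_class_self[OF equiv_process_rel assms(1)] by (rule someI)
  then have "((s, f), ?p) \<in> process_rel C S R A B" by auto
  then have "?\<phi> (s, f) = ?\<phi> ?p"
  proof (rule process_rel_induct)
    fix x y h l
    assume *: "h \<in> Arr S" "Dom S h = x" "Cod S h = y" "l \<in> Arr C"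
      "Dom C l = OMap R y \<odot> A" "Cod C l = OMap R x \<odot> B"
    then have [simp]: "x \<in> Obj S" "y \<in> Obj S" by auto
    \<comment> \<open>The image of the middle arrow of the slide, with \<open>Mu\<close> taken at
      \<open>R y\<close> before and at \<open>R x\<close> after; \<open>conj_Mu\<close> would use
      the same object at both ends.\<close>
    let ?l = "Mu F (OMap R y) A \<Zcomp>\<^bsub>C'\<^esub> (AMap F l \<Zcomp>\<^bsub>C'\<^esub> inv\<^bsub>C'\<^esub> (Mu F (OMap R x) B))"
    have "fbk x (OMap F A) (OMap F B) (AMap K h \<lhd>\<^bsub>C'\<^esub> OMap F A \<Zcomp>\<^bsub>C'\<^esub> ?l)
      = fbk y (OMap F A) (OMap F B) (?l \<Zcomp>\<^bsub>C'\<^esub> AMap K h \<lhd>\<^bsub>C'\<^esub> OMap F B)"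
      using * assms by (intro K.sliding_whisker) simp_all
    then show "?\<phi> (x, AMap R h \<lhd> A \<Zcomp> l) = ?\<phi> (y, l \<Zcomp> AMap R h \<lhd> B)"
      using * assms by (simp add: conj_Mu_def F.AMap_rwhisker F.D.assoc)
  qed (use assms in auto)
  then show ?thesis
    by (simp add: ext_arr_def St_class_def)
qed

lemma ext_simps [simp]:
  assumes "X \<in> Arr \<S>"
  shows "ext_arr X \<in> Arr C'" "Dom C' (ext_arr X) = OMap F (Dom \<S> X)" "Cod C' (ext_arr X) = OMap F (Cod \<S> X)"
proof -
  obtain A B s f where X: "X = cls A B s f" "(s, f) \<in> proc A B" and o: "A \<in> Obj C" "B \<in> Obj C"
    using assms by (elim St_Arr_cases) auto
  show "ext_arr X \<in> Arr C'" "Dom C' (ext_arr X) = OMap F (Dom \<S> X)" "Cod C' (ext_arr X) = OMap F (Cod \<S> X)"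
    using X o by (simp_all add: ext_cls)
qed

text \<open>\<open>conj_Mu\<close> takes the unit state for \<open>R\<close> to the unit state for
  \<open>R ; F\<close>, and the vanishing axiom removes it.\<close>

lemma ext_iota_arr:
  assumes "u \<in> Arr C"
  shows "ext_arr (iota_arr C S R u) = AMap F u"
proof -
  let ?A = "Dom C u" and ?B = "Cod C u"
  have E: "AMap F (act_unit C R A) = inv\<^bsub>C'\<^esub> (Mu F (OMap R \<I>\<^bsub>S\<^esub>) A) \<Zcomp>\<^bsub>C'\<^esub> act_unit C' K (OMap F A)"
    if "A \<in> Obj C" for A
    using that by (simp flip: AMap_act_unit)
  have "conj_Mu C' F (OMap R \<I>\<^bsub>S\<^esub>) ?A ?B (unit_state C R ?A ?B u) = unit_state C' K (OMap F ?A) (OMap F ?B) (AMap F u)"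
    using assms by (simp add: R.unit_state_act K.R.unit_state_act conj_Mu_def E F.D.assoc)
  then show ?thesis
    using assms K.vanishing[of "AMap F u" "OMap F ?A" "OMap F ?B"]
    by (simp add: iota_arr_cls ext_cls)
qed

lemma ext_join:
  assumes "s \<in> Obj S" "t \<in> Obj S" "A \<in> Obj C" "B \<in> Obj C"
    "f \<in> Arr C" "Dom C f = OMap R s \<odot> (OMap R t \<odot> A)" "Cod C f = OMap R s \<odot> (OMap R t \<odot> B)"
  shows "ext_arr (cls A B (s \<odot>\<^bsub>S\<^esub> t) (join s t A B f)) = fbk t (OMap F A) (OMap F B)
    (fbk s (OMap F (OMap R t) \<odot>\<^bsub>C'\<^esub> OMap F A) (OMap F (OMap R t) \<odot>\<^bsub>C'\<^esub> OMap F B)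
      (OMap F (OMap R s) \<rhd>\<^bsub>C'\<^esub> Mu F (OMap R t) A \<Zcomp>\<^bsub>C'\<^esub>
      (conj_Mu C' F (OMap R s) (OMap R t \<odot> A) (OMap R t \<odot> B) f \<Zcomp>\<^bsub>C'\<^esub>
       inv\<^bsub>C'\<^esub> (OMap F (OMap R s) \<rhd>\<^bsub>C'\<^esub> Mu F (OMap R t) B))))"
proof -
  let ?f = "OMap F (OMap R s) \<rhd>\<^bsub>C'\<^esub> Mu F (OMap R t) A \<Zcomp>\<^bsub>C'\<^esub>
      (conj_Mu C' F (OMap R s) (OMap R t \<odot> A) (OMap R t \<odot> B) f \<Zcomp>\<^bsub>C'\<^esub>
       inv\<^bsub>C'\<^esub> (OMap F (OMap R s) \<rhd>\<^bsub>C'\<^esub> Mu F (OMap R t) B))"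
  have "fbk t (OMap F A) (OMap F B) (fbk s (OMap K t \<odot>\<^bsub>C'\<^esub> OMap F A) (OMap K t \<odot>\<^bsub>C'\<^esub> OMap F B) ?f)
    = fbk (s \<odot>\<^bsub>S\<^esub> t) (OMap F A) (OMap F B) (join_state C' K s t (OMap F A) (OMap F B) ?f)"
    using assms by (intro K.joining) simp_all
  then show ?thesis
    using assms by (simp add: ext_cls conj_Mu_join)
qed

text \<open>Joining splits the feedback over \<open>s \<odot> t\<close> into nested ones. Tightening
  takes \<open>?g\<close> out of the inner loop, strength takes the inner loop past
  \<open>R t\<close>, and tightening takes it out of the outer loop.\<close>

lemma ext_Comp_cls:
  assumes f: "(s, f) \<in> proc A B" and g: "(t, g) \<in> proc B D"
    and [simp]: "A \<in> Obj C" "B \<in> Obj C" "D \<in> Obj C"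
  shows "ext_arr (cls A B s f \<Zcomp>\<^bsub>\<S>\<^esub> cls B D t g) = ext_arr (cls A B s f) \<Zcomp>\<^bsub>C'\<^esub> ext_arr (cls B D t g)"
proof -
  let ?s = "OMap R s" and ?t = "OMap R t"
  let ?f = "conj_Mu C' F ?s A B f" and ?g = "conj_Mu C' F ?t B D g"
  have o [simp]: "s \<in> Obj S" "t \<in> Obj S" using f g by auto
  have E1: "conj_Mu C' F ?s (?t \<odot> A) (?t \<odot> D) (under C ?s A B ?t f \<Zcomp> ?s \<rhd> g) =
    conj_Mu C' F ?s (?t \<odot> A) (?t \<odot> B) (under C ?s A B ?t f) \<Zcomp>\<^bsub>C'\<^esub> OMap F ?s \<rhd>\<^bsub>C'\<^esub> AMap F g"
    using f g by (simp add: F.conj_Mu_Comp F.conj_Mu_lwhisker)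
  have E2: "OMap F ?s \<rhd>\<^bsub>C'\<^esub> Mu F ?t A \<Zcomp>\<^bsub>C'\<^esub> conj_Mu C' F ?s (?t \<odot> A) (?t \<odot> B) (under C ?s A B ?t f) =
    under C' (OMap F ?s) (OMap F A) (OMap F B) (OMap F ?t) ?f \<Zcomp>\<^bsub>C'\<^esub> OMap F ?s \<rhd>\<^bsub>C'\<^esub> Mu F ?t B"
    using f by (intro F.conj_Mu_under) simp_all
  have E3: "OMap F ?s \<rhd>\<^bsub>C'\<^esub> Mu F ?t B \<Zcomp>\<^bsub>C'\<^esub> (OMap F ?s \<rhd>\<^bsub>C'\<^esub> AMap F g \<Zcomp>\<^bsub>C'\<^esub> inv\<^bsub>C'\<^esub> (OMap F ?s \<rhd>\<^bsub>C'\<^esub> Mu F ?t D))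
    = OMap F ?s \<rhd>\<^bsub>C'\<^esub> ?g"
    using g by (simp add: conj_Mu_def)
  have "ext_arr (cls A B s f \<Zcomp>\<^bsub>\<S>\<^esub> cls B D t g) = fbk t (OMap F A) (OMap F D)
    (fbk s (OMap F ?t \<odot>\<^bsub>C'\<^esub> OMap F A) (OMap F ?t \<odot>\<^bsub>C'\<^esub> OMap F D)
      (under C' (OMap F ?s) (OMap F A) (OMap F B) (OMap F ?t) ?f \<Zcomp>\<^bsub>C'\<^esub> OMap F ?s \<rhd>\<^bsub>C'\<^esub> ?g))"
    using f g by (simp add: cls_Comp ext_join E1 F.D.assoc E2[THEN F.D.Comp_eq_assoc] E3)
  also have "\<dots> = fbk t (OMap F A) (OMap F D) (OMap F ?t \<rhd>\<^bsub>C'\<^esub> fbk s (OMap F A) (OMap F B) ?f \<Zcomp>\<^bsub>C'\<^esub> ?g)"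
    using f g by (simp add: K.strength_left K.tightening_right)
  also have "\<dots> = fbk s (OMap F A) (OMap F B) ?f \<Zcomp>\<^bsub>C'\<^esub> fbk t (OMap F B) (OMap F D) ?g"
    using f g by (simp add: K.tightening_left)
  finally show ?thesis using f g by (simp add: ext_cls)
qed

text \<open>Whiskering inside the feedback is whiskering outside by strength, and tightening lets
  \<open>Mu F\<close> in and out of the loop.\<close>

lemma ext_extend:
  assumes f: "(s, f) \<in> proc A B" and [simp]: "A \<in> Obj C" "B \<in> Obj C" "D \<in> Obj C"
  shows "Mu F A D \<Zcomp>\<^bsub>C'\<^esub> ext_arr (cls (A \<odot> D) (B \<odot> D) s (extend C (OMap R s) A B D f))
    = ext_arr (cls A B s f) \<lhd>\<^bsub>C'\<^esub> OMap F D \<Zcomp>\<^bsub>C'\<^esub> Mu F B D"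
  using f by (simp add: ext_cls K.tightening_left K.strength_right K.tightening_right F.conj_Mu_extend)

lemma ext_under:
  assumes f: "(s, f) \<in> proc A B" and [simp]: "A \<in> Obj C" "B \<in> Obj C" "D \<in> Obj C"
  shows "Mu F D A \<Zcomp>\<^bsub>C'\<^esub> ext_arr (cls (D \<odot> A) (D \<odot> B) s (under C (OMap R s) A B D f))
    = OMap F D \<rhd>\<^bsub>C'\<^esub> ext_arr (cls A B s f) \<Zcomp>\<^bsub>C'\<^esub> Mu F D B"
  using f by (simp add: ext_cls K.tightening_left K.strength_left K.tightening_right F.conj_Mu_under)

lemma ext_ATensor_cls:
  assumes f: "(s, f) \<in> proc A B" and g: "(t, g) \<in> proc A' B'"
    and [simp]: "A \<in> Obj C" "B \<in> Obj C" "A' \<in> Obj C" "B' \<in> Obj C"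
  shows "(ext_arr (cls A B s f) \<otimes>\<^bsub>C'\<^esub> ext_arr (cls A' B' t g)) \<Zcomp>\<^bsub>C'\<^esub> Mu F B B' =
    Mu F A A' \<Zcomp>\<^bsub>C'\<^esub> ext_arr (cls A B s f \<otimes>\<^bsub>\<S>\<^esub> cls A' B' t g)"
  using f g by (simp add: cls_ATensor ext_Comp_cls F.D.ATensor_whisker F.D.assoc
    ext_extend[THEN F.D.Comp_eq_assoc] ext_under)

lemma symmetric_monoidal_functor_ext: "symmetric_monoidal_functor \<S> C' ext"
proof
  fix A B E
  show "Eps ext \<in> hom C' \<I>\<^bsub>C'\<^esub> (OMap ext \<I>\<^bsub>\<S>\<^esub>)" "is_iso C' (Eps ext)" by simp_all
  { assume "A \<in> Obj \<S>"
    then show "OMap ext A \<in> Obj C'" "AMap ext (\<one>\<^bsub>\<S>\<^esub> A) = \<one>\<^bsub>C'\<^esub> (OMap ext A)"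
      "(Eps ext \<otimes>\<^bsub>C'\<^esub> \<one>\<^bsub>C'\<^esub> (OMap ext A)) \<Zcomp>\<^bsub>C'\<^esub> Mu ext \<I>\<^bsub>\<S>\<^esub> A \<Zcomp>\<^bsub>C'\<^esub> AMap ext (\<lambda>\<^bsub>\<S>\<^esub>_ A) = \<lambda>\<^bsub>C'\<^esub>_ (OMap ext A)"
      "(\<one>\<^bsub>C'\<^esub> (OMap ext A) \<otimes>\<^bsub>C'\<^esub> Eps ext) \<Zcomp>\<^bsub>C'\<^esub> Mu ext A \<I>\<^bsub>\<S>\<^esub> \<Zcomp>\<^bsub>C'\<^esub> AMap ext (\<rho>\<^bsub>\<S>\<^esub> A) = \<rho>\<^bsub>C'\<^esub> (OMap ext A)"
      by (simp_all add: St_structure ext_iota_arr F.Mu_LUnitor F.Mu_RUnitor flip: iota_arr_Ide) }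
  { assume "A \<in> Obj \<S>" "B \<in> Obj \<S>"
    then show "Mu ext A B \<in> hom C' (OMap ext A \<odot>\<^bsub>C'\<^esub> OMap ext B) (OMap ext (A \<odot>\<^bsub>\<S>\<^esub> B))"
      "is_iso C' (Mu ext A B)"
      "Mu ext A B \<Zcomp>\<^bsub>C'\<^esub> AMap ext (\<sigma>\<^bsub>\<S>\<^esub> A B) = \<sigma>\<^bsub>C'\<^esub> (OMap ext A) (OMap ext B) \<Zcomp>\<^bsub>C'\<^esub> Mu ext B A"
      by (simp_all add: St_structure ext_iota_arr F.Mu_Symm) }
  { assume "A \<in> Obj \<S>" "B \<in> Obj \<S>" "E \<in> Obj \<S>"
    then show "(Mu ext A B \<otimes>\<^bsub>C'\<^esub> \<one>\<^bsub>C'\<^esub> (OMap ext E)) \<Zcomp>\<^bsub>C'\<^esub> Mu ext (A \<odot>\<^bsub>\<S>\<^esub> B) E \<Zcomp>\<^bsub>C'\<^esub> AMap ext (\<alpha>\<^bsub>\<S>\<^esub> A B E)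
      = \<alpha>\<^bsub>C'\<^esub> (OMap ext A) (OMap ext B) (OMap ext E) \<Zcomp>\<^bsub>C'\<^esub> (\<one>\<^bsub>C'\<^esub> (OMap ext A) \<otimes>\<^bsub>C'\<^esub> Mu ext B E)
        \<Zcomp>\<^bsub>C'\<^esub> Mu ext A (B \<odot>\<^bsub>\<S>\<^esub> E)"
      by (simp add: St_structure ext_iota_arr F.Mu_Assoc) }
next
  fix X A B Y D A' B'
  show "AMap ext X \<in> hom C' (OMap ext A) (OMap ext B)" if "X \<in> hom \<S> A B"
    using that by simp
  show "AMap ext (X \<Zcomp>\<^bsub>\<S>\<^esub> Y) = AMap ext X \<Zcomp>\<^bsub>C'\<^esub> AMap ext Y" if "X \<in> hom \<S> A B" "Y \<in> hom \<S> B D"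
    using that by (elim St_hom_cases) (simp add: ext_Comp_cls)
  show "(AMap ext X \<otimes>\<^bsub>C'\<^esub> AMap ext Y) \<Zcomp>\<^bsub>C'\<^esub> Mu ext B B' = Mu ext A A' \<Zcomp>\<^bsub>C'\<^esub> AMap ext (X \<otimes>\<^bsub>\<S>\<^esub> Y)"
    if "X \<in> hom \<S> A B" "Y \<in> hom \<S> A' B'"
    using that by (elim St_hom_cases) (simp add: ext_ATensor_cls)
qed

text \<open>The joining axiom opens the stored state as an outer loop, and tightening moves the
  structure maps \<open>Mu F\<close> out of the inner loop, which is then the value of the extension
  at \<open>X\<close>.\<close>

lemma ext_store:
  assumes "s \<in> Obj S" "A \<in> Obj C" "B \<in> Obj C" "X \<in> hom \<S> (OMap R s \<odot> A) (OMap R s \<odot> B)"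
  shows "ext_arr (store C S R s A B X) = fbk s (OMap F A) (OMap F B)
    (Mu F (OMap R s) A \<Zcomp>\<^bsub>C'\<^esub> ext_arr X \<Zcomp>\<^bsub>C'\<^esub> inv\<^bsub>C'\<^esub> (Mu F (OMap R s) B))"
proof -
  obtain r f where X: "X = cls (OMap R s \<odot> A) (OMap R s \<odot> B) r f" "r \<in> Obj S" "f \<in> Arr C"
    "Dom C f = OMap R r \<odot> (OMap R s \<odot> A)" "Cod C f = OMap R r \<odot> (OMap R s \<odot> B)"
    using assms(4) by (elim St_hom_cases)
  then show ?thesis
    using assms(1-3) by (simp add: cls_store ext_join)
      (simp add: ext_cls K.tightening_left K.tightening_right F.D.assoc)
qed

lemma mf_eq_iota_ext: "mf_eq C (mf_comp C' (iota C S R) ext) F"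
  by (simp add: mf_eq_def mf_comp_def ext_iota_arr flip: iota_arr_Ide)

lemma mf_eq_R\<iota>_ext: "mf_eq S (mf_comp C' R\<iota> ext) K"
  using mf_eq_iota_ext by (simp add: mf_eq_def R\<iota>_select mf_comp_def ext_iota_arr)

end

text \<open>Storing \<open>s\<close> in a stateless process gives the state
  \<open>\<I> \<odot> s\<close>, whose first component is deleted by the left unitor of
  \<open>S\<close>.\<close>

lemma (in stateful_processes) cls_eq_store_iota_arr:
  assumes "(s, f) \<in> proc A B" "A \<in> Obj C" "B \<in> Obj C"
  shows "cls A B s f = store C S R s A B (iota_arr C S R f)"
  using assms cls_join_LUnitor[of s A B f] by (simp add: iota_arr_cls cls_store R.unit_state_act)

theorem theorem5p6:
  fixes C :: "('o, 'a) smc"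
    and S :: "('s, 'h) smc"
    and R :: "('s, 'h, 'o, 'a) mfunctor"
  assumes "symmetric_monoidal_category C"
    and "symmetric_monoidal_category S"
    and "symmetric_monoidal_functor S C R"
  shows
    "symmetric_monoidal_functor C (St C S R) (iota C S R) \<and>
     structured_feedback_category (St C S R) S (mf_comp (St C S R) R (iota C S R)) (store C S R) \<and>
     (\<forall>(C' :: ('p, 'b) smc) (S' :: ('t, 'k) smc) R' fbk' F G.
        structured_feedback_category C' S' R' fbk' \<and>
        symmetric_monoidal_functor C C' F \<and>
        symmetric_monoidal_functor S S' G \<and>
        mf_eq S (mf_comp C' R F) (mf_comp C' G R')
        \<longrightarrow> (\<exists>F'.
              structured_feedback_functor
                (St C S R) S (mf_comp (St C S R) R (iota C S R)) (store C S R)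
                C' S' R' fbk' F' G \<and>
              mf_eq C (mf_comp C' (iota C S R) F') F \<and>
              (\<forall>F''.
                 structured_feedback_functor
                   (St C S R) S (mf_comp (St C S R) R (iota C S R)) (store C S R)
                   C' S' R' fbk' F'' G \<and>
                 mf_eq C (mf_comp C' (iota C S R) F'') F
                 \<longrightarrow> mf_eq (St C S R) F'' F')))"
proof -
  interpret stateful_processes C S R
    using assms(3) by (rule stateful_processes.intro)
  show ?thesis
  proof (intro conjI allI impI)
    show "symmetric_monoidal_functor C \<S> (iota C S R)"
      by (rule symmetric_monoidal_functor_iota)
    show sf: "structured_feedback_category \<S> S R\<iota> (store C S R)"
      by (rule structured_feedback_category_St)
    fix C' :: "('p, 'b) smc" and S' :: "('t, 'k) smc" and R' fbk' F G
    assume "structured_feedback_category C' S' R' fbk' \<and> symmetric_monoidal_functor C C' F \<and>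
      symmetric_monoidal_functor S S' G \<and> mf_eq S (mf_comp C' R F) (mf_comp C' G R')"
    then have sf': "structured_feedback_category C' S' R' fbk'" and F: "symmetric_monoidal_functor C C' F"
      and G: "symmetric_monoidal_functor S S' G" and eq: "mf_eq S (mf_comp C' R F) (mf_comp C' G R')"
      by auto
    \<comment> \<open>Feedback re-indexed along \<open>G\<close> naturally lives over
      \<open>G ; R'\<close>; the commuting square moves it to \<open>R ; F\<close>, over which the
      extension is defined.\<close>
    have "structured_feedback_category C' S (mf_comp C' R F) (\<lambda>s. fbk' (OMap G s))"
    proof (rule structured_feedback_category_mf_eq)
      show "structured_feedback_category C' S (mf_comp C' G R') (\<lambda>s. fbk' (OMap G s))"
        using sf' G by (rule structured_feedback_category_pullback)
      show "symmetric_monoidal_functor S C' (mf_comp C' R F)"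
        using assms(3) F by (rule symmetric_monoidal_functor_mf_comp)
      show "mf_eq S (mf_comp C' G R') (mf_comp C' R F)"
        using eq by (simp add: mf_eq_def)
    qed
    then interpret E: stateful_extension C S R C' F "\<lambda>s. fbk' (OMap G s)"
      using F by (intro stateful_extension.intro stateful_processes_axioms)
    show "\<exists>F'. structured_feedback_functor \<S> S R\<iota> (store C S R) C' S' R' fbk' F' G \<and>
      mf_eq C (mf_comp C' (iota C S R) F') F \<and>
      (\<forall>F''. structured_feedback_functor \<S> S R\<iota> (store C S R) C' S' R' fbk' F'' G \<and>
         mf_eq C (mf_comp C' (iota C S R) F'') F \<longrightarrow> mf_eq \<S> F'' F')"
    proof (intro exI[of _ E.ext] conjI allI impI)
      show "structured_feedback_functor \<S> S R\<iota> (store C S R) C' S' R' fbk' E.ext G"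
      proof (intro structured_feedback_functor.intro structured_feedback_functor_axioms.intro
          sf sf' G E.symmetric_monoidal_functor_ext)
        show "mf_eq S (mf_comp C' R\<iota> E.ext) (mf_comp C' G R')"
          using E.mf_eq_R\<iota>_ext eq by (simp add: mf_eq_def)
        show "AMap E.ext (store C S R s A B X) = fbk' (OMap G s) (OMap E.ext A) (OMap E.ext B)
          (Mu E.ext (OMap R\<iota> s) A \<Zcomp>\<^bsub>C'\<^esub> AMap E.ext X \<Zcomp>\<^bsub>C'\<^esub> inv\<^bsub>C'\<^esub> (Mu E.ext (OMap R\<iota> s) B))"
          if "s \<in> Obj S" "A \<in> Obj \<S>" "B \<in> Obj \<S>"
            "X \<in> hom \<S> (OMap R\<iota> s \<odot>\<^bsub>\<S>\<^esub> A) (OMap R\<iota> s \<odot>\<^bsub>\<S>\<^esub> B)" for s A B X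
          using that E.ext_store[of s A B X] by (simp add: R\<iota>_select)
      qed
      show "mf_eq C (mf_comp C' (iota C S R) E.ext) F"
        by (rule E.mf_eq_iota_ext)
      fix F''
      assume "structured_feedback_functor \<S> S R\<iota> (store C S R) C' S' R' fbk' F'' G \<and>
        mf_eq C (mf_comp C' (iota C S R) F'') F"
      then have sff: "structured_feedback_functor \<S> S R\<iota> (store C S R) C' S' R' fbk' F'' G"
        and eq'': "mf_eq C (mf_comp C' (iota C S R) F'') F" by auto
      interpret F'': structured_feedback_functor \<S> S R\<iota> "store C S R" C' S' R' fbk' F'' G by (rule sff)
      \<comment> \<open>The structure maps of \<iota> are identities, so its composite with
        \<open>F''\<close> has the structure maps of \<open>F''\<close>, and comparing with
        \<open>F\<close> leaves open only the arrows outside the image of \<iota>.\<close>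
      have O: "OMap F'' A = OMap F A" if "A \<in> Obj C" for A
        using eq'' that by (simp add: mf_eq_def mf_comp_def)
      have A: "AMap F'' (iota_arr C S R f) = AMap F f" if "f \<in> Arr C" for f
        using eq'' that by (simp add: mf_eq_def mf_comp_def)
      have e: "Eps F'' = Eps F"
        using eq'' by (simp add: mf_eq_def mf_comp_def)
      have m: "Mu F'' A B = Mu F A B" if "A \<in> Obj C" "B \<in> Obj C" for A B
        using eq'' that by (simp add: mf_eq_def mf_comp_def)
      have "AMap F'' X = E.ext_arr X" if "X \<in> Arr \<S>" for X
      proof -
        obtain A B s f where X: "X = cls A B s f" "A \<in> Obj C" "B \<in> Obj C" "s \<in> Obj S" "f \<in> Arr C"
          "Dom C f = OMap R s \<odot>\<^bsub>C\<^esub> A" "Cod C f = OMap R s \<odot>\<^bsub>C\<^esub> B"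
          using \<open>X \<in> Arr \<S>\<close> by (elim St_Arr_cases)
        \<comment> \<open>Every arrow of \<open>St\<close> is a stored stateless one. Preservation
          of feedback thus expresses its image by data on which \<open>F''\<close> agrees with
          \<open>F\<close>, and the extension satisfies the same equation.\<close>
        have "AMap F'' (store C S R s A B (iota_arr C S R f)) = fbk' (OMap G s) (OMap F A) (OMap F B)
          (Mu F (OMap R s) A \<Zcomp>\<^bsub>C'\<^esub> AMap F f \<Zcomp>\<^bsub>C'\<^esub> inv\<^bsub>C'\<^esub> (Mu F (OMap R s) B))"
          using X F''.preserves_fbk[of s A B "iota_arr C S R f"] by (simp add: R\<iota>_select O A m)
        also have "\<dots> = E.ext_arr (store C S R s A B (iota_arr C S R f))"
          using X E.ext_store[of s A B "iota_arr C S R f"] by (simp add: E.ext_iota_arr)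
        finally show ?thesis
          using X cls_eq_store_iota_arr[of s f A B] by simp
      qed
      then show "mf_eq \<S> F'' E.ext"
        by (simp add: mf_eq_def O e m)
    qed
  qed
qed

end
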